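(* Let $\mathcal K$ be a PIE-complete $2$-category, $(\Sigma,\sigma)$ a signature pair, $T$ a bialgebraic $\sigma$-theory, and $(F,\eta)\colon M\to N$ a lax morphism of $\Sigma$-models in $\mathcal K$. Assume: 1. $\eta_t\colon N(t)F_0\Rightarrow F_cM(t)$ is an isomorphism for every function coarity term $t\colon c$; 2. for every equational coarity term $t\colon c$, the $2$-cell $\eta_t*u_Me_M\colon N(t)F_0u_Me_M\Rightarrow F_cM(t)u_Me_M$ is monic (as a morphism of the category $\mathcal K(M^T,N_c)$). Then there is a unique morphism $F^T\colon M^T\to N^T$ such that $e_NF^T=F^\sigma e_M$. Here $F^\sigma\colon M^\sigma\to N^\sigma$ is the unique $1$-cell (which exists by assumption 1) satisfying $u_NF^\sigma=F_0u_M$ and $$\phi_N*F^\sigma=(\eta_{t_2}^{-1}*u_M)_f\bullet\Big(\big(\textstyle\prod_{f}F_{c}\big)*\phi_M\Big)\bullet(\eta_{t_1}*u_M)_f ,$$ the indexing being over the function symbols $f\colon t_1\to t_2\colon c$ of $\sigma$.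
   Context: 2-categories. A 2-category is strict; $\bullet$ is vertical composition of 2-cells, juxtaposition (or $\circ$) is composition of 1-cells, $*$ is horizontal composition of 2-cells, and in whiskerings a 1-cell $h$ stands for $\mathrm{id}_h$. All 2-limits are strict. Product $\prod_i c_i$ with projections $\pi_i$: families of 1-cells $x\to c_i$, resp. of 2-cells between such, correspond uniquely to 1-cells $x\to\prod_i c_i$, resp. 2-cells; notation $(f_i)_i$, $(\alpha_i)_i$. Inserter of $f,g\colon c\to d$: an object $\mathrm{Ins}(f,g)$ with a 1-cell $u\colon\mathrm{Ins}(f,g)\to c$ and a 2-cell $\phi\colon fu\Rightarrow gu$ such that (i) for each $h'\colon x\to c$ and $\alpha\colon fh'\Rightarrow gh'$ there is a unique $h$ with $h'=uh$, $\alpha=\phi*h$; (ii) for $h_1,h_2\colon x\to\mathrm{Ins}(f,g)$ and $\alpha'\colon uh_1\Rightarrow uh_2$ with $(g*\alpha')\bullet(\phi*h_1)=(\phi*h_2)\bullet(f*\alpha')$ there is a unique $\alpha\colon h_1\Rightarrow h_2$ with $\alpha'=u*\alpha$. Equifier of $\eta,\theta\colon f\Rightarrow g\colon c\to d$: an object $\mathrm{Eq}(\eta,\theta)$ with a 1-cell $u\colon \mathrm{Eq}(\eta,\theta)\to c$, $\eta*u=\theta*u$, such that every $h'\colon x\to c$ with $\eta*h'=\theta*h'$ factors uniquely as $h'=uh$, and $u*(-)\colon\mathcal K(x,\mathrm{Eq}(\eta,\theta))\to\mathcal K(x,c)$ is fully faithful for all $x$. $\mathcal K$ is PIE-complete if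 it has small products, inserters and equifiers. Syntax. A 2-signature $\Sigma=(C,\mathcal F,\mathcal T)$ consists of: a small set $C$ of category symbols; a small set $\mathcal F$ of functor symbols, each with a type $B\colon c_1\cdots c_n\to d$ ($n\ge 0$, $c_i,d\in C$); a set $V$ of variables typed in $C$, countably infinitely many of each type; and a small set $\mathcal T$ of transformation symbols $\alpha^{\bar x}\colon t_1\to t_2$, where $\bar x$ is a context (finite sequence of distinct variables) and $t_1,t_2\in\mathrm{Term}^\Sigma_V$ are terms of the same type whose variables all occur in $\bar x$. For a set $X$ typed in $C$, $\mathrm{Term}^\Sigma_X$ is generated recursively: each $x\colon c$ in $X$ is a term of type $c$, and $B(t_1,\dots,t_n)$ is a term of type $d$ for $B\colon c_1\cdots c_n\to d$ in $\mathcal F$ and terms $t_i\colon c_i$. A 1-signature $\sigma$ relative to $\Sigma$ consists of a small set $S$ of sorts, each $s\in S$ having a type $c_s\in C$, and a small set of function symbols $f\colon t_1\to t_2\colon c$, with $t_1,t_2\in\mathrm{Term}^\Sigma_S$ of common type $c$. $(\Sigma,\sigma)$ is then a signature pair. $t^{\bar x}(t_1',\dots,t_n')$ denotes substitution of $t_i'$ for $x_i$. The term graph $G_\sigma$ has vertices $\mathrm{Term}^\Sigma_S$ and arrows generated recursively by: each function symbol $f\colon t_1\to t_2$; arrows $\alpha_{t_1',\dots,t_n'}\colon t_1^{\bar x}(t_1',\dots,t_n')\to t_2^{\bar x}(t_1',\dots,t_n')$ for $\alpha^{\bar x}\colon t_1\to t_2$ in $\mathcal T$ and terms $t_i'\in\mathrm{Term}^\Sigma_S$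 of the type of $x_i$; and arrows $B(t_1',\dots,q,\dots,t_n')\colon B(t_1',\dots,t_i',\dots,t_n')\to B(t_1',\dots,t_i'',\dots,t_n')$ for $B\in\mathcal F$ and an arrow $q\colon t_i'\to t_i''$. A $\sigma$-equation is a parallel pair of paths $(p,q\colon t_1\to t_2\colon c)$ in $G_\sigma$; a bialgebraic $\sigma$-theory $T$ is a set of $\sigma$-equations. Function arity (coarity) terms are the domains (codomains) of function symbols of $\sigma$; equational arity (coarity) terms are the domains (codomains) of the equations in $T$. Models. A $\Sigma$-model $M$ in $\mathcal K$ assigns an object $M_c$ to each $c\in C$ (with $M_{\bar c}=\prod_i M_{c_i}$ for $\bar c=c_1\cdots c_n$, and $M_{\bar x}=\prod_i M_{c_i}$ for $\bar x=(x_1\colon c_1,\dots,x_n\colon c_n)$), a 1-cell $M(B)\colon M_{\bar c}\to M_d$ to each $B\colon\bar c\to d$ (giving for each term $t\colon c$ in context $\bar x$ a 1-cell $M_{\bar x}(t)\colon M_{\bar x}\to M_c$ by $M_{\bar x}(x_i)=\pi_i$, $M_{\bar x}(B(t_1,\dots,t_n))=M(B)(M_{\bar x}(t_1),\dots,M_{\bar x}(t_n))$), and a 2-cell $M(\alpha)\colon M_{\bar x}(t_1)\Rightarrow M_{\bar x}(t_2)$ to each $\alpha^{\bar x}\colon t_1\to t_2$ in $\mathcal T$. Put $M_0=\prod_{s\in S}M_{c_s}$, and for $t\colon c$ in $\mathrm{Term}^\Sigma_S$ define $M(t)\colon M_0\to M_c$ by $M(s)=\pi_s$, $M(B(t_1,\dots,t_n))=M(B)(M(t_1),\dots,M(t_n))$.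 $M^\sigma$ is the inserter of $(M(t_1))_f,(M(t_2))_f\colon M_0\to\prod_{f\colon t_1\to t_2\colon c}M_c$ (over function symbols $f$ of $\sigma$), with 1-cell $u_M\colon M^\sigma\to M_0$ and 2-cell $\phi_M$; put $M^\sigma(t)=M(t)u_M$. For arrows $p\colon t_1\to t_2\colon c$ of $G_\sigma$ define $\bar p_M\colon M^\sigma(t_1)\Rightarrow M^\sigma(t_2)$ by: $\bar f_M=\pi_f*\phi_M$; $\overline{\alpha_{t_1',\dots,t_n'}}_M=M(\alpha)*(M^\sigma(t_1'),\dots,M^\sigma(t_n'))$; $\overline{B(t_1',\dots,q,\dots,t_n')}_M=M(B)*(M^\sigma(t_1'),\dots,\bar q_M,\dots,M^\sigma(t_n'))$; extend to paths by vertical composition. The object of $T$-bialgebras $M^T$, with 1-cell $e_M\colon M^T\to M^\sigma$, is the equifier of $(\bar p_M)_{(p,q)\in T}$ and $(\bar q_M)_{(p,q)\in T}\colon (M^\sigma(t_1))\Rightarrow(M^\sigma(t_2))\colon M^\sigma\to\prod_{(p,q\colon t_1\to t_2\colon c)\in T}M_c$. Lax morphisms. A lax morphism $(F,\eta)\colon M\to N$ of $\Sigma$-models consists of 1-cells $F_c\colon M_c\to N_c$ for $c\in C$ (with $F_{\bar c}=\prod_i F_{c_i}$, similarly $F_{\bar x}$) and 2-cells $\eta^B\colon N(B)F_{\bar c}\Rightarrow F_dM(B)$ for $B\colon\bar c\to d$ in $\mathcal F$, such that $(F_c*M(\theta))\bullet\eta_{t_1,\bar x}=\eta_{t_2,\bar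 x}\bullet(N(\theta)*F_{\bar x})$ for every $\theta^{\bar x}\colon t_1\to t_2$ of type $c$ in $\mathcal T$. Here $\eta_{t,\bar x}\colon N_{\bar x}(t)F_{\bar x}\Rightarrow F_cM_{\bar x}(t)$ is the identity if $t=x_i$, and for $t=B(t_1,\dots,t_n)$ it is $\eta^B(M_{\bar x}(t_1),\dots,M_{\bar x}(t_n))\bullet N(B)(\eta_{t_1,\bar x},\dots,\eta_{t_n,\bar x})$. Put $F_0=\prod_{s\in S}F_{c_s}\colon M_0\to N_0$ and define $\eta_t\colon N(t)F_0\Rightarrow F_cM(t)$ for $t\colon c$ in $\mathrm{Term}_S^\Sigma$ by the same recursion: identity for a sort, and $\eta_{B(t_1,\dots,t_n)}=\eta^B(M(t_1),\dots,M(t_n))\bullet N(B)(\eta_{t_1},\dots,\eta_{t_n})$. *)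

theory Defs
  imports Main "HOL-Library.Infinite_Typeclass"
begin

section \<open>Strict 2-categories\<close>

text \<open>1-cells and 2-cells are composed right to left:
  \<open>g \<cdot> f\<close> is \<open>g\<close> after \<open>f\<close>, \<open>\<beta> \<bullet> \<alpha>\<close> is the vertical composite \<open>\<beta>\<close> after \<open>\<alpha>\<close>, and
  \<open>\<beta> \<star> \<alpha>\<close> is the horizontal composite of \<open>\<alpha> : f \<Rightarrow> f' : x \<rightarrow> y\<close> and \<open>\<beta> : g \<Rightarrow> g' : y \<rightarrow> z\<close>.
  The operations are constrained on composable arguments only.\<close>

record ('o, 'm, 't) two_cat =
  Obj :: "'o set"
  Arr :: "'m set"
  Cell :: "'t set"
  Src :: "'m \<Rightarrow> 'o"
  Tgt :: "'m \<Rightarrow> 'o"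
  Dom :: "'t \<Rightarrow> 'm"
  Cod :: "'t \<Rightarrow> 'm"
  Id1 :: "'o \<Rightarrow> 'm"
  Id2 :: "'m \<Rightarrow> 't"
  comp1 :: "'m \<Rightarrow> 'm \<Rightarrow> 'm"  (infixr "\<cdot>\<index>" 75)
  vcomp :: "'t \<Rightarrow> 't \<Rightarrow> 't"  (infixr "\<bullet>\<index>" 70)
  hcomp :: "'t \<Rightarrow> 't \<Rightarrow> 't"  (infixr "\<star>\<index>" 75)

definition hom1 :: "('o, 'm, 't) two_cat \<Rightarrow> 'o \<Rightarrow> 'o \<Rightarrow> 'm set" where
  "hom1 K x y = {f \<in> Arr K. Src K f = x \<and> Tgt K f = y}"

definition hom2 :: "('o, 'm, 't) two_cat \<Rightarrow> 'm \<Rightarrow> 'm \<Rightarrow> 't set" where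
  "hom2 K f g = {\<alpha> \<in> Cell K. Dom K \<alpha> = f \<and> Cod K \<alpha> = g}"

definition lwhisk :: "('o, 'm, 't) two_cat \<Rightarrow> 'm \<Rightarrow> 't \<Rightarrow> 't" where
  "lwhisk K h \<alpha> = Id2 K h \<star>\<^bsub>K\<^esub> \<alpha>"

definition rwhisk :: "('o, 'm, 't) two_cat \<Rightarrow> 't \<Rightarrow> 'm \<Rightarrow> 't" where
  "rwhisk K \<alpha> h = \<alpha> \<star>\<^bsub>K\<^esub> Id2 K h"

locale two_category =
  fixes K :: "('o, 'm, 't) two_cat" (structure)
  assumes Src_Obj: "f \<in> Arr K \<Longrightarrow> Src K f \<in> Obj K"
    and Tgt_Obj: "f \<in> Arr K \<Longrightarrow> Tgt K f \<in> Obj K"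
    and Id1_hom: "x \<in> Obj K \<Longrightarrow> Id1 K x \<in> hom1 K x x"
    and comp1_hom: "\<lbrakk>f \<in> hom1 K x y; g \<in> hom1 K y z\<rbrakk> \<Longrightarrow> g \<cdot> f \<in> hom1 K x z"
    and comp1_Id1_left: "f \<in> hom1 K x y \<Longrightarrow> Id1 K y \<cdot> f = f"
    and comp1_Id1_right: "f \<in> hom1 K x y \<Longrightarrow> f \<cdot> Id1 K x = f"
    and comp1_assoc: "\<lbrakk>f \<in> hom1 K w x; g \<in> hom1 K x y; h \<in> hom1 K y z\<rbrakk>
           \<Longrightarrow> (h \<cdot> g) \<cdot> f = h \<cdot> (g \<cdot> f)"
    and Dom_Arr: "\<alpha> \<in> Cell K \<Longrightarrow> Dom K \<alpha> \<in> Arr K"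
    and Cod_Arr: "\<alpha> \<in> Cell K \<Longrightarrow> Cod K \<alpha> \<in> Arr K"
    and Cell_Src: "\<alpha> \<in> Cell K \<Longrightarrow> Src K (Cod K \<alpha>) = Src K (Dom K \<alpha>)"
    and Cell_Tgt: "\<alpha> \<in> Cell K \<Longrightarrow> Tgt K (Cod K \<alpha>) = Tgt K (Dom K \<alpha>)"
    and Id2_hom: "f \<in> Arr K \<Longrightarrow> Id2 K f \<in> hom2 K f f"
    and vcomp_hom: "\<lbrakk>\<alpha> \<in> hom2 K f g; \<beta> \<in> hom2 K g h\<rbrakk> \<Longrightarrow> \<beta> \<bullet> \<alpha> \<in> hom2 K f h"
    and vcomp_Id2_left: "\<alpha> \<in> hom2 K f g \<Longrightarrow> Id2 K g \<bullet> \<alpha> = \<alpha>"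
    and vcomp_Id2_right: "\<alpha> \<in> hom2 K f g \<Longrightarrow> \<alpha> \<bullet> Id2 K f = \<alpha>"
    and vcomp_assoc: "\<lbrakk>\<alpha> \<in> hom2 K f g; \<beta> \<in> hom2 K g h; \<gamma> \<in> hom2 K h k\<rbrakk>
           \<Longrightarrow> (\<gamma> \<bullet> \<beta>) \<bullet> \<alpha> = \<gamma> \<bullet> (\<beta> \<bullet> \<alpha>)"
    and hcomp_hom: "\<lbrakk>\<alpha> \<in> hom2 K f f'; \<beta> \<in> hom2 K g g'; Src K g = Tgt K f\<rbrakk>
           \<Longrightarrow> \<beta> \<star> \<alpha> \<in> hom2 K (g \<cdot> f) (g' \<cdot> f')"
    and hcomp_Id_left: "\<lbrakk>\<alpha> \<in> hom2 K f f'; Tgt K f = y\<rbrakk> \<Longrightarrow> Id2 K (Id1 K y) \<star> \<alpha> = \<alpha>"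
    and hcomp_Id_right: "\<lbrakk>\<alpha> \<in> hom2 K f f'; Src K f = x\<rbrakk> \<Longrightarrow> \<alpha> \<star> Id2 K (Id1 K x) = \<alpha>"
    and hcomp_assoc: "\<lbrakk>\<alpha> \<in> hom2 K f f'; \<beta> \<in> hom2 K g g'; \<gamma> \<in> hom2 K h h';
           Src K g = Tgt K f; Src K h = Tgt K g\<rbrakk> \<Longrightarrow> (\<gamma> \<star> \<beta>) \<star> \<alpha> = \<gamma> \<star> (\<beta> \<star> \<alpha>)"
    and hcomp_Id2: "\<lbrakk>f \<in> hom1 K x y; g \<in> hom1 K y z\<rbrakk> \<Longrightarrow> Id2 K g \<star> Id2 K f = Id2 K (g \<cdot> f)"
    and interchange: "\<lbrakk>\<alpha> \<in> hom2 K f f'; \<alpha>' \<in> hom2 K f' f''; \<beta> \<in> hom2 K g g'; \<beta>' \<in> hom2 K g' g'';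
           Src K g = Tgt K f\<rbrakk> \<Longrightarrow> (\<beta>' \<bullet> \<beta>) \<star> (\<alpha>' \<bullet> \<alpha>) = (\<beta>' \<star> \<alpha>') \<bullet> (\<beta> \<star> \<alpha>)"

definition inverse2 :: "('o, 'm, 't) two_cat \<Rightarrow> 't \<Rightarrow> 't \<Rightarrow> bool" where
  "inverse2 K \<alpha> \<beta> \<longleftrightarrow> \<alpha> \<in> Cell K \<and> \<beta> \<in> hom2 K (Cod K \<alpha>) (Dom K \<alpha>) \<and>
     \<beta> \<bullet>\<^bsub>K\<^esub> \<alpha> = Id2 K (Dom K \<alpha>) \<and> \<alpha> \<bullet>\<^bsub>K\<^esub> \<beta> = Id2 K (Cod K \<alpha>)"

definition iso2 :: "('o, 'm, 't) two_cat \<Rightarrow> 't \<Rightarrow> bool" where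
  "iso2 K \<alpha> \<longleftrightarrow> (\<exists>\<beta>. inverse2 K \<alpha> \<beta>)"

definition inv2 :: "('o, 'm, 't) two_cat \<Rightarrow> 't \<Rightarrow> 't" where
  "inv2 K \<alpha> = (THE \<beta>. inverse2 K \<alpha> \<beta>)"

definition monic2 :: "('o, 'm, 't) two_cat \<Rightarrow> 't \<Rightarrow> bool" where
  "monic2 K \<mu> \<longleftrightarrow> \<mu> \<in> Cell K \<and>
     (\<forall>h. \<forall>\<beta> \<in> hom2 K h (Dom K \<mu>). \<forall>\<gamma> \<in> hom2 K h (Dom K \<mu>).
        \<mu> \<bullet>\<^bsub>K\<^esub> \<beta> = \<mu> \<bullet>\<^bsub>K\<^esub> \<gamma> \<longrightarrow> \<beta> = \<gamma>)"


section \<open>Strict 2-limits\<close>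

definition is_product ::
    "('o, 'm, 't) two_cat \<Rightarrow> 'i set \<Rightarrow> ('i \<Rightarrow> 'o) \<Rightarrow> 'o \<Rightarrow> ('i \<Rightarrow> 'm) \<Rightarrow> bool" where
  "is_product K I c P \<pi> \<longleftrightarrow>
     P \<in> Obj K \<and> (\<forall>i\<in>I. \<pi> i \<in> hom1 K P (c i)) \<and>
     (\<forall>x\<in>Obj K. \<forall>f. (\<forall>i\<in>I. f i \<in> hom1 K x (c i)) \<longrightarrow>
        (\<exists>!h. h \<in> hom1 K x P \<and> (\<forall>i\<in>I. \<pi> i \<cdot>\<^bsub>K\<^esub> h = f i))) \<and>
     (\<forall>x\<in>Obj K. \<forall>h\<in>hom1 K x P. \<forall>k\<in>hom1 K x P. \<forall>\<alpha>.
        (\<forall>i\<in>I. \<alpha> i \<in> hom2 K (\<pi> i \<cdot>\<^bsub>K\<^esub> h) (\<pi> i \<cdot>\<^bsub>K\<^esub> k)) \<longrightarrow>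
        (\<exists>!\<beta>. \<beta> \<in> hom2 K h k \<and> (\<forall>i\<in>I. lwhisk K (\<pi> i) \<beta> = \<alpha> i)))"

definition is_inserter ::
    "('o, 'm, 't) two_cat \<Rightarrow> 'm \<Rightarrow> 'm \<Rightarrow> 'o \<Rightarrow> 'm \<Rightarrow> 't \<Rightarrow> bool" where
  "is_inserter K f g E u \<phi> \<longleftrightarrow>
     E \<in> Obj K \<and> u \<in> hom1 K E (Src K f) \<and> \<phi> \<in> hom2 K (f \<cdot>\<^bsub>K\<^esub> u) (g \<cdot>\<^bsub>K\<^esub> u) \<and>
     (\<forall>x\<in>Obj K. \<forall>h'\<in>hom1 K x (Src K f). \<forall>\<alpha>\<in>hom2 K (f \<cdot>\<^bsub>K\<^esub> h') (g \<cdot>\<^bsub>K\<^esub> h').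
        \<exists>!h. h \<in> hom1 K x E \<and> h' = u \<cdot>\<^bsub>K\<^esub> h \<and> \<alpha> = rwhisk K \<phi> h) \<and>
     (\<forall>x\<in>Obj K. \<forall>h1\<in>hom1 K x E. \<forall>h2\<in>hom1 K x E.
        \<forall>\<alpha>'\<in>hom2 K (u \<cdot>\<^bsub>K\<^esub> h1) (u \<cdot>\<^bsub>K\<^esub> h2).
        lwhisk K g \<alpha>' \<bullet>\<^bsub>K\<^esub> rwhisk K \<phi> h1 = rwhisk K \<phi> h2 \<bullet>\<^bsub>K\<^esub> lwhisk K f \<alpha>' \<longrightarrow>
        (\<exists>!\<alpha>. \<alpha> \<in> hom2 K h1 h2 \<and> \<alpha>' = lwhisk K u \<alpha>))"

definition is_equifier ::
    "('o, 'm, 't) two_cat \<Rightarrow> 't \<Rightarrow> 't \<Rightarrow> 'o \<Rightarrow> 'm \<Rightarrow> bool" where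
  "is_equifier K \<eta> \<theta> E u \<longleftrightarrow>
     E \<in> Obj K \<and> u \<in> hom1 K E (Src K (Dom K \<eta>)) \<and> rwhisk K \<eta> u = rwhisk K \<theta> u \<and>
     (\<forall>x\<in>Obj K. \<forall>h'\<in>hom1 K x (Src K (Dom K \<eta>)). rwhisk K \<eta> h' = rwhisk K \<theta> h' \<longrightarrow>
        (\<exists>!h. h \<in> hom1 K x E \<and> h' = u \<cdot>\<^bsub>K\<^esub> h)) \<and>
     (\<forall>x\<in>Obj K. \<forall>h1\<in>hom1 K x E. \<forall>h2\<in>hom1 K x E.
        \<forall>\<alpha>'\<in>hom2 K (u \<cdot>\<^bsub>K\<^esub> h1) (u \<cdot>\<^bsub>K\<^esub> h2).
        \<exists>!\<alpha>. \<alpha> \<in> hom2 K h1 h2 \<and> \<alpha>' = lwhisk K u \<alpha>)"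

text \<open>Smallness is relative to an arbitrary infinite type \<open>'u\<close>: a set is small if it injects
  into \<open>'u\<close>. All finite sets are small in this sense.\<close>

definition small :: "'u::infinite itself \<Rightarrow> 'a set \<Rightarrow> bool" where
  "small U A \<longleftrightarrow> (\<exists>e :: 'a \<Rightarrow> 'u. inj_on e A)"

text \<open>Products indexed by subsets of \<open>'u\<close> provide, by reindexing, products indexed by small
  sets of any type.\<close>

definition pie_complete :: "'u::infinite itself \<Rightarrow> ('o, 'm, 't) two_cat \<Rightarrow> bool" where
  "pie_complete U K \<longleftrightarrow>
     (\<forall>(I :: 'u set) c. (\<forall>i\<in>I. c i \<in> Obj K) \<longrightarrow> (\<exists>P \<pi>. is_product K I c P \<pi>)) \<and>
     (\<forall>c\<in>Obj K. \<forall>d\<in>Obj K. \<forall>f\<in>hom1 K c d. \<forall>g\<in>hom1 K c d. \<exists>E u \<phi>. is_inserter K f g E u \<phi>) \<and>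
     (\<forall>c\<in>Obj K. \<forall>d\<in>Obj K. \<forall>f\<in>hom1 K c d. \<forall>g\<in>hom1 K c d.
        \<forall>\<eta>\<in>hom2 K f g. \<forall>\<theta>\<in>hom2 K f g. \<exists>E u. is_equifier K \<eta> \<theta> E u)"

text \<open>Chosen limits. The defining predicates look at the family \<open>c\<close> on \<open>I\<close> only, so the choice
  does not depend on the values of \<open>c\<close> outside \<open>I\<close>.\<close>

definition some_product :: "('o, 'm, 't) two_cat \<Rightarrow> 'i set \<Rightarrow> ('i \<Rightarrow> 'o) \<Rightarrow> 'o \<times> ('i \<Rightarrow> 'm)" where
  "some_product K I c = (SOME (P, \<pi>). is_product K I c P \<pi>)"

definition prod_obj :: "('o, 'm, 't) two_cat \<Rightarrow> 'i set \<Rightarrow> ('i \<Rightarrow> 'o) \<Rightarrow> 'o" where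
  "prod_obj K I c = fst (some_product K I c)"

definition proj :: "('o, 'm, 't) two_cat \<Rightarrow> 'i set \<Rightarrow> ('i \<Rightarrow> 'o) \<Rightarrow> 'i \<Rightarrow> 'm" where
  "proj K I c = snd (some_product K I c)"

text \<open>The 1-cell \<open>(f\<^sub>i)\<^sub>i\<close> from \<open>x\<close> into the product, and the 2-cell \<open>(\<alpha>\<^sub>i)\<^sub>i\<close> between such.\<close>

definition tup1 ::
    "('o, 'm, 't) two_cat \<Rightarrow> 'i set \<Rightarrow> ('i \<Rightarrow> 'o) \<Rightarrow> 'o \<Rightarrow> ('i \<Rightarrow> 'm) \<Rightarrow> 'm" where
  "tup1 K I c x f =
     (THE h. h \<in> hom1 K x (prod_obj K I c) \<and> (\<forall>i\<in>I. proj K I c i \<cdot>\<^bsub>K\<^esub> h = f i))"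

definition tup2 ::
    "('o, 'm, 't) two_cat \<Rightarrow> 'i set \<Rightarrow> ('i \<Rightarrow> 'o) \<Rightarrow> 'o \<Rightarrow> ('i \<Rightarrow> 't) \<Rightarrow> 't" where
  "tup2 K I c x \<alpha> =
     (THE \<beta>. \<beta> \<in> hom2 K (tup1 K I c x (\<lambda>i. Dom K (\<alpha> i))) (tup1 K I c x (\<lambda>i. Cod K (\<alpha> i))) \<and>
        (\<forall>i\<in>I. lwhisk K (proj K I c i) \<beta> = \<alpha> i))"

definition prod_mor ::
    "('o, 'm, 't) two_cat \<Rightarrow> 'i set \<Rightarrow> ('i \<Rightarrow> 'o) \<Rightarrow> ('i \<Rightarrow> 'o) \<Rightarrow> ('i \<Rightarrow> 'm) \<Rightarrow> 'm" where
  "prod_mor K I c d f = tup1 K I d (prod_obj K I c) (\<lambda>i. f i \<cdot>\<^bsub>K\<^esub> proj K I c i)"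

definition lprod_obj :: "('o, 'm, 't) two_cat \<Rightarrow> 'o list \<Rightarrow> 'o" where
  "lprod_obj K cs = prod_obj K {..<length cs} (nth cs)"

definition lproj :: "('o, 'm, 't) two_cat \<Rightarrow> 'o list \<Rightarrow> nat \<Rightarrow> 'm" where
  "lproj K cs = proj K {..<length cs} (nth cs)"

definition ltup1 :: "('o, 'm, 't) two_cat \<Rightarrow> 'o list \<Rightarrow> 'o \<Rightarrow> 'm list \<Rightarrow> 'm" where
  "ltup1 K cs x fs = tup1 K {..<length cs} (nth cs) x (nth fs)"

definition ltup2 :: "('o, 'm, 't) two_cat \<Rightarrow> 'o list \<Rightarrow> 'o \<Rightarrow> 't list \<Rightarrow> 't" where
  "ltup2 K cs x \<alpha>s = tup2 K {..<length cs} (nth cs) x (nth \<alpha>s)"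

definition lprod_mor :: "('o, 'm, 't) two_cat \<Rightarrow> 'o list \<Rightarrow> 'o list \<Rightarrow> 'm list \<Rightarrow> 'm" where
  "lprod_mor K cs ds fs = prod_mor K {..<length cs} (nth cs) (nth ds) (nth fs)"

definition some_inserter :: "('o, 'm, 't) two_cat \<Rightarrow> 'm \<Rightarrow> 'm \<Rightarrow> 'o \<times> 'm \<times> 't" where
  "some_inserter K f g = (SOME (E, u, \<phi>). is_inserter K f g E u \<phi>)"

definition some_equifier :: "('o, 'm, 't) two_cat \<Rightarrow> 't \<Rightarrow> 't \<Rightarrow> 'o \<times> 'm" where
  "some_equifier K \<eta> \<theta> = (SOME (E, u). is_equifier K \<eta> \<theta> E u)"


section \<open>Signatures and terms\<close>

datatype (syms: 'b, atoms: 'x) trm = Atom 'x | App 'b "('b, 'x) trm list"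

record ('c, 'b, 'v, 'a) sig2 =
  cats :: "'c set"
  funs :: "'b set"
  fdom :: "'b \<Rightarrow> 'c list"
  fcod :: "'b \<Rightarrow> 'c"
  vars :: "'v set"
  vtype :: "'v \<Rightarrow> 'c"
  trans_syms :: "'a set"
  ctx :: "'a \<Rightarrow> 'v list"
  tdom :: "'a \<Rightarrow> ('b, 'v) trm"
  tcod :: "'a \<Rightarrow> ('b, 'v) trm"

text \<open>\<open>has_type \<Sigma> X \<tau> t c\<close>: \<open>t\<close> is a term of type \<open>c\<close> over the set \<open>X\<close> typed by \<open>\<tau>\<close>.\<close>

inductive has_type ::
    "('c, 'b, 'v, 'a) sig2 \<Rightarrow> 'x set \<Rightarrow> ('x \<Rightarrow> 'c) \<Rightarrow> ('b, 'x) trm \<Rightarrow> 'c \<Rightarrow> bool"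
  for \<Sigma> X \<tau> where
  Atom: "x \<in> X \<Longrightarrow> has_type \<Sigma> X \<tau> (Atom x) (\<tau> x)"
| App: "\<lbrakk>B \<in> funs \<Sigma>; list_all2 (has_type \<Sigma> X \<tau>) ts (fdom \<Sigma> B)\<rbrakk>
         \<Longrightarrow> has_type \<Sigma> X \<tau> (App B ts) (fcod \<Sigma> B)"

text \<open>The only possible type of a term.\<close>

primrec typ_of :: "('c, 'b, 'v, 'a) sig2 \<Rightarrow> ('x \<Rightarrow> 'c) \<Rightarrow> ('b, 'x) trm \<Rightarrow> 'c" where
  "typ_of \<Sigma> \<tau> (Atom x) = \<tau> x"
| "typ_of \<Sigma> \<tau> (App B ts) = fcod \<Sigma> B"

definition is_sig2 :: "'u::infinite itself \<Rightarrow> ('c, 'b, 'v, 'a) sig2 \<Rightarrow> bool" where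
  "is_sig2 U \<Sigma> \<longleftrightarrow>
     small U (cats \<Sigma>) \<and> small U (funs \<Sigma>) \<and> small U (trans_syms \<Sigma>) \<and>
     (\<forall>B\<in>funs \<Sigma>. set (fdom \<Sigma> B) \<subseteq> cats \<Sigma> \<and> fcod \<Sigma> B \<in> cats \<Sigma>) \<and>
     (\<forall>x\<in>vars \<Sigma>. vtype \<Sigma> x \<in> cats \<Sigma>) \<and>
     (\<forall>c\<in>cats \<Sigma>. \<exists>e :: nat \<Rightarrow> 'v. bij_betw e UNIV {x \<in> vars \<Sigma>. vtype \<Sigma> x = c}) \<and>
     (\<forall>\<alpha>\<in>trans_syms \<Sigma>.
        distinct (ctx \<Sigma> \<alpha>) \<and> set (ctx \<Sigma> \<alpha>) \<subseteq> vars \<Sigma> \<and>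
        atoms (tdom \<Sigma> \<alpha>) \<subseteq> set (ctx \<Sigma> \<alpha>) \<and> atoms (tcod \<Sigma> \<alpha>) \<subseteq> set (ctx \<Sigma> \<alpha>) \<and>
        (\<exists>c. has_type \<Sigma> (vars \<Sigma>) (vtype \<Sigma>) (tdom \<Sigma> \<alpha>) c \<and>
             has_type \<Sigma> (vars \<Sigma>) (vtype \<Sigma>) (tcod \<Sigma> \<alpha>) c))"

record ('c, 'b, 's, 'f) sig1 =
  sorts :: "'s set"
  stype :: "'s \<Rightarrow> 'c"
  fsyms :: "'f set"
  fsrc :: "'f \<Rightarrow> ('b, 's) trm"
  ftgt :: "'f \<Rightarrow> ('b, 's) trm"

abbreviation sterm ::
    "('c, 'b, 'v, 'a) sig2 \<Rightarrow> ('c, 'b, 's, 'f) sig1 \<Rightarrow> ('b, 's) trm \<Rightarrow> 'c \<Rightarrow> bool" where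
  "sterm \<Sigma> \<sigma> \<equiv> has_type \<Sigma> (sorts \<sigma>) (stype \<sigma>)"

abbreviation styp ::
    "('c, 'b, 'v, 'a) sig2 \<Rightarrow> ('c, 'b, 's, 'f) sig1 \<Rightarrow> ('b, 's) trm \<Rightarrow> 'c" where
  "styp \<Sigma> \<sigma> \<equiv> typ_of \<Sigma> (stype \<sigma>)"

definition is_sig1 ::
    "'u::infinite itself \<Rightarrow> ('c, 'b, 'v, 'a) sig2 \<Rightarrow> ('c, 'b, 's, 'f) sig1 \<Rightarrow> bool" where
  "is_sig1 U \<Sigma> \<sigma> \<longleftrightarrow>
     small U (sorts \<sigma>) \<and> small U (fsyms \<sigma>) \<and>
     (\<forall>s\<in>sorts \<sigma>. stype \<sigma> s \<in> cats \<Sigma>) \<and>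
     (\<forall>f\<in>fsyms \<sigma>. \<exists>c. sterm \<Sigma> \<sigma> (fsrc \<sigma> f) c \<and> sterm \<Sigma> \<sigma> (ftgt \<sigma> f) c)"

definition is_sig_pair ::
    "'u::infinite itself \<Rightarrow> ('c, 'b, 'v, 'a) sig2 \<Rightarrow> ('c, 'b, 's, 'f) sig1 \<Rightarrow> bool" where
  "is_sig_pair U \<Sigma> \<sigma> \<longleftrightarrow> is_sig2 U \<Sigma> \<and> is_sig1 U \<Sigma> \<sigma>"

primrec bind_trm :: "('x \<Rightarrow> ('b, 'y) trm) \<Rightarrow> ('b, 'x) trm \<Rightarrow> ('b, 'y) trm" where
  "bind_trm \<rho> (Atom x) = \<rho> x"
| "bind_trm \<rho> (App B ts) = App B (map (bind_trm \<rho>) ts)"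

definition subst :: "'x list \<Rightarrow> ('b, 'y) trm list \<Rightarrow> ('b, 'x) trm \<Rightarrow> ('b, 'y) trm" where
  "subst xs ts = bind_trm (\<lambda>x. the (map_of (zip xs ts) x))"


section \<open>The term graph, paths and bialgebraic theories\<close>

text \<open>\<open>GApp B ts q us\<close> is the arrow \<open>B(ts, q, us)\<close>: the terms \<open>ts\<close> and \<open>us\<close> precede and follow
  the argument position of the arrow \<open>q\<close>.\<close>

datatype ('b, 's, 'a, 'f) garrow =
  GFun 'f
| GTrans 'a "('b, 's) trm list"
| GApp 'b "('b, 's) trm list" "('b, 's, 'a, 'f) garrow" "('b, 's) trm list"

primrec gsrc ::
    "('c, 'b, 'v, 'a) sig2 \<Rightarrow> ('c, 'b, 's, 'f) sig1 \<Rightarrow> ('b, 's, 'a, 'f) garrow \<Rightarrow> ('b, 's) trm" where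
  "gsrc \<Sigma> \<sigma> (GFun f) = fsrc \<sigma> f"
| "gsrc \<Sigma> \<sigma> (GTrans \<alpha> ts) = subst (ctx \<Sigma> \<alpha>) ts (tdom \<Sigma> \<alpha>)"
| "gsrc \<Sigma> \<sigma> (GApp B ts q us) = App B (ts @ gsrc \<Sigma> \<sigma> q # us)"

primrec gtgt ::
    "('c, 'b, 'v, 'a) sig2 \<Rightarrow> ('c, 'b, 's, 'f) sig1 \<Rightarrow> ('b, 's, 'a, 'f) garrow \<Rightarrow> ('b, 's) trm" where
  "gtgt \<Sigma> \<sigma> (GFun f) = ftgt \<sigma> f"
| "gtgt \<Sigma> \<sigma> (GTrans \<alpha> ts) = subst (ctx \<Sigma> \<alpha>) ts (tcod \<Sigma> \<alpha>)"
| "gtgt \<Sigma> \<sigma> (GApp B ts q us) = App B (ts @ gtgt \<Sigma> \<sigma> q # us)"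

inductive is_garrow ::
    "('c, 'b, 'v, 'a) sig2 \<Rightarrow> ('c, 'b, 's, 'f) sig1 \<Rightarrow> ('b, 's, 'a, 'f) garrow \<Rightarrow> bool"
  for \<Sigma> \<sigma> where
  "f \<in> fsyms \<sigma> \<Longrightarrow> is_garrow \<Sigma> \<sigma> (GFun f)"
| "\<lbrakk>\<alpha> \<in> trans_syms \<Sigma>; list_all2 (sterm \<Sigma> \<sigma>) ts (map (vtype \<Sigma>) (ctx \<Sigma> \<alpha>))\<rbrakk>
     \<Longrightarrow> is_garrow \<Sigma> \<sigma> (GTrans \<alpha> ts)"
| "\<lbrakk>B \<in> funs \<Sigma>; is_garrow \<Sigma> \<sigma> q;
     list_all2 (sterm \<Sigma> \<sigma>) (ts @ gsrc \<Sigma> \<sigma> q # us) (fdom \<Sigma> B);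
     list_all2 (sterm \<Sigma> \<sigma>) (ts @ gtgt \<Sigma> \<sigma> q # us) (fdom \<Sigma> B)\<rbrakk>
     \<Longrightarrow> is_garrow \<Sigma> \<sigma> (GApp B ts q us)"

text \<open>A path is its starting vertex together with the list of its arrows, first arrow first.\<close>

type_synonym ('b, 's, 'a, 'f) gpath = "('b, 's) trm \<times> ('b, 's, 'a, 'f) garrow list"

type_synonym ('b, 's, 'a, 'f) eqn = "('b, 's, 'a, 'f) gpath \<times> ('b, 's, 'a, 'f) gpath"

fun is_gpath ::
    "('c, 'b, 'v, 'a) sig2 \<Rightarrow> ('c, 'b, 's, 'f) sig1 \<Rightarrow> ('b, 's, 'a, 'f) gpath \<Rightarrow> bool" where
  "is_gpath \<Sigma> \<sigma> (t, []) \<longleftrightarrow> (\<exists>c. sterm \<Sigma> \<sigma> t c)"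
| "is_gpath \<Sigma> \<sigma> (t, q # qs) \<longleftrightarrow>
     is_garrow \<Sigma> \<sigma> q \<and> gsrc \<Sigma> \<sigma> q = t \<and> is_gpath \<Sigma> \<sigma> (gtgt \<Sigma> \<sigma> q, qs)"

definition path_src :: "('b, 's, 'a, 'f) gpath \<Rightarrow> ('b, 's) trm" where
  "path_src p = fst p"

fun path_tgt ::
    "('c, 'b, 'v, 'a) sig2 \<Rightarrow> ('c, 'b, 's, 'f) sig1 \<Rightarrow> ('b, 's, 'a, 'f) gpath \<Rightarrow> ('b, 's) trm" where
  "path_tgt \<Sigma> \<sigma> (t, []) = t"
| "path_tgt \<Sigma> \<sigma> (t, q # qs) = path_tgt \<Sigma> \<sigma> (gtgt \<Sigma> \<sigma> q, qs)"

definition is_equation ::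
    "('c, 'b, 'v, 'a) sig2 \<Rightarrow> ('c, 'b, 's, 'f) sig1 \<Rightarrow> ('b, 's, 'a, 'f) eqn \<Rightarrow> bool" where
  "is_equation \<Sigma> \<sigma> = (\<lambda>(p, q). is_gpath \<Sigma> \<sigma> p \<and> is_gpath \<Sigma> \<sigma> q \<and>
     path_src p = path_src q \<and> path_tgt \<Sigma> \<sigma> p = path_tgt \<Sigma> \<sigma> q)"

text \<open>For a signature pair, smallness of \<open>T\<close> holds automatically, since equations are finite
  expressions over small sets of symbols.\<close>

definition is_theory ::
    "'u::infinite itself \<Rightarrow> ('c, 'b, 'v, 'a) sig2 \<Rightarrow> ('c, 'b, 's, 'f) sig1 \<Rightarrow>
       ('b, 's, 'a, 'f) eqn set \<Rightarrow> bool" where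
  "is_theory U \<Sigma> \<sigma> T \<longleftrightarrow> small U T \<and> (\<forall>e\<in>T. is_equation \<Sigma> \<sigma> e)"

definition fun_coarity_terms :: "('c, 'b, 's, 'f) sig1 \<Rightarrow> ('b, 's) trm set" where
  "fun_coarity_terms \<sigma> = ftgt \<sigma> ` fsyms \<sigma>"

definition eqn_coarity_terms ::
    "('c, 'b, 'v, 'a) sig2 \<Rightarrow> ('c, 'b, 's, 'f) sig1 \<Rightarrow> ('b, 's, 'a, 'f) eqn set \<Rightarrow>
       ('b, 's) trm set" where
  "eqn_coarity_terms \<Sigma> \<sigma> T = {path_tgt \<Sigma> \<sigma> p | p q. (p, q) \<in> T}"


section \<open>Models\<close>

record ('c, 'b, 'a, 'o, 'm, 't) model =
  Mob :: "'c \<Rightarrow> 'o"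
  Mfun :: "'b \<Rightarrow> 'm"
  Mtrans :: "'a \<Rightarrow> 't"

text \<open>\<open>eval K \<Sigma> M x a t\<close> is the 1-cell out of \<open>x\<close> denoted by \<open>t\<close> when the atoms denote the
  1-cells \<open>a\<close> out of \<open>x\<close>.\<close>

primrec eval ::
    "('o, 'm, 't) two_cat \<Rightarrow> ('c, 'b, 'v, 'a) sig2 \<Rightarrow> ('c, 'b, 'a, 'o, 'm, 't) model \<Rightarrow>
       'o \<Rightarrow> ('x \<Rightarrow> 'm) \<Rightarrow> ('b, 'x) trm \<Rightarrow> 'm" where
  "eval K \<Sigma> M x a (Atom y) = a y"
| "eval K \<Sigma> M x a (App B ts) =
     Mfun M B \<cdot>\<^bsub>K\<^esub> ltup1 K (map (Mob M) (fdom \<Sigma> B)) x (map (eval K \<Sigma> M x a) ts)"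

definition ctx_obs ::
    "('c, 'b, 'v, 'a) sig2 \<Rightarrow> ('c, 'b, 'a, 'o, 'm, 't) model \<Rightarrow> 'v list \<Rightarrow> 'o list" where
  "ctx_obs \<Sigma> M xs = map (\<lambda>x. Mob M (vtype \<Sigma> x)) xs"

definition ctx_proj ::
    "('o, 'm, 't) two_cat \<Rightarrow> ('c, 'b, 'v, 'a) sig2 \<Rightarrow> ('c, 'b, 'a, 'o, 'm, 't) model \<Rightarrow>
       'v list \<Rightarrow> 'v \<Rightarrow> 'm" where
  "ctx_proj K \<Sigma> M xs y = lproj K (ctx_obs \<Sigma> M xs) (THE i. i < length xs \<and> xs ! i = y)"

definition eval_ctx ::
    "('o, 'm, 't) two_cat \<Rightarrow> ('c, 'b, 'v, 'a) sig2 \<Rightarrow> ('c, 'b, 'a, 'o, 'm, 't) model \<Rightarrow>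
       'v list \<Rightarrow> ('b, 'v) trm \<Rightarrow> 'm" where
  "eval_ctx K \<Sigma> M xs = eval K \<Sigma> M (lprod_obj K (ctx_obs \<Sigma> M xs)) (ctx_proj K \<Sigma> M xs)"

definition is_model ::
    "('o, 'm, 't) two_cat \<Rightarrow> ('c, 'b, 'v, 'a) sig2 \<Rightarrow> ('c, 'b, 'a, 'o, 'm, 't) model \<Rightarrow> bool" where
  "is_model K \<Sigma> M \<longleftrightarrow>
     (\<forall>c\<in>cats \<Sigma>. Mob M c \<in> Obj K) \<and>
     (\<forall>B\<in>funs \<Sigma>.
        Mfun M B \<in> hom1 K (lprod_obj K (map (Mob M) (fdom \<Sigma> B))) (Mob M (fcod \<Sigma> B))) \<and>
     (\<forall>\<alpha>\<in>trans_syms \<Sigma>.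
        Mtrans M \<alpha> \<in> hom2 K (eval_ctx K \<Sigma> M (ctx \<Sigma> \<alpha>) (tdom \<Sigma> \<alpha>))
                            (eval_ctx K \<Sigma> M (ctx \<Sigma> \<alpha>) (tcod \<Sigma> \<alpha>)))"

definition base_obj ::
    "('o, 'm, 't) two_cat \<Rightarrow> ('c, 'b, 's, 'f) sig1 \<Rightarrow> ('c, 'b, 'a, 'o, 'm, 't) model \<Rightarrow> 'o" where
  "base_obj K \<sigma> M = prod_obj K (sorts \<sigma>) (\<lambda>s. Mob M (stype \<sigma> s))"

definition base_proj ::
    "('o, 'm, 't) two_cat \<Rightarrow> ('c, 'b, 's, 'f) sig1 \<Rightarrow> ('c, 'b, 'a, 'o, 'm, 't) model \<Rightarrow> 's \<Rightarrow> 'm" where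
  "base_proj K \<sigma> M = proj K (sorts \<sigma>) (\<lambda>s. Mob M (stype \<sigma> s))"

definition eval_s ::
    "('o, 'm, 't) two_cat \<Rightarrow> ('c, 'b, 'v, 'a) sig2 \<Rightarrow> ('c, 'b, 's, 'f) sig1 \<Rightarrow>
       ('c, 'b, 'a, 'o, 'm, 't) model \<Rightarrow> ('b, 's) trm \<Rightarrow> 'm" where
  "eval_s K \<Sigma> \<sigma> M = eval K \<Sigma> M (base_obj K \<sigma> M) (base_proj K \<sigma> M)"

text \<open>The family \<open>(M\<^sub>c)\<close> indexed by the function symbols \<open>f : t\<^sub>1 \<rightarrow> t\<^sub>2 : c\<close>.\<close>

definition fsym_ob ::
    "('c, 'b, 'v, 'a) sig2 \<Rightarrow> ('c, 'b, 's, 'f) sig1 \<Rightarrow> ('c, 'b, 'a, 'o, 'm, 't) model \<Rightarrow> 'f \<Rightarrow> 'o" where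
  "fsym_ob \<Sigma> \<sigma> M f = Mob M (styp \<Sigma> \<sigma> (ftgt \<sigma> f))"

definition alg ::
    "('o, 'm, 't) two_cat \<Rightarrow> ('c, 'b, 'v, 'a) sig2 \<Rightarrow> ('c, 'b, 's, 'f) sig1 \<Rightarrow>
       ('c, 'b, 'a, 'o, 'm, 't) model \<Rightarrow> 'o \<times> 'm \<times> 't" where
  "alg K \<Sigma> \<sigma> M = some_inserter K
     (tup1 K (fsyms \<sigma>) (fsym_ob \<Sigma> \<sigma> M) (base_obj K \<sigma> M) (\<lambda>f. eval_s K \<Sigma> \<sigma> M (fsrc \<sigma> f)))
     (tup1 K (fsyms \<sigma>) (fsym_ob \<Sigma> \<sigma> M) (base_obj K \<sigma> M) (\<lambda>f. eval_s K \<Sigma> \<sigma> M (ftgt \<sigma> f)))"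

definition alg_obj ::
    "('o, 'm, 't) two_cat \<Rightarrow> ('c, 'b, 'v, 'a) sig2 \<Rightarrow> ('c, 'b, 's, 'f) sig1 \<Rightarrow>
       ('c, 'b, 'a, 'o, 'm, 't) model \<Rightarrow> 'o"  \<comment> \<open>\<open>M\<^sup>\<sigma>\<close>\<close> where
  "alg_obj K \<Sigma> \<sigma> M = fst (alg K \<Sigma> \<sigma> M)"

definition alg_u ::
    "('o, 'm, 't) two_cat \<Rightarrow> ('c, 'b, 'v, 'a) sig2 \<Rightarrow> ('c, 'b, 's, 'f) sig1 \<Rightarrow>
       ('c, 'b, 'a, 'o, 'm, 't) model \<Rightarrow> 'm"  \<comment> \<open>\<open>u\<^sub>M\<close>\<close> where
  "alg_u K \<Sigma> \<sigma> M = fst (snd (alg K \<Sigma> \<sigma> M))"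

definition alg_phi ::
    "('o, 'm, 't) two_cat \<Rightarrow> ('c, 'b, 'v, 'a) sig2 \<Rightarrow> ('c, 'b, 's, 'f) sig1 \<Rightarrow>
       ('c, 'b, 'a, 'o, 'm, 't) model \<Rightarrow> 't"  \<comment> \<open>\<open>\<phi>\<^sub>M\<close>\<close> where
  "alg_phi K \<Sigma> \<sigma> M = snd (snd (alg K \<Sigma> \<sigma> M))"

definition eval_alg ::
    "('o, 'm, 't) two_cat \<Rightarrow> ('c, 'b, 'v, 'a) sig2 \<Rightarrow> ('c, 'b, 's, 'f) sig1 \<Rightarrow>
       ('c, 'b, 'a, 'o, 'm, 't) model \<Rightarrow> ('b, 's) trm \<Rightarrow> 'm"  \<comment> \<open>\<open>M\<^sup>\<sigma>(t)\<close>\<close> where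
  "eval_alg K \<Sigma> \<sigma> M t = eval_s K \<Sigma> \<sigma> M t \<cdot>\<^bsub>K\<^esub> alg_u K \<Sigma> \<sigma> M"

primrec arrow_cell ::
    "('o, 'm, 't) two_cat \<Rightarrow> ('c, 'b, 'v, 'a) sig2 \<Rightarrow> ('c, 'b, 's, 'f) sig1 \<Rightarrow>
       ('c, 'b, 'a, 'o, 'm, 't) model \<Rightarrow> ('b, 's, 'a, 'f) garrow \<Rightarrow> 't" where
  "arrow_cell K \<Sigma> \<sigma> M (GFun f) =
     lwhisk K (proj K (fsyms \<sigma>) (fsym_ob \<Sigma> \<sigma> M) f) (alg_phi K \<Sigma> \<sigma> M)"
| "arrow_cell K \<Sigma> \<sigma> M (GTrans \<alpha> ts) =
     rwhisk K (Mtrans M \<alpha>)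
       (ltup1 K (ctx_obs \<Sigma> M (ctx \<Sigma> \<alpha>)) (alg_obj K \<Sigma> \<sigma> M) (map (eval_alg K \<Sigma> \<sigma> M) ts))"
| "arrow_cell K \<Sigma> \<sigma> M (GApp B ts q us) =
     lwhisk K (Mfun M B)
       (ltup2 K (map (Mob M) (fdom \<Sigma> B)) (alg_obj K \<Sigma> \<sigma> M)
          (map (\<lambda>t. Id2 K (eval_alg K \<Sigma> \<sigma> M t)) ts
           @ arrow_cell K \<Sigma> \<sigma> M q
           # map (\<lambda>t. Id2 K (eval_alg K \<Sigma> \<sigma> M t)) us))"

fun path_cell ::
    "('o, 'm, 't) two_cat \<Rightarrow> ('c, 'b, 'v, 'a) sig2 \<Rightarrow> ('c, 'b, 's, 'f) sig1 \<Rightarrow>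
       ('c, 'b, 'a, 'o, 'm, 't) model \<Rightarrow> ('b, 's, 'a, 'f) gpath \<Rightarrow> 't" where
  "path_cell K \<Sigma> \<sigma> M (t, []) = Id2 K (eval_alg K \<Sigma> \<sigma> M t)"
| "path_cell K \<Sigma> \<sigma> M (t, q # qs) =
     path_cell K \<Sigma> \<sigma> M (gtgt \<Sigma> \<sigma> q, qs) \<bullet>\<^bsub>K\<^esub> arrow_cell K \<Sigma> \<sigma> M q"

definition eqn_ob ::
    "('c, 'b, 'v, 'a) sig2 \<Rightarrow> ('c, 'b, 's, 'f) sig1 \<Rightarrow> ('c, 'b, 'a, 'o, 'm, 't) model \<Rightarrow>
       ('b, 's, 'a, 'f) eqn \<Rightarrow> 'o" where
  "eqn_ob \<Sigma> \<sigma> M e = Mob M (styp \<Sigma> \<sigma> (path_tgt \<Sigma> \<sigma> (fst e)))"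

definition bialg ::
    "('o, 'm, 't) two_cat \<Rightarrow> ('c, 'b, 'v, 'a) sig2 \<Rightarrow> ('c, 'b, 's, 'f) sig1 \<Rightarrow>
       ('b, 's, 'a, 'f) eqn set \<Rightarrow> ('c, 'b, 'a, 'o, 'm, 't) model \<Rightarrow> 'o \<times> 'm" where
  "bialg K \<Sigma> \<sigma> T M = some_equifier K
     (tup2 K T (eqn_ob \<Sigma> \<sigma> M) (alg_obj K \<Sigma> \<sigma> M) (\<lambda>e. path_cell K \<Sigma> \<sigma> M (fst e)))
     (tup2 K T (eqn_ob \<Sigma> \<sigma> M) (alg_obj K \<Sigma> \<sigma> M) (\<lambda>e. path_cell K \<Sigma> \<sigma> M (snd e)))"

definition bialg_obj ::
    "('o, 'm, 't) two_cat \<Rightarrow> ('c, 'b, 'v, 'a) sig2 \<Rightarrow> ('c, 'b, 's, 'f) sig1 \<Rightarrow>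
       ('b, 's, 'a, 'f) eqn set \<Rightarrow> ('c, 'b, 'a, 'o, 'm, 't) model \<Rightarrow> 'o"  \<comment> \<open>\<open>M\<^sup>T\<close>\<close> where
  "bialg_obj K \<Sigma> \<sigma> T M = fst (bialg K \<Sigma> \<sigma> T M)"

definition bialg_e ::
    "('o, 'm, 't) two_cat \<Rightarrow> ('c, 'b, 'v, 'a) sig2 \<Rightarrow> ('c, 'b, 's, 'f) sig1 \<Rightarrow>
       ('b, 's, 'a, 'f) eqn set \<Rightarrow> ('c, 'b, 'a, 'o, 'm, 't) model \<Rightarrow> 'm"  \<comment> \<open>\<open>e\<^sub>M\<close>\<close> where
  "bialg_e K \<Sigma> \<sigma> T M = snd (bialg K \<Sigma> \<sigma> T M)"


section \<open>Lax morphisms\<close>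

record ('c, 'b, 'm, 't) lax_mor =
  Lmor :: "'c \<Rightarrow> 'm"
  Lcell :: "'b \<Rightarrow> 't"

text \<open>The recursion for \<open>\<eta>\<^sub>t\<close>, for terms over atoms typed by \<open>\<tau>\<close> that denote in \<open>M\<close> the
  1-cells \<open>a\<close> out of \<open>x\<close>. On an atom \<open>y\<close> of type \<open>c\<close> it is the identity of \<open>F\<^sub>c \<cdot> a y\<close>.\<close>

primrec eta ::
    "('o, 'm, 't) two_cat \<Rightarrow> ('c, 'b, 'v, 'a) sig2 \<Rightarrow>
       ('c, 'b, 'a, 'o, 'm, 't) model \<Rightarrow> ('c, 'b, 'a, 'o, 'm, 't) model \<Rightarrow>
       ('c, 'b, 'm, 't) lax_mor \<Rightarrow> ('x \<Rightarrow> 'c) \<Rightarrow> 'o \<Rightarrow> ('x \<Rightarrow> 'm) \<Rightarrow> ('b, 'x) trm \<Rightarrow> 't" where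
  "eta K \<Sigma> M N F \<tau> x a (Atom y) = Id2 K (Lmor F (\<tau> y) \<cdot>\<^bsub>K\<^esub> a y)"
| "eta K \<Sigma> M N F \<tau> x a (App B ts) =
     rwhisk K (Lcell F B) (ltup1 K (map (Mob M) (fdom \<Sigma> B)) x (map (eval K \<Sigma> M x a) ts))
     \<bullet>\<^bsub>K\<^esub> lwhisk K (Mfun N B) (ltup2 K (map (Mob N) (fdom \<Sigma> B)) x (map (eta K \<Sigma> M N F \<tau> x a) ts))"

definition eta_ctx ::
    "('o, 'm, 't) two_cat \<Rightarrow> ('c, 'b, 'v, 'a) sig2 \<Rightarrow>
       ('c, 'b, 'a, 'o, 'm, 't) model \<Rightarrow> ('c, 'b, 'a, 'o, 'm, 't) model \<Rightarrow>
       ('c, 'b, 'm, 't) lax_mor \<Rightarrow> 'v list \<Rightarrow> ('b, 'v) trm \<Rightarrow> 't" where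
  "eta_ctx K \<Sigma> M N F xs =
     eta K \<Sigma> M N F (vtype \<Sigma>) (lprod_obj K (ctx_obs \<Sigma> M xs)) (ctx_proj K \<Sigma> M xs)"

definition list_mor ::
    "('o, 'm, 't) two_cat \<Rightarrow> ('c, 'b, 'a, 'o, 'm, 't) model \<Rightarrow> ('c, 'b, 'a, 'o, 'm, 't) model \<Rightarrow>
       ('c, 'b, 'm, 't) lax_mor \<Rightarrow> 'c list \<Rightarrow> 'm" where
  "list_mor K M N F cs = lprod_mor K (map (Mob M) cs) (map (Mob N) cs) (map (Lmor F) cs)"

definition is_lax_mor ::
    "('o, 'm, 't) two_cat \<Rightarrow> ('c, 'b, 'v, 'a) sig2 \<Rightarrow>
       ('c, 'b, 'a, 'o, 'm, 't) model \<Rightarrow> ('c, 'b, 'a, 'o, 'm, 't) model \<Rightarrow>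
       ('c, 'b, 'm, 't) lax_mor \<Rightarrow> bool" where
  "is_lax_mor K \<Sigma> M N F \<longleftrightarrow>
     (\<forall>c\<in>cats \<Sigma>. Lmor F c \<in> hom1 K (Mob M c) (Mob N c)) \<and>
     (\<forall>B\<in>funs \<Sigma>. Lcell F B \<in> hom2 K (Mfun N B \<cdot>\<^bsub>K\<^esub> list_mor K M N F (fdom \<Sigma> B))
                                      (Lmor F (fcod \<Sigma> B) \<cdot>\<^bsub>K\<^esub> Mfun M B)) \<and>
     (\<forall>\<theta>\<in>trans_syms \<Sigma>.
        lwhisk K (Lmor F (typ_of \<Sigma> (vtype \<Sigma>) (tdom \<Sigma> \<theta>))) (Mtrans M \<theta>)
          \<bullet>\<^bsub>K\<^esub> eta_ctx K \<Sigma> M N F (ctx \<Sigma> \<theta>) (tdom \<Sigma> \<theta>)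
        = eta_ctx K \<Sigma> M N F (ctx \<Sigma> \<theta>) (tcod \<Sigma> \<theta>)
          \<bullet>\<^bsub>K\<^esub> rwhisk K (Mtrans N \<theta>) (list_mor K M N F (map (vtype \<Sigma>) (ctx \<Sigma> \<theta>))))"

definition base_mor ::
    "('o, 'm, 't) two_cat \<Rightarrow> ('c, 'b, 's, 'f) sig1 \<Rightarrow>
       ('c, 'b, 'a, 'o, 'm, 't) model \<Rightarrow> ('c, 'b, 'a, 'o, 'm, 't) model \<Rightarrow>
       ('c, 'b, 'm, 't) lax_mor \<Rightarrow> 'm"  \<comment> \<open>\<open>F\<^sub>0\<close>\<close> where
  "base_mor K \<sigma> M N F = prod_mor K (sorts \<sigma>) (\<lambda>s. Mob M (stype \<sigma> s)) (\<lambda>s. Mob N (stype \<sigma> s))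
     (\<lambda>s. Lmor F (stype \<sigma> s))"

definition eta_s ::
    "('o, 'm, 't) two_cat \<Rightarrow> ('c, 'b, 'v, 'a) sig2 \<Rightarrow> ('c, 'b, 's, 'f) sig1 \<Rightarrow>
       ('c, 'b, 'a, 'o, 'm, 't) model \<Rightarrow> ('c, 'b, 'a, 'o, 'm, 't) model \<Rightarrow>
       ('c, 'b, 'm, 't) lax_mor \<Rightarrow> ('b, 's) trm \<Rightarrow> 't" where
  "eta_s K \<Sigma> \<sigma> M N F = eta K \<Sigma> M N F (stype \<sigma>) (base_obj K \<sigma> M) (base_proj K \<sigma> M)"

text \<open>The two equations that determine \<open>F\<^sup>\<sigma> : M\<^sup>\<sigma> \<rightarrow> N\<^sup>\<sigma>\<close>.\<close>

definition is_alg_mor ::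
    "('o, 'm, 't) two_cat \<Rightarrow> ('c, 'b, 'v, 'a) sig2 \<Rightarrow> ('c, 'b, 's, 'f) sig1 \<Rightarrow>
       ('c, 'b, 'a, 'o, 'm, 't) model \<Rightarrow> ('c, 'b, 'a, 'o, 'm, 't) model \<Rightarrow>
       ('c, 'b, 'm, 't) lax_mor \<Rightarrow> 'm \<Rightarrow> bool" where
  "is_alg_mor K \<Sigma> \<sigma> M N F G \<longleftrightarrow>
     G \<in> hom1 K (alg_obj K \<Sigma> \<sigma> M) (alg_obj K \<Sigma> \<sigma> N) \<and>
     alg_u K \<Sigma> \<sigma> N \<cdot>\<^bsub>K\<^esub> G = base_mor K \<sigma> M N F \<cdot>\<^bsub>K\<^esub> alg_u K \<Sigma> \<sigma> M \<and>
     rwhisk K (alg_phi K \<Sigma> \<sigma> N) G =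
       tup2 K (fsyms \<sigma>) (fsym_ob \<Sigma> \<sigma> N) (alg_obj K \<Sigma> \<sigma> M)
         (\<lambda>f. rwhisk K (inv2 K (eta_s K \<Sigma> \<sigma> M N F (ftgt \<sigma> f))) (alg_u K \<Sigma> \<sigma> M))
       \<bullet>\<^bsub>K\<^esub> lwhisk K (prod_mor K (fsyms \<sigma>) (fsym_ob \<Sigma> \<sigma> M) (fsym_ob \<Sigma> \<sigma> N)
                      (\<lambda>f. Lmor F (styp \<Sigma> \<sigma> (ftgt \<sigma> f))))
              (alg_phi K \<Sigma> \<sigma> M)
       \<bullet>\<^bsub>K\<^esub> tup2 K (fsyms \<sigma>) (fsym_ob \<Sigma> \<sigma> N) (alg_obj K \<Sigma> \<sigma> M)
         (\<lambda>f. rwhisk K (eta_s K \<Sigma> \<sigma> M N F (fsrc \<sigma> f)) (alg_u K \<Sigma> \<sigma> M))"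

definition alg_mor ::
    "('o, 'm, 't) two_cat \<Rightarrow> ('c, 'b, 'v, 'a) sig2 \<Rightarrow> ('c, 'b, 's, 'f) sig1 \<Rightarrow>
       ('c, 'b, 'a, 'o, 'm, 't) model \<Rightarrow> ('c, 'b, 'a, 'o, 'm, 't) model \<Rightarrow>
       ('c, 'b, 'm, 't) lax_mor \<Rightarrow> 'm"  \<comment> \<open>\<open>F\<^sup>\<sigma>\<close>\<close> where
  "alg_mor K \<Sigma> \<sigma> M N F = (THE G. is_alg_mor K \<Sigma> \<sigma> M N F G)"

end

theory Submission
  imports Defs
begin

text \<open>The cells \<open>\<eta>\<^sub>t * u\<^sub>M\<close> are natural in the arrows \<open>p : t\<^sub>1 \<rightarrow> t\<^sub>2\<close> of the term graph:
  \<open>(F\<^sub>c * p\<^sub>M) \<bullet> (\<eta>\<^sub>t\<^sub>1 * u\<^sub>M) = (\<eta>\<^sub>t\<^sub>2 * u\<^sub>M) \<bullet> (p\<^sub>N * F\<^sup>\<sigma>)\<close>.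
  For function symbols this is the equation defining \<open>F\<^sup>\<sigma>\<close>; for transformation symbols it is the
  axiom on lax morphisms, transported along a substitution lemma for \<open>\<eta>\<close>; for \<open>B(\<dots>,q,\<dots>)\<close> it is
  the interchange law. Pasting gives the same for paths. If \<open>(p,q)\<close> is an equation then
  \<open>p\<^sub>M * e\<^sub>M = q\<^sub>M * e\<^sub>M\<close>, so \<open>p\<^sub>N * F\<^sup>\<sigma>e\<^sub>M\<close> and \<open>q\<^sub>N * F\<^sup>\<sigma>e\<^sub>M\<close> agree after composition with the
  monic cell \<open>\<eta>\<^sub>t\<^sub>2 * u\<^sub>Me\<^sub>M\<close>, and \<open>F\<^sup>\<sigma>e\<^sub>M\<close> factors through the equifier \<open>e\<^sub>N\<close>.

  Evaluation and \<open>\<eta>\<close> are treated for an arbitrary interpretation of the atoms by 1-cells out of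
  an object \<open>x\<close>. Whiskering with \<open>u\<^sub>M\<close> then amounts to reinterpreting the sorts in \<open>M\<^sup>\<sigma>\<close>.\<close>

section \<open>Whiskering\<close>

text \<open>Away from function coarity terms \<open>\<eta>_t\<close> need not be invertible, so
  \<open>p_N * F^\<sigma>\<close> cannot be computed from \<open>p_M\<close>; it is only constrained
  by a square, from which \<eta> at the target has to be cancelled on the left. The cancellation
  takes place over \<open>M^T\<close>, since only there do the two legs coming from \<open>M\<close>
  agree. The square makes sense because \<open>N^\<sigma>(t) F^\<sigma> = N(t) F_0 u_M\<close> holds
  strictly. Thus \<open>\<eta>_t * u_M\<close> has two descriptions of its domain: one is available
  before \<open>F^\<sigma>\<close> and serves to construct it, the other serves for naturality. The
  arbitrary object \<open>x\<close> is forced by substitution: the axiom on lax morphisms speaks of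
  \<eta> over the product of a context, while naturality at \<open>\<alpha>_{t'}\<close> concerns
  \<eta> over \<open>M^\<sigma>\<close>, and one recursion has to serve both.\<close>

definition cells :: "('o, 'm, 't) two_cat \<Rightarrow> 'o \<Rightarrow> 'o \<Rightarrow> 'm \<Rightarrow> 'm \<Rightarrow> 't set" where
  "cells K x y f g = {\<alpha> \<in> hom2 K f g. f \<in> hom1 K x y \<and> g \<in> hom1 K x y}"

lemma cellsD:
  assumes "\<alpha> \<in> cells K x y f g"
  shows "f \<in> hom1 K x y" "g \<in> hom1 K x y" "\<alpha> \<in> hom2 K f g" "Dom K \<alpha> = f" "Cod K \<alpha> = g"
  using assms by (auto simp: cells_def hom2_def)

context two_category
begin

text \<open>The axioms of a strict 2-category are conditional on composability, and
  \<open>hom2\<close> alone forgets the objects. Membership in \<open>cells K x y f g\<close>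
  records the whole boundary, so that composability is settled by unification. Typing
  \<open>f\<close> is enough, because the endpoints of a 2-cell are parallel.\<close>

lemma cellsI: "\<lbrakk>\<alpha> \<in> hom2 K f g; f \<in> hom1 K x y\<rbrakk> \<Longrightarrow> \<alpha> \<in> cells K x y f g"
  using Cell_Src Cell_Tgt Cod_Arr by (auto simp: cells_def hom1_def hom2_def)

lemma hom1_Obj: "f \<in> hom1 K x y \<Longrightarrow> x \<in> Obj K" "f \<in> hom1 K x y \<Longrightarrow> y \<in> Obj K"
  using Src_Obj Tgt_Obj by (auto simp: hom1_def)

lemma Id2_cells: "f \<in> hom1 K x y \<Longrightarrow> Id2 K f \<in> cells K x y f f"
  using Id2_hom by (auto simp: cells_def hom1_def)

lemma vcomp_cells:
  "\<lbrakk>\<beta> \<in> cells K x y g h; \<alpha> \<in> cells K x y f g\<rbrakk> \<Longrightarrow> \<beta> \<bullet> \<alpha> \<in> cells K x y f h"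
  using vcomp_hom by (auto simp: cells_def)

lemma vcomp_cells_assoc:
  "\<lbrakk>\<gamma> \<in> cells K x y h k; \<beta> \<in> cells K x y g h; \<alpha> \<in> cells K x y f g\<rbrakk>
    \<Longrightarrow> (\<gamma> \<bullet> \<beta>) \<bullet> \<alpha> = \<gamma> \<bullet> (\<beta> \<bullet> \<alpha>)"
  using vcomp_assoc by (auto simp: cells_def)

lemma vcomp_Id2:
  assumes "\<alpha> \<in> cells K x y f g"
  shows "Id2 K g \<bullet> \<alpha> = \<alpha>" "\<alpha> \<bullet> Id2 K f = \<alpha>"
  using assms vcomp_Id2_left vcomp_Id2_right by (auto simp: cells_def)

lemma hcomp_cells:
  "\<lbrakk>\<beta> \<in> cells K y z g g'; \<alpha> \<in> cells K x y f f'\<rbrakk> \<Longrightarrow> \<beta> \<star> \<alpha> \<in> cells K x z (g \<cdot> f) (g' \<cdot> f')"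
  using hcomp_hom comp1_hom by (auto simp: cells_def hom1_def)

lemma lwhisk_cells:
  "\<lbrakk>h \<in> hom1 K y z; \<alpha> \<in> cells K x y f g\<rbrakk> \<Longrightarrow> lwhisk K h \<alpha> \<in> cells K x z (h \<cdot> f) (h \<cdot> g)"
  unfolding lwhisk_def by (rule hcomp_cells[OF Id2_cells])

lemma rwhisk_cells:
  "\<lbrakk>\<alpha> \<in> cells K x y f g; h \<in> hom1 K w x\<rbrakk> \<Longrightarrow> rwhisk K \<alpha> h \<in> cells K w y (f \<cdot> h) (g \<cdot> h)"
  unfolding rwhisk_def by (rule hcomp_cells[OF _ Id2_cells])

lemma interchange_cells:
  assumes "\<beta>' \<in> cells K y z g' g''" "\<beta> \<in> cells K y z g g'"
    and "\<alpha>' \<in> cells K x y f' f''" "\<alpha> \<in> cells K x y f f'"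
  shows "(\<beta>' \<bullet> \<beta>) \<star> (\<alpha>' \<bullet> \<alpha>) = (\<beta>' \<star> \<alpha>') \<bullet> (\<beta> \<star> \<alpha>)"
  using assms interchange by (auto simp: cells_def hom1_def)

lemma lwhisk_vcomp:
  assumes "h \<in> hom1 K y z" "\<beta> \<in> cells K x y g k" "\<alpha> \<in> cells K x y f g"
  shows "lwhisk K h (\<beta> \<bullet> \<alpha>) = lwhisk K h \<beta> \<bullet> lwhisk K h \<alpha>"
  using interchange_cells[OF Id2_cells Id2_cells assms(2,3), OF assms(1,1)]
  by (simp add: lwhisk_def vcomp_Id2[OF Id2_cells[OF assms(1)]])

lemma rwhisk_vcomp:
  assumes "\<beta> \<in> cells K x y g k" "\<alpha> \<in> cells K x y f g" "h \<in> hom1 K w x"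
  shows "rwhisk K (\<beta> \<bullet> \<alpha>) h = rwhisk K \<beta> h \<bullet> rwhisk K \<alpha> h"
  using interchange_cells[OF assms(1,2) Id2_cells Id2_cells, OF assms(3,3)]
  by (simp add: rwhisk_def vcomp_Id2[OF Id2_cells[OF assms(3)]])

lemma lwhisk_Id2: "\<lbrakk>h \<in> hom1 K y z; f \<in> hom1 K x y\<rbrakk> \<Longrightarrow> lwhisk K h (Id2 K f) = Id2 K (h \<cdot> f)"
  by (simp add: lwhisk_def hcomp_Id2)

lemma rwhisk_Id2: "\<lbrakk>f \<in> hom1 K x y; h \<in> hom1 K w x\<rbrakk> \<Longrightarrow> rwhisk K (Id2 K f) h = Id2 K (f \<cdot> h)"
  by (simp add: rwhisk_def hcomp_Id2)

lemma hcomp_cells_assoc: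
  assumes "\<gamma> \<in> cells K y z h h'" "\<beta> \<in> cells K x y g g'" "\<alpha> \<in> cells K w x f f'"
  shows "(\<gamma> \<star> \<beta>) \<star> \<alpha> = \<gamma> \<star> (\<beta> \<star> \<alpha>)"
  using assms hcomp_assoc by (auto simp: cells_def hom1_def)

lemma lwhisk_comp1:
  "\<lbrakk>k \<in> hom1 K y z; h \<in> hom1 K x y; \<alpha> \<in> cells K w x f g\<rbrakk>
    \<Longrightarrow> lwhisk K (k \<cdot> h) \<alpha> = lwhisk K k (lwhisk K h \<alpha>)"
  using hcomp_cells_assoc[OF Id2_cells Id2_cells] by (fastforce simp: lwhisk_def hcomp_Id2)

lemma rwhisk_comp1:
  "\<lbrakk>\<alpha> \<in> cells K x y f g; h \<in> hom1 K w x; k \<in> hom1 K v w\<rbrakk>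
    \<Longrightarrow> rwhisk K \<alpha> (h \<cdot> k) = rwhisk K (rwhisk K \<alpha> h) k"
  using hcomp_cells_assoc[OF _ Id2_cells Id2_cells] by (fastforce simp: rwhisk_def hcomp_Id2)

lemma lwhisk_rwhisk:
  "\<lbrakk>k \<in> hom1 K y z; \<alpha> \<in> cells K x y f g; h \<in> hom1 K w x\<rbrakk>
    \<Longrightarrow> rwhisk K (lwhisk K k \<alpha>) h = lwhisk K k (rwhisk K \<alpha> h)"
  using hcomp_cells_assoc[OF Id2_cells _ Id2_cells] by (fastforce simp: rwhisk_def lwhisk_def)

text \<open>Both composites equal \<open>\<beta> \<star> \<alpha>\<close>, by interchange against
  identities. This form slides a 2-cell past another one; the naturality of \<eta> at transformation
  and functor symbols rests on it.\<close>

lemma whisk_exchange: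
  assumes "\<beta> \<in> cells K y z h k" "\<alpha> \<in> cells K x y f g"
  shows "rwhisk K \<beta> g \<bullet> lwhisk K h \<alpha> = lwhisk K k \<alpha> \<bullet> rwhisk K \<beta> f"
proof -
  note \<alpha> = cellsD[OF assms(2)] and \<beta> = cellsD[OF assms(1)]
  have "rwhisk K \<beta> g \<bullet> lwhisk K h \<alpha> = (\<beta> \<bullet> Id2 K h) \<star> (Id2 K g \<bullet> \<alpha>)"
    using interchange_cells[OF assms(1) Id2_cells Id2_cells assms(2)] \<alpha>(2) \<beta>(1)
    by (simp add: rwhisk_def lwhisk_def)
  also have "\<dots> = (Id2 K k \<bullet> \<beta>) \<star> (\<alpha> \<bullet> Id2 K f)"
    by (simp add: vcomp_Id2[OF assms(1)] vcomp_Id2[OF assms(2)])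
  also have "\<dots> = lwhisk K k \<alpha> \<bullet> rwhisk K \<beta> f"
    using interchange_cells[OF Id2_cells assms(1) assms(2) Id2_cells] \<alpha>(1) \<beta>(2)
    by (simp add: rwhisk_def lwhisk_def)
  finally show ?thesis .
qed

section \<open>Invertible 2-cells\<close>

lemma inverse2_unique:
  assumes "inverse2 K \<alpha> \<beta>" "inverse2 K \<alpha> \<gamma>"
  shows "\<beta> = \<gamma>"
proof -
  have \<alpha>: "\<alpha> \<in> hom2 K (Dom K \<alpha>) (Cod K \<alpha>)"
    using assms by (auto simp: inverse2_def hom2_def)
  have "\<beta> = (\<gamma> \<bullet> \<alpha>) \<bullet> \<beta>" "\<gamma> \<bullet> (\<alpha> \<bullet> \<beta>) = \<gamma>"
    using assms vcomp_Id2_left vcomp_Id2_right by (auto simp: inverse2_def)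
  then show ?thesis
    using assms vcomp_assoc[of \<beta> "Cod K \<alpha>" "Dom K \<alpha>" \<alpha> _ \<gamma> "Dom K \<alpha>", OF _ \<alpha>]
    by (simp add: inverse2_def)
qed

text \<open>Uniqueness of inverses turns the definite description into an actual inverse; its
  boundary is that of \<alpha> reversed, with the same objects.\<close>

lemma inv2:
  assumes "iso2 K \<alpha>" "\<alpha> \<in> cells K x y f g"
  shows "inv2 K \<alpha> \<in> cells K x y g f" "inv2 K \<alpha> \<bullet> \<alpha> = Id2 K f" "\<alpha> \<bullet> inv2 K \<alpha> = Id2 K g"
proof -
  have "inverse2 K \<alpha> (inv2 K \<alpha>)"
    unfolding inv2_def using assms(1) inverse2_unique by (auto simp: iso2_def intro: theI)
  with assms(2)
  show "inv2 K \<alpha> \<in> cells K x y g f" "inv2 K \<alpha> \<bullet> \<alpha> = Id2 K f" "\<alpha> \<bullet> inv2 K \<alpha> = Id2 K g"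
    by (auto simp: inverse2_def cells_def hom2_def)
qed

end

section \<open>Products\<close>

text \<open>The chosen product is a Hilbert choice, hence a product only if some product exists.
  Stating this for the chosen cone keeps other cones out of all later arguments.\<close>

definition has_product :: "('o, 'm, 't) two_cat \<Rightarrow> 'i set \<Rightarrow> ('i \<Rightarrow> 'o) \<Rightarrow> bool" where
  "has_product K I c \<longleftrightarrow> is_product K I c (prod_obj K I c) (proj K I c)"

lemma has_productI: "is_product K I c P \<pi> \<Longrightarrow> has_product K I c"
proof -
  assume "is_product K I c P \<pi>"
  then have "\<exists>p. case p of (P, \<pi>) \<Rightarrow> is_product K I c P \<pi>" by auto
  from someI_ex[OF this] show ?thesis
    by (auto simp: has_product_def prod_obj_def proj_def some_product_def split: prod.splits)
qed

text \<open>Completeness speaks only of families indexed by subsets of the type \<open>'u\<close>. A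
  family on \<open>I\<close> is carried to the image of \<open>e\<close> by
  \<open>inv_into I e\<close>, which undoes \<open>e\<close> on \<open>I\<close>; a product of the
  carried family then becomes one over \<open>I\<close> by precomposing its projections with
  \<open>e\<close>.\<close>

lemma is_product_reindex:
  assumes P: "is_product K (e ` I) (c \<circ> inv_into I e) P \<pi>" and e: "inj_on e I"
  shows "is_product K I c P (\<pi> \<circ> e)"
proof -
  have univ1: "\<forall>x\<in>Obj K. \<forall>f. (\<forall>j\<in>e ` I. f j \<in> hom1 K x ((c \<circ> inv_into I e) j)) \<longrightarrow>
      (\<exists>!h. h \<in> hom1 K x P \<and> (\<forall>j\<in>e ` I. \<pi> j \<cdot>\<^bsub>K\<^esub> h = f j))"
    using P unfolding is_product_def by (elim conjE)
  have univ2: "\<forall>x\<in>Obj K. \<forall>h\<in>hom1 K x P. \<forall>k\<in>hom1 K x P. \<forall>\<alpha>.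
      (\<forall>j\<in>e ` I. \<alpha> j \<in> hom2 K (\<pi> j \<cdot>\<^bsub>K\<^esub> h) (\<pi> j \<cdot>\<^bsub>K\<^esub> k)) \<longrightarrow>
      (\<exists>!\<beta>. \<beta> \<in> hom2 K h k \<and> (\<forall>j\<in>e ` I. lwhisk K (\<pi> j) \<beta> = \<alpha> j))"
    using P unfolding is_product_def by (elim conjE)
  show ?thesis
    unfolding is_product_def
  proof (intro conjI ballI allI impI)
    show "P \<in> Obj K" using P by (simp add: is_product_def)
    show "(\<pi> \<circ> e) i \<in> hom1 K P (c i)" if "i \<in> I" for i
      using P e that by (auto simp: is_product_def)
  next
    fix x f assume "x \<in> Obj K" "\<forall>i\<in>I. f i \<in> hom1 K x (c i)"
    then show "\<exists>!h. h \<in> hom1 K x P \<and> (\<forall>i\<in>I. (\<pi> \<circ> e) i \<cdot>\<^bsub>K\<^esub> h = f i)"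
      using univ1[rule_format, of x "f \<circ> inv_into I e"] e by (simp add: inv_into_into)
  next
    fix x h k \<alpha> assume "x \<in> Obj K" "h \<in> hom1 K x P" "k \<in> hom1 K x P"
      "\<forall>i\<in>I. \<alpha> i \<in> hom2 K ((\<pi> \<circ> e) i \<cdot>\<^bsub>K\<^esub> h) ((\<pi> \<circ> e) i \<cdot>\<^bsub>K\<^esub> k)"
    then have "\<exists>!\<beta>. \<beta> \<in> hom2 K h k \<and> (\<forall>j\<in>e ` I. lwhisk K (\<pi> j) \<beta> = (\<alpha> \<circ> inv_into I e) j)"
      using e by (intro univ2[rule_format]) auto
    then show "\<exists>!\<beta>. \<beta> \<in> hom2 K h k \<and> (\<forall>i\<in>I. lwhisk K ((\<pi> \<circ> e) i) \<beta> = \<alpha> i)"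
      using e by simp
  qed
qed

lemma pie_complete_has_product:
  fixes U :: "'u::infinite itself"
  assumes "pie_complete U K" "small U I" "\<And>i. i \<in> I \<Longrightarrow> c i \<in> Obj K"
  shows "has_product K I c"
proof -
  obtain e :: "_ \<Rightarrow> 'u" where e: "inj_on e I"
    using assms(2) by (auto simp: small_def)
  have "\<forall>j\<in>e ` I. (c \<circ> inv_into I e) j \<in> Obj K"
    using assms(3) e by auto
  with assms(1) obtain P \<pi> where "is_product K (e ` I) (c \<circ> inv_into I e) P \<pi>"
    unfolding pie_complete_def by blast
  then show ?thesis
    using e by (intro has_productI[OF is_product_reindex])
qed

text \<open>Arguments and contexts are indexed by initial segments of the naturals, whose products
  must also come from completeness. An infinite type has subsets of every finite cardinality, and
  equal cardinality provides the injection.\<close>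

lemma finite_small: "finite A \<Longrightarrow> small (U :: 'u::infinite itself) A"
proof -
  assume A: "finite A"
  obtain B :: "'u set" where "finite B" "card B = card A"
    using infinite_arbitrarily_large[OF infinite_UNIV] by metis
  with A obtain e where "bij_betw e A B"
    by (metis finite_same_card_bij)
  then show ?thesis by (auto simp: small_def bij_betw_def)
qed

context two_category
begin

lemma proj_hom: "\<lbrakk>has_product K I c; i \<in> I\<rbrakk> \<Longrightarrow> proj K I c i \<in> hom1 K (prod_obj K I c) (c i)"
  by (simp add: has_product_def is_product_def)

lemma prod_obj_Obj: "has_product K I c \<Longrightarrow> prod_obj K I c \<in> Obj K"
  by (simp add: has_product_def is_product_def)

lemma product_universal1:
  assumes "has_product K I c" "x \<in> Obj K" "\<And>i. i \<in> I \<Longrightarrow> f i \<in> hom1 K x (c i)"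
  shows "\<exists>!h. h \<in> hom1 K x (prod_obj K I c) \<and> (\<forall>i\<in>I. proj K I c i \<cdot> h = f i)"
proof -
  have "\<forall>x\<in>Obj K. \<forall>f. (\<forall>i\<in>I. f i \<in> hom1 K x (c i)) \<longrightarrow>
      (\<exists>!h. h \<in> hom1 K x (prod_obj K I c) \<and> (\<forall>i\<in>I. proj K I c i \<cdot> h = f i))"
    using assms(1) unfolding has_product_def is_product_def by (elim conjE)
  from this[rule_format, OF assms(2), of f] assms(3) show ?thesis by simp
qed

lemma product_universal2:
  assumes "has_product K I c" "h \<in> hom1 K x (prod_obj K I c)" "k \<in> hom1 K x (prod_obj K I c)"
    and "\<And>i. i \<in> I \<Longrightarrow> \<alpha> i \<in> hom2 K (proj K I c i \<cdot> h) (proj K I c i \<cdot> k)"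
  shows "\<exists>!\<beta>. \<beta> \<in> hom2 K h k \<and> (\<forall>i\<in>I. lwhisk K (proj K I c i) \<beta> = \<alpha> i)"
proof -
  have "\<forall>x\<in>Obj K. \<forall>h\<in>hom1 K x (prod_obj K I c). \<forall>k\<in>hom1 K x (prod_obj K I c). \<forall>\<alpha>.
      (\<forall>i\<in>I. \<alpha> i \<in> hom2 K (proj K I c i \<cdot> h) (proj K I c i \<cdot> k)) \<longrightarrow>
      (\<exists>!\<beta>. \<beta> \<in> hom2 K h k \<and> (\<forall>i\<in>I. lwhisk K (proj K I c i) \<beta> = \<alpha> i))"
    using assms(1) unfolding has_product_def is_product_def by (elim conjE)
  from this[rule_format, OF hom1_Obj(1)[OF assms(2)] assms(2,3), of \<alpha>] assms(4)
  show ?thesis by simp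
qed

lemma product_ext1:
  assumes "has_product K I c" "h \<in> hom1 K x (prod_obj K I c)" "k \<in> hom1 K x (prod_obj K I c)"
    and "\<And>i. i \<in> I \<Longrightarrow> proj K I c i \<cdot> h = proj K I c i \<cdot> k"
  shows "h = k"
proof -
  have "\<exists>!l. l \<in> hom1 K x (prod_obj K I c) \<and> (\<forall>i\<in>I. proj K I c i \<cdot> l = proj K I c i \<cdot> k)"
    using comp1_hom[OF assms(3) proj_hom[OF assms(1)]]
    by (rule product_universal1[OF assms(1) hom1_Obj(1)[OF assms(2)]])
  then show ?thesis using assms(2-4) by (elim ex1E) metis
qed

lemma product_ext2:
  assumes "has_product K I c" "\<alpha> \<in> cells K x (prod_obj K I c) h k" "\<beta> \<in> cells K x (prod_obj K I c) h k"
    and "\<And>i. i \<in> I \<Longrightarrow> lwhisk K (proj K I c i) \<alpha> = lwhisk K (proj K I c i) \<beta>"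
  shows "\<alpha> = \<beta>"
proof -
  have "\<exists>!\<gamma>. \<gamma> \<in> hom2 K h k \<and>
      (\<forall>i\<in>I. lwhisk K (proj K I c i) \<gamma> = lwhisk K (proj K I c i) \<beta>)"
    using cellsD(3)[OF lwhisk_cells[OF proj_hom[OF assms(1)] assms(3)]]
    by (rule product_universal2[OF assms(1) cellsD(1,2)[OF assms(2)]])
  then show ?thesis using cellsD(3)[OF assms(2)] cellsD(3)[OF assms(3)] assms(4)
    by (elim ex1E) metis
qed

lemma tup1:
  assumes "has_product K I c" "x \<in> Obj K" "\<And>i. i \<in> I \<Longrightarrow> f i \<in> hom1 K x (c i)"
  shows "tup1 K I c x f \<in> hom1 K x (prod_obj K I c)"
    and "i \<in> I \<Longrightarrow> proj K I c i \<cdot> tup1 K I c x f = f i"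
proof -
  from theI'[OF product_universal1[OF assms]]
  show "tup1 K I c x f \<in> hom1 K x (prod_obj K I c)"
    and "i \<in> I \<Longrightarrow> proj K I c i \<cdot> tup1 K I c x f = f i"
    by (auto simp: tup1_def)
qed

text \<open>The description in \<open>tup1\<close> tests the family on \<open>I\<close> only. A
  family read off a list by \<open>nth\<close> can therefore be replaced by any function with the
  same values below the length.\<close>

lemma tup1_cong: "(\<And>i. i \<in> I \<Longrightarrow> f i = g i) \<Longrightarrow> tup1 K I c x f = tup1 K I c x g"
  by (auto simp: tup1_def intro!: arg_cong[where f=The])

text \<open>The components of \<open>h\<close> are typed because \<open>h\<close> is, and this is
  where the typing of \<open>f\<close> comes from; uniqueness in the universal property does the
  rest.\<close>

lemma tup1_eqI:
  assumes "has_product K I c" "h \<in> hom1 K x (prod_obj K I c)"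
    and "\<And>i. i \<in> I \<Longrightarrow> proj K I c i \<cdot> h = f i"
  shows "tup1 K I c x f = h"
proof -
  have f: "f i \<in> hom1 K x (c i)" if "i \<in> I" for i
    using comp1_hom[OF assms(2) proj_hom[OF assms(1) that]] assms(3)[OF that] by simp
  show ?thesis
    by (rule product_ext1[OF assms(1) _ assms(2)])
      (use tup1[OF assms(1) hom1_Obj(1)[OF assms(2)] f] assms(3) in auto)
qed

lemma tup1_comp1:
  assumes "has_product K I c" "\<And>i. i \<in> I \<Longrightarrow> f i \<in> hom1 K x (c i)" "h \<in> hom1 K w x"
  shows "tup1 K I c x f \<cdot> h = tup1 K I c w (\<lambda>i. f i \<cdot> h)"
proof (rule tup1_eqI[symmetric, OF assms(1)])
  note t = tup1[OF assms(1) hom1_Obj(2)[OF assms(3)] assms(2)]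
  show "tup1 K I c x f \<cdot> h \<in> hom1 K w (prod_obj K I c)"
    by (rule comp1_hom[OF assms(3) t(1)])
  show "proj K I c i \<cdot> tup1 K I c x f \<cdot> h = f i \<cdot> h" if "i \<in> I" for i
    using comp1_assoc[OF assms(3) t(1) proj_hom[OF assms(1) that]] t(2) that by simp
qed

lemma tup2:
  assumes "has_product K I c" "x \<in> Obj K" "\<And>i. i \<in> I \<Longrightarrow> \<alpha> i \<in> cells K x (c i) (f i) (g i)"
  shows "tup2 K I c x \<alpha> \<in> cells K x (prod_obj K I c) (tup1 K I c x f) (tup1 K I c x g)"
    and "i \<in> I \<Longrightarrow> lwhisk K (proj K I c i) (tup2 K I c x \<alpha>) = \<alpha> i"
proof -
  \<comment> \<open>\<open>tup2\<close> takes the endpoints of its value from \<open>Dom\<close> and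
    \<open>Cod\<close> of the family. On \<open>I\<close> these are \<open>f\<close> and
    \<open>g\<close>, so the tuples coincide with those in the statement.\<close>
  have "tup1 K I c x (\<lambda>i. Dom K (\<alpha> i)) = tup1 K I c x f"
    "tup1 K I c x (\<lambda>i. Cod K (\<alpha> i)) = tup1 K I c x g"
    using assms(3) by (auto intro!: tup1_cong dest: cellsD)
  moreover have f: "tup1 K I c x f \<in> hom1 K x (prod_obj K I c)"
      "tup1 K I c x g \<in> hom1 K x (prod_obj K I c)"
    using assms(3) by (auto intro!: tup1[OF assms(1,2)] dest: cellsD)
  moreover have "\<exists>!\<beta>. \<beta> \<in> hom2 K (tup1 K I c x f) (tup1 K I c x g) \<and>
      (\<forall>i\<in>I. lwhisk K (proj K I c i) \<beta> = \<alpha> i)"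
  proof -
    have "\<forall>i\<in>I. \<alpha> i \<in> hom2 K (proj K I c i \<cdot> tup1 K I c x f) (proj K I c i \<cdot> tup1 K I c x g)"
      using tup1(2)[OF assms(1,2), of f] tup1(2)[OF assms(1,2), of g] cellsD(1-3)[OF assms(3)]
      by simp
    then show ?thesis
      using product_universal2[OF assms(1) f] by blast
  qed
  note theI'[OF this]
  ultimately show
    "tup2 K I c x \<alpha> \<in> cells K x (prod_obj K I c) (tup1 K I c x f) (tup1 K I c x g)"
    "i \<in> I \<Longrightarrow> lwhisk K (proj K I c i) (tup2 K I c x \<alpha>) = \<alpha> i"
    by (auto simp: tup2_def cells_def)
qed

lemma tup2_cong: "(\<And>i. i \<in> I \<Longrightarrow> \<alpha> i = \<beta> i) \<Longrightarrow> tup2 K I c x \<alpha> = tup2 K I c x \<beta>"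
proof -
  assume eq: "\<And>i. i \<in> I \<Longrightarrow> \<alpha> i = \<beta> i"
  then have "tup1 K I c x (\<lambda>i. Dom K (\<alpha> i)) = tup1 K I c x (\<lambda>i. Dom K (\<beta> i))"
    "tup1 K I c x (\<lambda>i. Cod K (\<alpha> i)) = tup1 K I c x (\<lambda>i. Cod K (\<beta> i))"
    by (auto intro!: tup1_cong)
  with eq show ?thesis by (simp add: tup2_def)
qed

lemma tup2_eqI:
  assumes "has_product K I c" "\<beta> \<in> cells K x (prod_obj K I c) h k"
    and "\<And>i. i \<in> I \<Longrightarrow> lwhisk K (proj K I c i) \<beta> = \<alpha> i"
  shows "tup2 K I c x \<alpha> = \<beta>"
proof -
  have \<alpha>: "\<alpha> i \<in> cells K x (c i) (proj K I c i \<cdot> h) (proj K I c i \<cdot> k)" if "i \<in> I" for i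
    using lwhisk_cells[OF proj_hom[OF assms(1) that] assms(2)] assms(3)[OF that] by simp
  note \<beta> = cellsD[OF assms(2)]
  have "tup1 K I c x (\<lambda>i. proj K I c i \<cdot> h) = h" "tup1 K I c x (\<lambda>i. proj K I c i \<cdot> k) = k"
    using \<beta> by (auto intro: tup1_eqI[OF assms(1)])
  with tup2[OF assms(1) hom1_Obj(1)[OF \<beta>(1)] \<alpha>] show ?thesis
    by (intro product_ext2[OF assms(1) _ assms(2)]) (use assms(3) in auto)
qed

lemma tup2_rwhisk:
  assumes "has_product K I c" "\<And>i. i \<in> I \<Longrightarrow> \<alpha> i \<in> cells K x (c i) (f i) (g i)" "h \<in> hom1 K w x"
  shows "rwhisk K (tup2 K I c x \<alpha>) h = tup2 K I c w (\<lambda>i. rwhisk K (\<alpha> i) h)"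
proof (rule tup2_eqI[symmetric, OF assms(1)])
  note t = tup2[OF assms(1) hom1_Obj(2)[OF assms(3)] assms(2)]
  show "rwhisk K (tup2 K I c x \<alpha>) h \<in> cells K w (prod_obj K I c) (tup1 K I c x f \<cdot> h) (tup1 K I c x g \<cdot> h)"
    by (rule rwhisk_cells[OF t(1) assms(3)])
  show "lwhisk K (proj K I c i) (rwhisk K (tup2 K I c x \<alpha>) h) = rwhisk K (\<alpha> i) h" if "i \<in> I" for i
    using lwhisk_rwhisk[OF proj_hom[OF assms(1) that] t(1) assms(3)] t(2)[OF _ that] that by simp
qed

lemma tup2_vcomp:
  assumes "has_product K I c" "x \<in> Obj K" "\<And>i. i \<in> I \<Longrightarrow> \<beta> i \<in> cells K x (c i) (g i) (h i)"
    and "\<And>i. i \<in> I \<Longrightarrow> \<alpha> i \<in> cells K x (c i) (f i) (g i)"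
  shows "tup2 K I c x \<beta> \<bullet> tup2 K I c x \<alpha> = tup2 K I c x (\<lambda>i. \<beta> i \<bullet> \<alpha> i)"
proof (rule tup2_eqI[symmetric, OF assms(1)])
  note t = tup2[OF assms(1,2,3)] tup2[OF assms(1,2,4)]
  show "tup2 K I c x \<beta> \<bullet> tup2 K I c x \<alpha> \<in> cells K x (prod_obj K I c) (tup1 K I c x f) (tup1 K I c x h)"
    using t by (auto intro: vcomp_cells)
  show "lwhisk K (proj K I c i) (tup2 K I c x \<beta> \<bullet> tup2 K I c x \<alpha>) = \<beta> i \<bullet> \<alpha> i" if "i \<in> I" for i
    using lwhisk_vcomp[OF proj_hom[OF assms(1) that] t(1,3)] t(2)[OF _ that] t(4)[OF _ that] by simp
qed

text \<open>Each projection after the tuple is one of its components, so whiskering acts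
  coordinatewise. In \<open>tup2_rwhisk\<close> the 2-cell is the tuple; here the 1-cell is.\<close>

lemma tup1_lwhisk:
  assumes "has_product K I c" "\<And>i. i \<in> I \<Longrightarrow> f i \<in> hom1 K x (c i)" "\<alpha> \<in> cells K w x h k"
  shows "lwhisk K (tup1 K I c x f) \<alpha> = tup2 K I c w (\<lambda>i. lwhisk K (f i) \<alpha>)"
proof (rule tup2_eqI[symmetric, OF assms(1)])
  note t = tup1[OF assms(1) hom1_Obj(2)[OF cellsD(1)[OF assms(3)]], of f, OF assms(2)]
  show "lwhisk K (tup1 K I c x f) \<alpha> \<in> cells K w (prod_obj K I c) (tup1 K I c x f \<cdot> h) (tup1 K I c x f \<cdot> k)"
    using t(1) assms(3) by (auto intro: lwhisk_cells)
  show "lwhisk K (proj K I c i) (lwhisk K (tup1 K I c x f) \<alpha>) = lwhisk K (f i) \<alpha>" if "i \<in> I" for i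
    using lwhisk_comp1[OF proj_hom[OF assms(1) that] t(1) assms(3)] t(2) that by simp
qed

lemma prod_mor:
  assumes "has_product K I c" "has_product K I d" "\<And>i. i \<in> I \<Longrightarrow> f i \<in> hom1 K (c i) (d i)"
  shows "prod_mor K I c d f \<in> hom1 K (prod_obj K I c) (prod_obj K I d)"
    and "i \<in> I \<Longrightarrow> proj K I d i \<cdot> prod_mor K I c d f = f i \<cdot> proj K I c i"
  unfolding prod_mor_def
  by (auto intro!: tup1[OF assms(2)] prod_obj_Obj assms comp1_hom[OF proj_hom])

lemma prod_mor_tup1:
  assumes "has_product K I c" "has_product K I d" "\<And>i. i \<in> I \<Longrightarrow> f i \<in> hom1 K (c i) (d i)"
    and "x \<in> Obj K" "\<And>i. i \<in> I \<Longrightarrow> g i \<in> hom1 K x (c i)"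
  shows "prod_mor K I c d f \<cdot> tup1 K I c x g = tup1 K I d x (\<lambda>i. f i \<cdot> g i)"
proof (rule tup1_eqI[symmetric, OF assms(2)])
  note t = tup1[OF assms(1,4,5)] and p = prod_mor[OF assms(1-3)]
  show "prod_mor K I c d f \<cdot> tup1 K I c x g \<in> hom1 K x (prod_obj K I d)"
    using t p by (auto intro: comp1_hom)
  show "proj K I d i \<cdot> prod_mor K I c d f \<cdot> tup1 K I c x g = f i \<cdot> g i" if i: "i \<in> I" for i
    using comp1_assoc[OF t(1) p(1) proj_hom[OF assms(2) i]] p(2)[OF _ i] t(2)[OF _ i]
      comp1_assoc[OF t(1) proj_hom[OF assms(1) i] assms(3)[OF i]] by simp
qed

lemma prod_mor_tup2:
  assumes "has_product K I c" "has_product K I d" "\<And>i. i \<in> I \<Longrightarrow> f i \<in> hom1 K (c i) (d i)"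
    and "x \<in> Obj K" "\<And>i. i \<in> I \<Longrightarrow> \<alpha> i \<in> cells K x (c i) (g i) (h i)"
  shows "lwhisk K (prod_mor K I c d f) (tup2 K I c x \<alpha>) = tup2 K I d x (\<lambda>i. lwhisk K (f i) (\<alpha> i))"
proof (rule tup2_eqI[symmetric, OF assms(2)])
  note t = tup2[OF assms(1,4,5)] and p = prod_mor[OF assms(1-3)]
  show "lwhisk K (prod_mor K I c d f) (tup2 K I c x \<alpha>) \<in> cells K x (prod_obj K I d)
      (prod_mor K I c d f \<cdot> tup1 K I c x g) (prod_mor K I c d f \<cdot> tup1 K I c x h)"
    using t p by (auto intro: lwhisk_cells)
  show "lwhisk K (proj K I d i) (lwhisk K (prod_mor K I c d f) (tup2 K I c x \<alpha>)) = lwhisk K (f i) (\<alpha> i)"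
    if i: "i \<in> I" for i
    using lwhisk_comp1[OF proj_hom[OF assms(2) i] p(1) t(1)] p(2)[OF _ i] t(2)[OF _ i]
      lwhisk_comp1[OF assms(3)[OF i] proj_hom[OF assms(1) i] t(1)] by simp
qed

end

section \<open>Interpretation of terms and lax morphisms\<close>

text \<open>The generated rule keeps its hypotheses inside \<open>list_all2\<close>. The indexed
  form matches the components of a product, over which the inductions on terms argue.\<close>

lemma has_type_induct [consumes 1, case_names Atom App]:
  assumes "has_type \<Sigma> X \<tau> t c"
    and "\<And>y. y \<in> X \<Longrightarrow> P (Atom y) (\<tau> y)"
    and "\<And>B ts. \<lbrakk>B \<in> funs \<Sigma>; length ts = length (fdom \<Sigma> B);
        \<And>i. i < length (fdom \<Sigma> B) \<Longrightarrow> has_type \<Sigma> X \<tau> (ts ! i) (fdom \<Sigma> B ! i);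
        \<And>i. i < length (fdom \<Sigma> B) \<Longrightarrow> P (ts ! i) (fdom \<Sigma> B ! i)\<rbrakk> \<Longrightarrow> P (App B ts) (fcod \<Sigma> B)"
  shows "P t c"
  using assms(1) by induction (auto simp: list_all2_conv_all_nth intro: assms(2,3))

lemma typ_of_eq: "has_type \<Sigma> X \<tau> t c \<Longrightarrow> typ_of \<Sigma> \<tau> t = c"
  by (auto elim: has_type.cases)

text \<open>A 2-signature types the terms of a transformation symbol over all variables. Restricting
  to the variables that occur puts them over the context, where the projections interpret
  them.\<close>

lemma has_type_atoms:
  assumes "has_type \<Sigma> X \<tau> t c" "atoms t \<subseteq> Y"
  shows "has_type \<Sigma> Y \<tau> t c"
  using assms
proof (induction rule: has_type_induct)
  case (Atom y)
  then show ?case by (auto intro: has_type.Atom)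
next
  case (App B ts)
  have "atoms (ts ! i) \<subseteq> Y" if "i < length (fdom \<Sigma> B)" for i
    using App(5) that nth_mem[of i ts] by (fastforce simp: App(2))
  with App show ?case by (auto intro!: has_type.App simp: list_all2_conv_all_nth)
qed

lemma has_type_bind_trm:
  assumes "has_type \<Sigma> X \<tau> t c" "\<And>y. y \<in> X \<Longrightarrow> has_type \<Sigma> Y \<upsilon> (\<rho> y) (\<tau> y)"
  shows "has_type \<Sigma> Y \<upsilon> (bind_trm \<rho> t) c"
  using assms(1)
  by (induction rule: has_type_induct)
    (auto intro!: has_type.App assms(2) simp: list_all2_conv_all_nth)

text \<open>Substituting and then evaluating reads each atom as the value of the term put in its
  place. The two recursions agree literally, so no boundaries enter.\<close>

lemma eval_bind_trm:
  "eval K \<Sigma> M x a (bind_trm \<rho> t) = eval K \<Sigma> M x (\<lambda>y. eval K \<Sigma> M x a (\<rho> y)) t"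
  by (induction t) (auto cong: map_cong)

text \<open>Evaluating terms involves products over argument lists and contexts, so finite products
  are assumed here. The small products enter later, with the sorts, the function symbols and the
  equations.\<close>

locale model_in = two_category K
  for K :: "('o, 'm, 't) two_cat" (structure) +
  fixes \<Sigma> :: "('c, 'b, 'v, 'a) sig2"
    and M :: "('c, 'b, 'a, 'o, 'm, 't) model"
  assumes finite_products: "set cs \<subseteq> Obj K \<Longrightarrow> has_product K {..<length cs} (nth cs)"
    and fun_types: "B \<in> funs \<Sigma> \<Longrightarrow> set (fdom \<Sigma> B) \<subseteq> cats \<Sigma>" "B \<in> funs \<Sigma> \<Longrightarrow> fcod \<Sigma> B \<in> cats \<Sigma>"
    and model: "is_model K \<Sigma> M"
begin

lemma Mob_Obj: "c \<in> cats \<Sigma> \<Longrightarrow> Mob M c \<in> Obj K"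
  using model by (simp add: is_model_def)

lemma list_product:
  "set cs \<subseteq> cats \<Sigma> \<Longrightarrow> has_product K {..<length cs} (nth (map (Mob M) cs))"
  using finite_products[of "map (Mob M) cs"] Mob_Obj by auto

abbreviation "arg_obs B \<equiv> nth (map (Mob M) (fdom \<Sigma> B))"

lemma arg_product: "B \<in> funs \<Sigma> \<Longrightarrow> has_product K {..<length (fdom \<Sigma> B)} (arg_obs B)"
  by (rule list_product[OF fun_types(1)])

lemma Mfun_hom:
  "B \<in> funs \<Sigma> \<Longrightarrow>
    Mfun M B \<in> hom1 K (prod_obj K {..<length (fdom \<Sigma> B)} (arg_obs B)) (Mob M (fcod \<Sigma> B))"
  using model by (simp add: is_model_def lprod_obj_def)

text \<open>An interpretation of typed atoms by generalised elements of the model at stage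
  \<open>x\<close>. The cases that matter are the projections of \<open>M_0\<close>, the projections
  of the product of a context, and the sorts read in \<open>M^\<sigma>\<close>.\<close>

definition valuation :: "'x set \<Rightarrow> ('x \<Rightarrow> 'c) \<Rightarrow> 'o \<Rightarrow> ('x \<Rightarrow> 'm) \<Rightarrow> bool" where
  "valuation X \<tau> x a \<longleftrightarrow>
    x \<in> Obj K \<and> (\<forall>y\<in>X. \<tau> y \<in> cats \<Sigma> \<and> a y \<in> hom1 K x (Mob M (\<tau> y)))"

lemma valuation_comp1:
  "\<lbrakk>valuation X \<tau> x a; h \<in> hom1 K w x\<rbrakk> \<Longrightarrow> valuation X \<tau> w (\<lambda>y. a y \<cdot> h)"
  by (auto simp: valuation_def dest: hom1_Obj intro: comp1_hom)

lemma eval_App: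
  "length ts = length (fdom \<Sigma> B) \<Longrightarrow>
    eval K \<Sigma> M x a (App B ts) =
      Mfun M B \<cdot> tup1 K {..<length (fdom \<Sigma> B)} (arg_obs B) x (\<lambda>i. eval K \<Sigma> M x a (ts ! i))"
  by (auto simp: ltup1_def intro!: arg_cong[where f="(\<cdot>) _"] tup1_cong)

lemma type_in_cats: "\<lbrakk>valuation X \<tau> x a; has_type \<Sigma> X \<tau> t c\<rbrakk> \<Longrightarrow> c \<in> cats \<Sigma>"
  by (erule has_type.cases) (auto simp: valuation_def fun_types)

lemma eval_hom:
  assumes "valuation X \<tau> x a" "has_type \<Sigma> X \<tau> t c"
  shows "eval K \<Sigma> M x a t \<in> hom1 K x (Mob M c)"
  using assms(2)
proof (induction rule: has_type_induct)
  case (Atom y)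
  then show ?case using assms(1) by (simp add: valuation_def)
next
  case (App B ts)
  have "tup1 K {..<length (fdom \<Sigma> B)} (arg_obs B) x (\<lambda>i. eval K \<Sigma> M x a (ts ! i))
      \<in> hom1 K x (prod_obj K {..<length (fdom \<Sigma> B)} (arg_obs B))"
    using assms(1) App by (intro tup1(1) arg_product) (auto simp: valuation_def)
  then show ?case
    using App by (auto simp: eval_App simp del: eval.simps intro: comp1_hom Mfun_hom)
qed

lemma args_hom:
  assumes "valuation X \<tau> x a" "B \<in> funs \<Sigma>"
    and "\<And>i. i < length (fdom \<Sigma> B) \<Longrightarrow> has_type \<Sigma> X \<tau> (ts ! i) (fdom \<Sigma> B ! i)"
    and "i \<in> {..<length (fdom \<Sigma> B)}"
  shows "eval K \<Sigma> M x a (ts ! i) \<in> hom1 K x (arg_obs B i)"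
  using assms by (auto intro: eval_hom)

text \<open>Tuples and composition with \<open>Mfun M B\<close> are strictly compatible with
  precomposition. With \<open>h = u_M\<close> this compares the value of a term on
  \<open>M_0\<close> with its value on \<open>M^\<sigma>\<close>.\<close>

lemma eval_comp1:
  assumes "valuation X \<tau> x a" "has_type \<Sigma> X \<tau> t c" "h \<in> hom1 K w x"
  shows "eval K \<Sigma> M w (\<lambda>y. a y \<cdot> h) t = eval K \<Sigma> M x a t \<cdot> h"
  using assms(2)
proof (induction rule: has_type_induct)
  case (Atom y)
  then show ?case by simp
next
  case (App B ts)
  note a = args_hom[OF assms(1) App(1,3)]
  have x: "x \<in> Obj K" using assms(1) by (simp add: valuation_def)
  have "tup1 K {..<length (fdom \<Sigma> B)} (arg_obs B) w (\<lambda>i. eval K \<Sigma> M w (\<lambda>y. a y \<cdot> h) (ts ! i))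
      = tup1 K {..<length (fdom \<Sigma> B)} (arg_obs B) w (\<lambda>i. eval K \<Sigma> M x a (ts ! i) \<cdot> h)"
    using App by (auto intro: tup1_cong)
  also have "\<dots> = tup1 K {..<length (fdom \<Sigma> B)} (arg_obs B) x (\<lambda>i. eval K \<Sigma> M x a (ts ! i)) \<cdot> h"
    by (rule tup1_comp1[OF arg_product[OF App(1)] a assms(3), symmetric])
  finally show ?case
    using comp1_assoc[OF assms(3) tup1(1)[OF arg_product[OF App(1)] x a] Mfun_hom[OF App(1)]]
    by (simp add: eval_App[OF App(2)] del: eval.simps)
qed

lemma eval_cong:
  assumes "has_type \<Sigma> X \<tau> t c" "\<And>y. y \<in> X \<Longrightarrow> a y = b y"
  shows "eval K \<Sigma> M x a t = eval K \<Sigma> M x b t"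
  using assms(1)
proof (induction rule: has_type_induct)
  case (App B ts)
  then show ?case
    by (auto simp: eval_App simp del: eval.simps intro!: arg_cong[where f="(\<cdot>) _"] tup1_cong)
qed (simp add: assms(2))

end

section \<open>Lax morphisms and the cells \<eta>\<close>

locale lax_morphism = M: model_in K \<Sigma> M + N: model_in K \<Sigma> N
  for K :: "('o, 'm, 't) two_cat" (structure)
    and \<Sigma> :: "('c, 'b, 'v, 'a) sig2"
    and M N :: "('c, 'b, 'a, 'o, 'm, 't) model" +
  fixes F :: "('c, 'b, 'm, 't) lax_mor"
  assumes lax: "is_lax_mor K \<Sigma> M N F"
begin

lemma Lmor_hom: "c \<in> cats \<Sigma> \<Longrightarrow> Lmor F c \<in> hom1 K (Mob M c) (Mob N c)"
  using lax by (simp add: is_lax_mor_def)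

lemma list_mor_hom:
  "set cs \<subseteq> cats \<Sigma> \<Longrightarrow> list_mor K M N F cs \<in>
    hom1 K (prod_obj K {..<length cs} (nth (map (Mob M) cs))) (prod_obj K {..<length cs} (nth (map (Mob N) cs)))"
  unfolding list_mor_def lprod_mor_def
  by (auto intro!: M.prod_mor M.list_product N.list_product Lmor_hom simp: subsetD)

lemma proj_list_mor:
  "\<lbrakk>set cs \<subseteq> cats \<Sigma>; i < length cs\<rbrakk> \<Longrightarrow>
    proj K {..<length cs} (nth (map (Mob N) cs)) i \<cdot> list_mor K M N F cs =
      Lmor F (cs ! i) \<cdot> proj K {..<length cs} (nth (map (Mob M) cs)) i"
  unfolding list_mor_def lprod_mor_def
  using M.prod_mor(2)[OF M.list_product N.list_product, of cs "nth (map (Lmor F) cs)" i]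
  by (auto simp: Lmor_hom subsetD)

lemma list_mor_tup1:
  assumes "set cs \<subseteq> cats \<Sigma>" "x \<in> Obj K"
    and "\<And>i. i \<in> {..<length cs} \<Longrightarrow> f i \<in> hom1 K x (map (Mob M) cs ! i)"
  shows "list_mor K M N F cs \<cdot> tup1 K {..<length cs} (nth (map (Mob M) cs)) x f =
    tup1 K {..<length cs} (nth (map (Mob N) cs)) x (\<lambda>i. Lmor F (cs ! i) \<cdot> f i)"
proof -
  have "list_mor K M N F cs \<cdot> tup1 K {..<length cs} (nth (map (Mob M) cs)) x f =
    tup1 K {..<length cs} (nth (map (Mob N) cs)) x (\<lambda>i. map (Lmor F) cs ! i \<cdot> f i)"
    unfolding list_mor_def lprod_mor_def length_map
    using assms by (intro M.prod_mor_tup1 M.list_product N.list_product)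
      (auto simp: Lmor_hom subsetD)
  also have "\<dots> = tup1 K {..<length cs} (nth (map (Mob N) cs)) x (\<lambda>i. Lmor F (cs ! i) \<cdot> f i)"
    by (auto intro: M.tup1_cong)
  finally show ?thesis .
qed

lemma list_mor_tup2:
  assumes "set cs \<subseteq> cats \<Sigma>" "x \<in> Obj K"
    and "\<And>i. i \<in> {..<length cs} \<Longrightarrow> \<alpha> i \<in> cells K x (map (Mob M) cs ! i) (f i) (g i)"
  shows "lwhisk K (list_mor K M N F cs) (tup2 K {..<length cs} (nth (map (Mob M) cs)) x \<alpha>) =
    tup2 K {..<length cs} (nth (map (Mob N) cs)) x (\<lambda>i. lwhisk K (Lmor F (cs ! i)) (\<alpha> i))"
proof -
  have "lwhisk K (list_mor K M N F cs) (tup2 K {..<length cs} (nth (map (Mob M) cs)) x \<alpha>) =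
    tup2 K {..<length cs} (nth (map (Mob N) cs)) x (\<lambda>i. lwhisk K (map (Lmor F) cs ! i) (\<alpha> i))"
    unfolding list_mor_def lprod_mor_def length_map
    using assms by (intro M.prod_mor_tup2 M.list_product N.list_product)
      (auto simp: Lmor_hom subsetD)
  also have "\<dots> = tup2 K {..<length cs} (nth (map (Mob N) cs)) x (\<lambda>i. lwhisk K (Lmor F (cs ! i)) (\<alpha> i))"
    by (auto intro: M.tup2_cong)
  finally show ?thesis .
qed

lemma Lcell_cells:
  assumes "B \<in> funs \<Sigma>"
  shows "Lcell F B \<in> cells K (prod_obj K {..<length (fdom \<Sigma> B)} (M.arg_obs B)) (Mob N (fcod \<Sigma> B))
    (Mfun N B \<cdot> list_mor K M N F (fdom \<Sigma> B)) (Lmor F (fcod \<Sigma> B) \<cdot> Mfun M B)"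
  using lax assms
  by (intro M.cellsI M.comp1_hom[OF list_mor_hom N.Mfun_hom] M.fun_types) (auto simp: is_lax_mor_def)

text \<open>The valuation in \<open>N\<close> obtained by applying \<open>F\<close> to every atom.
  Evaluating in \<open>N\<close> at a pushed valuation generalises the 1-cell
  \<open>N(t) F_0\<close> to stages that are not products.\<close>

abbreviation (input) push :: "('x \<Rightarrow> 'c) \<Rightarrow> ('x \<Rightarrow> 'm) \<Rightarrow> 'x \<Rightarrow> 'm" where
  "push \<tau> a \<equiv> \<lambda>y. Lmor F (\<tau> y) \<cdot> a y"

lemma eta_App:
  "length ts = length (fdom \<Sigma> B) \<Longrightarrow>
    eta K \<Sigma> M N F \<tau> x a (App B ts) =
      rwhisk K (Lcell F B)
        (tup1 K {..<length (fdom \<Sigma> B)} (M.arg_obs B) x (\<lambda>i. eval K \<Sigma> M x a (ts ! i)))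
      \<bullet> lwhisk K (Mfun N B)
        (tup2 K {..<length (fdom \<Sigma> B)} (N.arg_obs B) x (\<lambda>i. eta K \<Sigma> M N F \<tau> x a (ts ! i)))"
  unfolding eta.simps ltup1_def ltup2_def
  by (intro arg_cong2[where f="(\<bullet>)"] arg_cong[where f="rwhisk K _"] arg_cong[where f="lwhisk K _"])
    (auto intro!: M.tup1_cong M.tup2_cong)

text \<open>The endpoints are normalised so that the two factors in the recursion for
  \<open>eta\<close> compose: the domain becomes \<open>Mfun N B\<close> after the tuple of
  \<open>Lmor F\<close> applied to the arguments, which is where the tuple of the \<eta> of the
  arguments ends.\<close>

lemma Lcell_rwhisk_cells:
  assumes "B \<in> funs \<Sigma>" "x \<in> Obj K"
    and "\<And>i. i \<in> {..<length (fdom \<Sigma> B)} \<Longrightarrow> f i \<in> hom1 K x (M.arg_obs B i)"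
  shows "rwhisk K (Lcell F B) (tup1 K {..<length (fdom \<Sigma> B)} (M.arg_obs B) x f) \<in>
    cells K x (Mob N (fcod \<Sigma> B))
      (Mfun N B \<cdot> tup1 K {..<length (fdom \<Sigma> B)} (N.arg_obs B) x (\<lambda>i. Lmor F (fdom \<Sigma> B ! i) \<cdot> f i))
      (Lmor F (fcod \<Sigma> B) \<cdot> Mfun M B \<cdot> tup1 K {..<length (fdom \<Sigma> B)} (M.arg_obs B) x f)"
proof -
  have t: "tup1 K {..<length (fdom \<Sigma> B)} (M.arg_obs B) x f
      \<in> hom1 K x (prod_obj K {..<length (fdom \<Sigma> B)} (M.arg_obs B))"
    by (rule M.tup1(1)[OF M.arg_product[OF assms(1)] assms(2,3)])
  note cs = M.fun_types(1)[OF assms(1)]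
  have l: "list_mor K M N F (fdom \<Sigma> B) \<cdot> tup1 K {..<length (fdom \<Sigma> B)} (M.arg_obs B) x f =
      tup1 K {..<length (fdom \<Sigma> B)} (N.arg_obs B) x (\<lambda>i. Lmor F (fdom \<Sigma> B ! i) \<cdot> f i)"
    by (rule list_mor_tup1[OF cs assms(2,3)])
  show ?thesis
    using M.rwhisk_cells[OF Lcell_cells[OF assms(1)] t]
    by (simp add: M.comp1_assoc[OF t list_mor_hom[OF cs] N.Mfun_hom[OF assms(1)]]
        M.comp1_assoc[OF t M.Mfun_hom[OF assms(1)] Lmor_hom[OF M.fun_types(2)[OF assms(1)]]]
        l)
qed

text \<open>On an atom both endpoints are literally \<open>Lmor F (\<tau> y) \<cdot> a y\<close>.
  For \<open>App\<close> the tuple of the \<eta> of the arguments runs from the pushed values to the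
  domain of the whiskered lax cell.\<close>

lemma eta_cells:
  assumes "M.valuation X \<tau> x a" "has_type \<Sigma> X \<tau> t c"
  shows "eta K \<Sigma> M N F \<tau> x a t \<in>
    cells K x (Mob N c) (eval K \<Sigma> N x (push \<tau> a) t) (Lmor F c \<cdot> eval K \<Sigma> M x a t)"
  using assms(2)
proof (induction rule: has_type_induct)
  case (Atom y)
  then show ?case
    using assms(1) by (auto simp: M.valuation_def intro!: M.Id2_cells intro: M.comp1_hom Lmor_hom)
next
  case (App B ts)
  have x: "x \<in> Obj K" using assms(1) by (simp add: M.valuation_def)
  have "tup2 K {..<length (fdom \<Sigma> B)} (N.arg_obs B) x (\<lambda>i. eta K \<Sigma> M N F \<tau> x a (ts ! i)) \<in>
    cells K x (prod_obj K {..<length (fdom \<Sigma> B)} (N.arg_obs B))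
      (tup1 K {..<length (fdom \<Sigma> B)} (N.arg_obs B) x (\<lambda>i. eval K \<Sigma> N x (push \<tau> a) (ts ! i)))
      (tup1 K {..<length (fdom \<Sigma> B)} (N.arg_obs B) x (\<lambda>i. Lmor F (fdom \<Sigma> B ! i) \<cdot> eval K \<Sigma> M x a (ts ! i)))"
    using App x by (intro M.tup2 N.arg_product) auto
  from M.lwhisk_cells[OF N.Mfun_hom[OF App(1)] this]
    Lcell_rwhisk_cells[OF App(1) x M.args_hom[OF assms(1) App(1,3)]]
  show ?case
    by (auto simp: eta_App[OF App(2)] M.eval_App[OF App(2)] N.eval_App[OF App(2)]
        simp del: eta.simps eval.simps intro: M.vcomp_cells)
qed

lemma eta_args_cells:
  assumes "M.valuation X \<tau> x a" "B \<in> funs \<Sigma>"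
    and "\<And>i. i < length (fdom \<Sigma> B) \<Longrightarrow> has_type \<Sigma> X \<tau> (ts ! i) (fdom \<Sigma> B ! i)"
    and "i \<in> {..<length (fdom \<Sigma> B)}"
  shows "eta K \<Sigma> M N F \<tau> x a (ts ! i) \<in> cells K x (N.arg_obs B i)
    (eval K \<Sigma> N x (push \<tau> a) (ts ! i)) (Lmor F (fdom \<Sigma> B ! i) \<cdot> eval K \<Sigma> M x a (ts ! i))"
  using assms by (auto intro: eta_cells)

text \<open>Whiskering by \<open>h\<close> distributes over the two factors of the recursion and
  passes into tuples. With \<open>h = u_M\<close> the cell \<open>\<eta>_t * u_M\<close> becomes
  \<eta> over \<open>M^\<sigma>\<close>, given by the same recursion on \<open>t\<close>.\<close>

lemma eta_comp1:
  assumes "M.valuation X \<tau> x a" "has_type \<Sigma> X \<tau> t c" "h \<in> hom1 K w x"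
  shows "eta K \<Sigma> M N F \<tau> w (\<lambda>y. a y \<cdot> h) t = rwhisk K (eta K \<Sigma> M N F \<tau> x a t) h"
  using assms(2)
proof (induction rule: has_type_induct)
  case (Atom y)
  then have "\<tau> y \<in> cats \<Sigma>" "a y \<in> hom1 K x (Mob M (\<tau> y))"
    using assms(1) by (auto simp: M.valuation_def)
  then show ?case
    using assms(3)
    by (simp add: M.comp1_assoc[OF _ _ Lmor_hom] M.rwhisk_Id2[OF M.comp1_hom[OF _ Lmor_hom]])
next
  case (App B ts)
  have x: "x \<in> Obj K" using assms(1) by (simp add: M.valuation_def)
  let ?L = "{..<length (fdom \<Sigma> B)}"
  let ?e = "\<lambda>i. eval K \<Sigma> M x a (ts ! i)" and ?\<eta> = "\<lambda>i. eta K \<Sigma> M N F \<tau> x a (ts ! i)"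
  note e = M.args_hom[OF assms(1) App(1,3)] and \<eta> = eta_args_cells[OF assms(1) App(1,3)]
  have tM: "tup1 K ?L (M.arg_obs B) w (\<lambda>i. eval K \<Sigma> M w (\<lambda>y. a y \<cdot> h) (ts ! i))
      = tup1 K ?L (M.arg_obs B) x ?e \<cdot> h"
    by (subst M.tup1_comp1[OF M.arg_product[OF App(1)] e assms(3)])
      (auto intro!: M.tup1_cong M.eval_comp1[OF assms(1) App(3) assms(3)])
  have tN: "tup2 K ?L (N.arg_obs B) w (\<lambda>i. eta K \<Sigma> M N F \<tau> w (\<lambda>y. a y \<cdot> h) (ts ! i))
      = rwhisk K (tup2 K ?L (N.arg_obs B) x ?\<eta>) h"
    by (subst M.tup2_rwhisk[OF N.arg_product[OF App(1)] \<eta> assms(3)])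
      (auto intro: M.tup2_cong simp: App(4))
  have t1: "tup1 K ?L (M.arg_obs B) x ?e \<in> hom1 K x (prod_obj K ?L (M.arg_obs B))"
    by (rule M.tup1(1)[OF M.arg_product[OF App(1)] x e])
  have t2: "tup2 K ?L (N.arg_obs B) x ?\<eta> \<in> cells K x (prod_obj K ?L (N.arg_obs B))
      (tup1 K ?L (N.arg_obs B) x (\<lambda>i. eval K \<Sigma> N x (push \<tau> a) (ts ! i)))
      (tup1 K ?L (N.arg_obs B) x (\<lambda>i. Lmor F (fdom \<Sigma> B ! i) \<cdot> ?e i))"
    by (rule M.tup2(1)[OF N.arg_product[OF App(1)] x \<eta>])
  have L: "rwhisk K (Lcell F B) (tup1 K ?L (M.arg_obs B) x ?e) \<in> cells K x (Mob N (fcod \<Sigma> B))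
      (Mfun N B \<cdot> tup1 K ?L (N.arg_obs B) x (\<lambda>i. Lmor F (fdom \<Sigma> B ! i) \<cdot> ?e i))
      (Lmor F (fcod \<Sigma> B) \<cdot> Mfun M B \<cdot> tup1 K ?L (M.arg_obs B) x ?e)"
    by (rule Lcell_rwhisk_cells[OF App(1) x e])
  show ?case
    unfolding eta_App[OF App(2)] tM tN
      M.rwhisk_vcomp[OF L M.lwhisk_cells[OF N.Mfun_hom[OF App(1)] t2] assms(3)]
      M.rwhisk_comp1[OF Lcell_cells[OF App(1)] t1 assms(3)]
      M.lwhisk_rwhisk[OF N.Mfun_hom[OF App(1)] t2 assms(3)] ..
qed

end

section \<open>Contexts and substitution\<close>

lemma subst_nth:
  assumes "distinct xs" "length ts = length xs"
  shows "subst xs ts t = bind_trm (\<lambda>x. the (map_of (zip xs ts) x)) t"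
    and "i < length xs \<Longrightarrow> the (map_of (zip xs ts) (xs ! i)) = ts ! i"
  using assms by (simp_all add: subst_def map_of_zip_nth)

context model_in
begin

abbreviation "ctx_ob xs \<equiv> nth (map (Mob M) (map (vtype \<Sigma>) xs))"

lemma ctx_obs_eq: "ctx_obs \<Sigma> M xs = map (Mob M) (map (vtype \<Sigma>) xs)"
  by (simp add: ctx_obs_def)

lemma lprod_ctx: "lprod_obj K (ctx_obs \<Sigma> M xs) = prod_obj K {..<length xs} (ctx_ob xs)"
  by (simp add: lprod_obj_def ctx_obs_eq del: map_map)

lemma ctx_product:
  "vtype \<Sigma> ` set xs \<subseteq> cats \<Sigma> \<Longrightarrow> has_product K {..<length xs} (ctx_ob xs)"
  using list_product[of "map (vtype \<Sigma>) xs"] by (simp del: map_map)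

text \<open>\<open>ctx_proj\<close> finds a position by a definite description; distinctness of the
  context makes the position unique.\<close>

lemma ctx_proj_nth:
  assumes "distinct xs" "i < length xs"
  shows "ctx_proj K \<Sigma> M xs (xs ! i) = proj K {..<length xs} (ctx_ob xs) i"
proof -
  have "(THE j. j < length xs \<and> xs ! j = xs ! i) = i"
    using assms by (auto simp: nth_eq_iff_index_eq)
  then show ?thesis by (simp add: ctx_proj_def lproj_def ctx_obs_eq del: map_map)
qed

lemma ctx_valuation:
  assumes "distinct xs" "vtype \<Sigma> ` set xs \<subseteq> cats \<Sigma>"
  shows "valuation (set xs) (vtype \<Sigma>) (prod_obj K {..<length xs} (ctx_ob xs)) (ctx_proj K \<Sigma> M xs)"
proof -
  have "proj K {..<length xs} (ctx_ob xs) i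
      \<in> hom1 K (prod_obj K {..<length xs} (ctx_ob xs)) (Mob M (vtype \<Sigma> (xs ! i)))" if "i < length xs" for i
    using proj_hom[OF ctx_product[OF assms(2)], of i] that by simp
  then show ?thesis
    using assms prod_obj_Obj[OF ctx_product[OF assms(2)]]
    by (auto simp: valuation_def in_set_conv_nth ctx_proj_nth simp del: map_map)
qed

lemma eval_ctx_eq:
  "eval_ctx K \<Sigma> M xs t =
    eval K \<Sigma> M (prod_obj K {..<length xs} (ctx_ob xs)) (ctx_proj K \<Sigma> M xs) t"
  by (simp add: eval_ctx_def lprod_ctx del: map_map)

text \<open>Along the tuple of the substituted values, the projections of the context product become
  these values. The claim is then \<open>eval_comp1\<close> for the valuation given by the
  projections.\<close>

lemma eval_subst:
  assumes "distinct xs" "vtype \<Sigma> ` set xs \<subseteq> cats \<Sigma>" "has_type \<Sigma> (set xs) (vtype \<Sigma>) t c"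
    and "length ts = length xs" "x \<in> Obj K"
    and "\<And>i. i \<in> {..<length xs} \<Longrightarrow> eval K \<Sigma> M x a (ts ! i) \<in> hom1 K x (ctx_ob xs i)"
  shows "eval K \<Sigma> M x a (subst xs ts t) =
    eval_ctx K \<Sigma> M xs t \<cdot> tup1 K {..<length xs} (ctx_ob xs) x (\<lambda>i. eval K \<Sigma> M x a (ts ! i))"
proof -
  let ?T = "tup1 K {..<length xs} (ctx_ob xs) x (\<lambda>i. eval K \<Sigma> M x a (ts ! i))"
  have T: "?T \<in> hom1 K x (prod_obj K {..<length xs} (ctx_ob xs))"
    by (rule tup1(1)[OF ctx_product[OF assms(2)] assms(5,6)])
  have "eval K \<Sigma> M x a (the (map_of (zip xs ts) y)) = ctx_proj K \<Sigma> M xs y \<cdot> ?T" if "y \<in> set xs" for y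
    using that tup1(2)[OF ctx_product[OF assms(2)] assms(5), of "\<lambda>i. eval K \<Sigma> M x a (ts ! i)", OF assms(6)]
    by (auto simp: in_set_conv_nth ctx_proj_nth[OF assms(1)] subst_nth[OF assms(1,4)] simp del: map_map)
  then show ?thesis
    unfolding subst_nth(1)[OF assms(1,4)] eval_bind_trm eval_ctx_eq
      eval_comp1[OF ctx_valuation[OF assms(1,2)] assms(3) T, symmetric]
    by (rule eval_cong[OF assms(3)])
qed

end

context lax_morphism
begin

text \<open>The substituted terms enter through \<open>k\<close>, their joint value in \<open>M\<close>, and \<open>\<Lambda>\<close>, the 2-cell with
  components \<open>\<eta>\<close> of \<open>\<rho> y\<close>; below, \<open>P\<close> and \<open>Q\<close> are the products \<open>M\<^sub>x\<close> and \<open>N\<^sub>x\<close> over a context.\<close>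

lemma eta_bind_trm:
  assumes p: "M.valuation Y \<tau> P p" and q: "N.valuation Y \<tau> Q q"
    and G: "G \<in> hom1 K P Q" "\<And>y. y \<in> Y \<Longrightarrow> q y \<cdot> G = Lmor F (\<tau> y) \<cdot> p y"
    and k: "k \<in> hom1 K x P" "\<And>y. y \<in> Y \<Longrightarrow> eval K \<Sigma> M x a (\<rho> y) = p y \<cdot> k"
    and \<Lambda>: "\<Lambda> \<in> cells K x Q l (G \<cdot> k)"
      "\<And>y. y \<in> Y \<Longrightarrow> eta K \<Sigma> M N F \<upsilon> x a (\<rho> y) = lwhisk K (q y) \<Lambda>"
    and t: "has_type \<Sigma> Y \<tau> t c"
  shows "eta K \<Sigma> M N F \<upsilon> x a (bind_trm \<rho> t) =
    rwhisk K (eta K \<Sigma> M N F \<tau> P p t) k \<bullet> lwhisk K (eval K \<Sigma> N Q q t) \<Lambda>"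
  using t
proof (induction rule: has_type_induct)
  case (Atom y)
  have y: "\<tau> y \<in> cats \<Sigma>" "p y \<in> hom1 K P (Mob M (\<tau> y))" "q y \<in> hom1 K Q (Mob N (\<tau> y))"
    using Atom p q by (auto simp: M.valuation_def N.valuation_def)
  have "rwhisk K (Id2 K (Lmor F (\<tau> y) \<cdot> p y)) k = Id2 K (q y \<cdot> G \<cdot> k)"
    using M.rwhisk_Id2[OF M.comp1_hom[OF y(2) Lmor_hom[OF y(1)]] k(1)] M.comp1_assoc[OF k(1) G(1) y(3)]
      G(2)[OF Atom] by simp
  then show ?case
    using M.vcomp_Id2(1)[OF M.lwhisk_cells[OF y(3) \<Lambda>(1)]] \<Lambda>(2)[OF Atom] by simp
next
  case (App B ts)
  let ?L = "{..<length (fdom \<Sigma> B)}"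
  let ?e = "\<lambda>i. eval K \<Sigma> M P p (ts ! i)" and ?\<eta> = "\<lambda>i. eta K \<Sigma> M N F \<tau> P p (ts ! i)"
    and ?n = "\<lambda>i. eval K \<Sigma> N Q q (ts ! i)"
  let ?T = "tup1 K ?L (M.arg_obs B) P ?e" and ?E = "tup2 K ?L (N.arg_obs B) P ?\<eta>"
    and ?R = "tup1 K ?L (N.arg_obs B) Q ?n"
  have objs: "P \<in> Obj K" "Q \<in> Obj K" "x \<in> Obj K"
    using p q M.hom1_Obj(1)[OF k(1)] by (auto simp: M.valuation_def N.valuation_def)
  have e: "?e i \<in> hom1 K P (M.arg_obs B i)" if "i \<in> ?L" for i
    using p App(1,3) that by (rule M.args_hom)
  have n: "?n i \<in> hom1 K Q (N.arg_obs B i)" if "i \<in> ?L" for i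
    using q App(1,3) that by (rule N.args_hom)
  note NB = N.Mfun_hom[OF App(1)]
  \<comment> \<open>Since \<open>G\<close> carries \<open>q\<close> to the push of \<open>p\<close>,
    the domain can be rewritten as \<open>?n i \<cdot> G\<close>. In this form the cell, whiskered
    by \<open>k\<close>, composes with \<Lambda> whiskered by \<open>?n i\<close>.\<close>
  have \<eta>: "?\<eta> i \<in> cells K P (N.arg_obs B i) (?n i \<cdot> G) (Lmor F (fdom \<Sigma> B ! i) \<cdot> ?e i)"
    if "i \<in> ?L" for i
  proof -
    have i: "has_type \<Sigma> Y \<tau> (ts ! i) (fdom \<Sigma> B ! i)"
      using App(3) that by simp
    have "?n i \<cdot> G = eval K \<Sigma> N P (push \<tau> p) (ts ! i)"
      unfolding N.eval_comp1[OF q i G(1), symmetric] by (rule N.eval_cong[OF i G(2)])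
    with eta_args_cells[OF p App(1,3), of i] that show ?thesis by simp
  qed
  have T: "?T \<in> hom1 K P (prod_obj K ?L (M.arg_obs B))"
    by (rule M.tup1(1)[OF M.arg_product[OF App(1)] objs(1) e])
  have R: "?R \<in> hom1 K Q (prod_obj K ?L (N.arg_obs B))"
    by (rule M.tup1(1)[OF N.arg_product[OF App(1)] objs(2) n])
  have RG: "?R \<cdot> G = tup1 K ?L (N.arg_obs B) P (\<lambda>i. ?n i \<cdot> G)"
    by (rule M.tup1_comp1[OF N.arg_product[OF App(1)] n G(1)])
  have E: "?E \<in> cells K P (prod_obj K ?L (N.arg_obs B)) (?R \<cdot> G)
      (tup1 K ?L (N.arg_obs B) P (\<lambda>i. Lmor F (fdom \<Sigma> B ! i) \<cdot> ?e i))"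
    unfolding RG by (rule M.tup2(1)[OF N.arg_product[OF App(1)] objs(1) \<eta>])
  have L: "rwhisk K (Lcell F B) ?T \<in> cells K P (Mob N (fcod \<Sigma> B))
      (Mfun N B \<cdot> tup1 K ?L (N.arg_obs B) P (\<lambda>i. Lmor F (fdom \<Sigma> B ! i) \<cdot> ?e i))
      (Lmor F (fcod \<Sigma> B) \<cdot> Mfun M B \<cdot> ?T)"
    by (rule Lcell_rwhisk_cells[OF App(1) objs(1) e])
  have tM: "tup1 K ?L (M.arg_obs B) x (\<lambda>i. eval K \<Sigma> M x a (map (bind_trm \<rho>) ts ! i)) = ?T \<cdot> k"
  proof (subst M.tup1_comp1[OF M.arg_product[OF App(1)] e k(1)])
    have "eval K \<Sigma> M x a (bind_trm \<rho> (ts ! i)) = ?e i \<cdot> k" if "i < length (fdom \<Sigma> B)" for i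
      unfolding eval_bind_trm M.eval_comp1[OF p App(3)[OF that] k(1), symmetric]
      by (rule M.eval_cong[OF App(3)[OF that] k(2)])
    then show "tup1 K ?L (M.arg_obs B) x (\<lambda>i. eval K \<Sigma> M x a (map (bind_trm \<rho>) ts ! i)) =
        tup1 K ?L (M.arg_obs B) x (\<lambda>i. ?e i \<cdot> k)"
      by (auto intro: M.tup1_cong simp: App(2))
  qed simp
  \<comment> \<open>The induction hypothesis presents every component as a composite of two cells.
    The tuple splits accordingly: one factor is whiskered by \<open>k\<close>, the other is
    \<Lambda> whiskered by the tuple \<open>?R\<close>.\<close>
  have tN: "tup2 K ?L (N.arg_obs B) x (\<lambda>i. eta K \<Sigma> M N F \<upsilon> x a (map (bind_trm \<rho>) ts ! i)) =
      rwhisk K ?E k \<bullet> lwhisk K ?R \<Lambda>"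
  proof -
    have n': "?n i \<cdot> G \<cdot> k = (?n i \<cdot> G) \<cdot> k" if "i \<in> ?L" for i
      using M.comp1_assoc[OF k(1) G(1) n[OF that]] by simp
    have 1: "rwhisk K (?\<eta> i) k \<in> cells K x (N.arg_obs B i) (?n i \<cdot> G \<cdot> k) ((Lmor F (fdom \<Sigma> B ! i) \<cdot> ?e i) \<cdot> k)"
      if "i \<in> ?L" for i
      unfolding n'[OF that] by (rule M.rwhisk_cells[OF \<eta>[OF that] k(1)])
    have 2: "lwhisk K (?n i) \<Lambda> \<in> cells K x (N.arg_obs B i) (?n i \<cdot> l) (?n i \<cdot> G \<cdot> k)"
      if "i \<in> ?L" for i
      by (rule M.lwhisk_cells[OF n[OF that] \<Lambda>(1)])
    have "rwhisk K ?E k = tup2 K ?L (N.arg_obs B) x (\<lambda>i. rwhisk K (?\<eta> i) k)"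
      by (rule M.tup2_rwhisk[OF N.arg_product[OF App(1)] \<eta> k(1)])
    moreover have "lwhisk K ?R \<Lambda> = tup2 K ?L (N.arg_obs B) x (\<lambda>i. lwhisk K (?n i) \<Lambda>)"
      by (rule M.tup1_lwhisk[OF N.arg_product[OF App(1)] n \<Lambda>(1)])
    ultimately have "rwhisk K ?E k \<bullet> lwhisk K ?R \<Lambda> =
        tup2 K ?L (N.arg_obs B) x (\<lambda>i. rwhisk K (?\<eta> i) k \<bullet> lwhisk K (?n i) \<Lambda>)"
      using M.tup2_vcomp[OF N.arg_product[OF App(1)] objs(3) 1 2] by simp
    also have "\<dots> = tup2 K ?L (N.arg_obs B) x (\<lambda>i. eta K \<Sigma> M N F \<upsilon> x a (map (bind_trm \<rho>) ts ! i))"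
      by (rule M.tup2_cong) (simp add: App(2,4))
    finally show ?thesis ..
  qed
  have Ek: "rwhisk K ?E k \<in> cells K x (prod_obj K ?L (N.arg_obs B)) (?R \<cdot> G \<cdot> k)
      (tup1 K ?L (N.arg_obs B) P (\<lambda>i. Lmor F (fdom \<Sigma> B ! i) \<cdot> ?e i) \<cdot> k)"
    using M.rwhisk_cells[OF E k(1)] by (simp add: M.comp1_assoc[OF k(1) G(1) R])
  note R\<Lambda> = M.lwhisk_cells[OF R \<Lambda>(1)]
  have Lk: "rwhisk K (Lcell F B) (?T \<cdot> k) \<in> cells K x (Mob N (fcod \<Sigma> B))
      (Mfun N B \<cdot> tup1 K ?L (N.arg_obs B) P (\<lambda>i. Lmor F (fdom \<Sigma> B ! i) \<cdot> ?e i) \<cdot> k)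
      ((Lmor F (fcod \<Sigma> B) \<cdot> Mfun M B \<cdot> ?T) \<cdot> k)"
    using M.rwhisk_cells[OF L k(1)] M.rwhisk_comp1[OF Lcell_cells[OF App(1)] T k(1)]
      M.comp1_assoc[OF k(1) cellsD(2)[OF E] NB] by simp
  \<comment> \<open>Both sides consist of three factors: the lax cell of \<open>B\<close> at
    \<open>?T \<cdot> k\<close>, \<open>Mfun N B\<close> on \<open>?E\<close> whiskered by
    \<open>k\<close>, and \<open>Mfun N B\<close> on \<Lambda> whiskered by \<open>?R\<close>. They
    differ in bracketing and in the order of whiskerings.\<close>
  show ?case
    unfolding bind_trm.simps eta_App[OF App(2)] eta_App[of "map (bind_trm \<rho>) ts", simplified length_map, OF App(2)]
      N.eval_App[OF App(2)] tM tN
      M.rwhisk_vcomp[OF L M.lwhisk_cells[OF NB E] k(1)]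
      M.rwhisk_comp1[OF Lcell_cells[OF App(1)] T k(1), symmetric]
      M.lwhisk_rwhisk[OF NB E k(1)]
      M.lwhisk_vcomp[OF NB Ek R\<Lambda>] M.lwhisk_comp1[OF NB R \<Lambda>(1)]
      M.vcomp_cells_assoc[OF Lk M.lwhisk_cells[OF NB Ek] M.lwhisk_cells[OF NB R\<Lambda>]] ..
qed

lemma eta_ctx_eq:
  "eta_ctx K \<Sigma> M N F xs t = eta K \<Sigma> M N F (vtype \<Sigma>)
    (prod_obj K {..<length xs} (M.ctx_ob xs)) (ctx_proj K \<Sigma> M xs) t"
  by (simp add: eta_ctx_def M.lprod_ctx del: map_map)

lemma ctx_proj_list_mor:
  assumes "distinct xs" "vtype \<Sigma> ` set xs \<subseteq> cats \<Sigma>" "y \<in> set xs"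
  shows "ctx_proj K \<Sigma> N xs y \<cdot> list_mor K M N F (map (vtype \<Sigma>) xs) =
    Lmor F (vtype \<Sigma> y) \<cdot> ctx_proj K \<Sigma> M xs y"
  using assms proj_list_mor[of "map (vtype \<Sigma>) xs"]
  by (auto simp: in_set_conv_nth M.ctx_proj_nth N.ctx_proj_nth simp del: map_map)

text \<open>Over the product of a context, pushing the projections of \<open>M\<close> amounts to
  composing those of \<open>N\<close> with \<open>list_mor\<close>. The domain thus takes the form
  that occurs in the axiom on lax morphisms.\<close>

lemma eta_ctx_cells:
  assumes "distinct xs" "vtype \<Sigma> ` set xs \<subseteq> cats \<Sigma>" "has_type \<Sigma> (set xs) (vtype \<Sigma>) t c"
  shows "eta_ctx K \<Sigma> M N F xs t \<in> cells K (prod_obj K {..<length xs} (M.ctx_ob xs)) (Mob N c)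
    (eval_ctx K \<Sigma> N xs t \<cdot> list_mor K M N F (map (vtype \<Sigma>) xs)) (Lmor F c \<cdot> eval_ctx K \<Sigma> M xs t)"
proof -
  have G: "list_mor K M N F (map (vtype \<Sigma>) xs) \<in> hom1 K (prod_obj K {..<length xs} (M.ctx_ob xs))
      (prod_obj K {..<length xs} (N.ctx_ob xs))"
    using list_mor_hom[of "map (vtype \<Sigma>) xs"] assms(2) by (simp del: map_map)
  have "eval_ctx K \<Sigma> N xs t \<cdot> list_mor K M N F (map (vtype \<Sigma>) xs) =
      eval K \<Sigma> N (prod_obj K {..<length xs} (M.ctx_ob xs)) (push (vtype \<Sigma>) (ctx_proj K \<Sigma> M xs)) t"
    unfolding N.eval_ctx_eq N.eval_comp1[OF N.ctx_valuation[OF assms(1,2)] assms(3) G, symmetric]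
    by (rule N.eval_cong[OF assms(3)]) (rule ctx_proj_list_mor[OF assms(1,2)])
  then show ?thesis
    using eta_cells[OF M.ctx_valuation[OF assms(1,2)] assms(3)]
    by (simp add: eta_ctx_eq M.eval_ctx_eq del: map_map)
qed

text \<open>The case of \<open>eta_bind_trm\<close> in which \<open>P\<close> and \<open>Q\<close>
  are the context products, \<open>G\<close> is \<open>list_mor\<close>, \<open>k\<close> is the
  tuple of the substituted values and \<Lambda> the tuple of their \<eta>. As
  \<open>list_mor\<close> acts on tuples coordinatewise, \<Lambda> ends at
  \<open>G \<cdot> k\<close>.\<close>

lemma eta_subst:
  assumes a: "M.valuation Z \<upsilon> x a"
    and xs: "distinct xs" "vtype \<Sigma> ` set xs \<subseteq> cats \<Sigma>"
    and t: "has_type \<Sigma> (set xs) (vtype \<Sigma>) t c"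
    and ts: "length ts = length xs" "\<And>i. i < length xs \<Longrightarrow> has_type \<Sigma> Z \<upsilon> (ts ! i) (vtype \<Sigma> (xs ! i))"
  shows "eta K \<Sigma> M N F \<upsilon> x a (subst xs ts t) =
    rwhisk K (eta_ctx K \<Sigma> M N F xs t) (tup1 K {..<length xs} (M.ctx_ob xs) x (\<lambda>i. eval K \<Sigma> M x a (ts ! i)))
    \<bullet> lwhisk K (eval_ctx K \<Sigma> N xs t)
        (tup2 K {..<length xs} (N.ctx_ob xs) x (\<lambda>i. eta K \<Sigma> M N F \<upsilon> x a (ts ! i)))"
proof -
  let ?k = "tup1 K {..<length xs} (M.ctx_ob xs) x (\<lambda>i. eval K \<Sigma> M x a (ts ! i))"
  let ?\<Lambda> = "tup2 K {..<length xs} (N.ctx_ob xs) x (\<lambda>i. eta K \<Sigma> M N F \<upsilon> x a (ts ! i))"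
  let ?G = "list_mor K M N F (map (vtype \<Sigma>) xs)"
  let ?cs = "map (vtype \<Sigma>) xs"
  have x: "x \<in> Obj K" using a by (simp add: M.valuation_def)
  note PM = M.ctx_product[OF xs(2)] and PN = N.ctx_product[OF xs(2)]
  have e: "eval K \<Sigma> M x a (ts ! i) \<in> hom1 K x (M.ctx_ob xs i)" if "i \<in> {..<length xs}" for i
    using M.eval_hom[OF a ts(2)] that by simp
  have \<eta>: "eta K \<Sigma> M N F \<upsilon> x a (ts ! i) \<in> cells K x (N.ctx_ob xs i)
      (eval K \<Sigma> N x (push \<upsilon> a) (ts ! i)) (Lmor F (?cs ! i) \<cdot> eval K \<Sigma> M x a (ts ! i))"
    if "i \<in> {..<length xs}" for i
    using eta_cells[OF a ts(2)] that by simp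
  have Gk: "?G \<cdot> ?k = tup1 K {..<length xs} (N.ctx_ob xs) x (\<lambda>i. Lmor F (?cs ! i) \<cdot> eval K \<Sigma> M x a (ts ! i))"
    using list_mor_tup1[of ?cs x "\<lambda>i. eval K \<Sigma> M x a (ts ! i)"] xs(2) x e by (simp del: map_map)
  show ?thesis
    unfolding subst_nth(1)[OF xs(1) ts(1)] eta_ctx_eq N.eval_ctx_eq
  proof (rule eta_bind_trm[OF M.ctx_valuation[OF xs] N.ctx_valuation[OF xs] _ _ _ _ _ _ t])
    show "?k \<in> hom1 K x (prod_obj K {..<length xs} (M.ctx_ob xs))"
      by (rule M.tup1(1)[OF PM x e])
    show "?G \<in> hom1 K (prod_obj K {..<length xs} (M.ctx_ob xs)) (prod_obj K {..<length xs} (N.ctx_ob xs))"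
      using list_mor_hom[of ?cs] xs(2) by (simp del: map_map)
    show "?\<Lambda> \<in> cells K x (prod_obj K {..<length xs} (N.ctx_ob xs))
        (tup1 K {..<length xs} (N.ctx_ob xs) x (\<lambda>i. eval K \<Sigma> N x (push \<upsilon> a) (ts ! i))) (?G \<cdot> ?k)"
      unfolding Gk by (rule M.tup2(1)[OF PN x \<eta>])
    fix y assume "y \<in> set xs"
    then obtain i where i: "i < length xs" "y = xs ! i" by (auto simp: in_set_conv_nth)
    note nth = subst_nth(2)[OF xs(1) ts(1) i(1)]
    show "ctx_proj K \<Sigma> N xs y \<cdot> ?G = Lmor F (vtype \<Sigma> y) \<cdot> ctx_proj K \<Sigma> M xs y"
      by (rule ctx_proj_list_mor[OF xs \<open>y \<in> set xs\<close>])
    show "eval K \<Sigma> M x a (the (map_of (zip xs ts) y)) = ctx_proj K \<Sigma> M xs y \<cdot> ?k"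
      unfolding i(2) nth M.ctx_proj_nth[OF xs(1) i(1)]
      by (rule M.tup1(2)[OF PM x e, symmetric]) (use i(1) in simp_all)
    show "eta K \<Sigma> M N F \<upsilon> x a (the (map_of (zip xs ts) y)) = lwhisk K (ctx_proj K \<Sigma> N xs y) ?\<Lambda>"
      unfolding i(2) nth N.ctx_proj_nth[OF xs(1) i(1)]
      by (rule M.tup2(2)[OF PN x \<eta>, symmetric]) (use i(1) in simp_all)
  qed
qed

text \<open>By the substitution formula, \<eta> of a substituted term is \<eta> over the context,
  whiskered by \<open>?k\<close>, after a whiskering of \<open>?\<Lambda>\<close>. The axiom on lax
  morphisms takes the transformation across the first factor, interchange takes it across the
  second.\<close>

lemma eta_natural_subst:
  assumes a: "M.valuation Z \<upsilon> x a"
    and \<theta>: "\<theta> \<in> trans_syms \<Sigma>"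
    and xs: "distinct (ctx \<Sigma> \<theta>)" "vtype \<Sigma> ` set (ctx \<Sigma> \<theta>) \<subseteq> cats \<Sigma>"
    and t: "has_type \<Sigma> (set (ctx \<Sigma> \<theta>)) (vtype \<Sigma>) (tdom \<Sigma> \<theta>) c"
      "has_type \<Sigma> (set (ctx \<Sigma> \<theta>)) (vtype \<Sigma>) (tcod \<Sigma> \<theta>) c"
    and ts: "length ts = length (ctx \<Sigma> \<theta>)"
      "\<And>i. i < length (ctx \<Sigma> \<theta>) \<Longrightarrow> has_type \<Sigma> Z \<upsilon> (ts ! i) (vtype \<Sigma> (ctx \<Sigma> \<theta> ! i))"
  shows "lwhisk K (Lmor F c) (rwhisk K (Mtrans M \<theta>)
      (tup1 K {..<length (ctx \<Sigma> \<theta>)} (M.ctx_ob (ctx \<Sigma> \<theta>)) x (\<lambda>i. eval K \<Sigma> M x a (ts ! i))))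
      \<bullet> eta K \<Sigma> M N F \<upsilon> x a (subst (ctx \<Sigma> \<theta>) ts (tdom \<Sigma> \<theta>)) =
    eta K \<Sigma> M N F \<upsilon> x a (subst (ctx \<Sigma> \<theta>) ts (tcod \<Sigma> \<theta>))
      \<bullet> rwhisk K (Mtrans N \<theta>)
      (tup1 K {..<length (ctx \<Sigma> \<theta>)} (N.ctx_ob (ctx \<Sigma> \<theta>)) x (\<lambda>i. eval K \<Sigma> N x (push \<upsilon> a) (ts ! i)))"
proof -
  let ?xs = "ctx \<Sigma> \<theta>"
  let ?I = "{..<length ?xs}"
  let ?k = "tup1 K ?I (M.ctx_ob ?xs) x (\<lambda>i. eval K \<Sigma> M x a (ts ! i))"
  let ?l = "tup1 K ?I (N.ctx_ob ?xs) x (\<lambda>i. eval K \<Sigma> N x (push \<upsilon> a) (ts ! i))"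
  let ?\<Lambda> = "tup2 K ?I (N.ctx_ob ?xs) x (\<lambda>i. eta K \<Sigma> M N F \<upsilon> x a (ts ! i))"
  let ?cs = "map (vtype \<Sigma>) ?xs"
  let ?G = "list_mor K M N F ?cs" and ?P = "prod_obj K ?I (M.ctx_ob ?xs)" and ?Q = "prod_obj K ?I (N.ctx_ob ?xs)"
  let ?e1 = "eta_ctx K \<Sigma> M N F ?xs (tdom \<Sigma> \<theta>)" and ?e2 = "eta_ctx K \<Sigma> M N F ?xs (tcod \<Sigma> \<theta>)"
  let ?n1 = "eval_ctx K \<Sigma> N ?xs (tdom \<Sigma> \<theta>)" and ?n2 = "eval_ctx K \<Sigma> N ?xs (tcod \<Sigma> \<theta>)"
  let ?m1 = "eval_ctx K \<Sigma> M ?xs (tdom \<Sigma> \<theta>)" and ?m2 = "eval_ctx K \<Sigma> M ?xs (tcod \<Sigma> \<theta>)"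
  have x: "x \<in> Obj K" using a by (simp add: M.valuation_def)
  note PM = M.ctx_product[OF xs(2)] and PN = N.ctx_product[OF xs(2)]
  have e: "eval K \<Sigma> M x a (ts ! i) \<in> hom1 K x (M.ctx_ob ?xs i)" if "i \<in> ?I" for i
    using M.eval_hom[OF a ts(2)] that by simp
  have \<eta>: "eta K \<Sigma> M N F \<upsilon> x a (ts ! i) \<in> cells K x (N.ctx_ob ?xs i)
      (eval K \<Sigma> N x (push \<upsilon> a) (ts ! i)) (Lmor F (?cs ! i) \<cdot> eval K \<Sigma> M x a (ts ! i))"
    if "i \<in> ?I" for i
    using eta_cells[OF a ts(2)] that by simp
  have Gk: "?G \<cdot> ?k = tup1 K ?I (N.ctx_ob ?xs) x (\<lambda>i. Lmor F (?cs ! i) \<cdot> eval K \<Sigma> M x a (ts ! i))"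
    using list_mor_tup1[of ?cs x "\<lambda>i. eval K \<Sigma> M x a (ts ! i)"] xs(2) x e by (simp del: map_map)
  have k: "?k \<in> hom1 K x ?P"
    by (rule M.tup1(1)[OF PM x e])
  have G: "?G \<in> hom1 K ?P ?Q"
    using list_mor_hom[of ?cs] xs(2) by (simp del: map_map)
  have \<Lambda>: "?\<Lambda> \<in> cells K x ?Q ?l (?G \<cdot> ?k)"
    unfolding Gk by (rule M.tup2(1)[OF PN x \<eta>])
  have n: "?n1 \<in> hom1 K ?Q (Mob N c)" "?n2 \<in> hom1 K ?Q (Mob N c)"
    unfolding N.eval_ctx_eq by (rule N.eval_hom[OF N.ctx_valuation[OF xs] t(1)] N.eval_hom[OF N.ctx_valuation[OF xs] t(2)])+
  have m: "?m1 \<in> hom1 K ?P (Mob M c)" "?m2 \<in> hom1 K ?P (Mob M c)"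
    unfolding M.eval_ctx_eq by (rule M.eval_hom[OF M.ctx_valuation[OF xs] t(1)] M.eval_hom[OF M.ctx_valuation[OF xs] t(2)])+
  have M\<theta>: "Mtrans M \<theta> \<in> cells K ?P (Mob M c) ?m1 ?m2"
    using M.model \<theta> by (intro M.cellsI m) (simp add: is_model_def)
  have N\<theta>: "Mtrans N \<theta> \<in> cells K ?Q (Mob N c) ?n1 ?n2"
    using N.model \<theta> by (intro M.cellsI n) (simp add: is_model_def)
  note e1 = eta_ctx_cells[OF xs t(1)] and e2 = eta_ctx_cells[OF xs t(2)]
  have c: "c \<in> cats \<Sigma>"
    by (rule M.type_in_cats[OF M.ctx_valuation[OF xs] t(1)])
  have lax_\<theta>: "lwhisk K (Lmor F c) (Mtrans M \<theta>) \<bullet> ?e1 = ?e2 \<bullet> rwhisk K (Mtrans N \<theta>) ?G"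
    using lax \<theta> unfolding is_lax_mor_def typ_of_eq[OF t(1), symmetric] by blast
  note F\<theta> = M.lwhisk_cells[OF Lmor_hom[OF c] M\<theta>] and \<theta>G = M.rwhisk_cells[OF N\<theta> G]
  note n1\<Lambda> = M.lwhisk_cells[OF n(1) \<Lambda>] and n2\<Lambda> = M.lwhisk_cells[OF n(2) \<Lambda>]
  have assoc: "?n1 \<cdot> ?G \<cdot> ?k = (?n1 \<cdot> ?G) \<cdot> ?k" "?n2 \<cdot> ?G \<cdot> ?k = (?n2 \<cdot> ?G) \<cdot> ?k"
    by (simp_all only: M.comp1_assoc[OF k G n(1)] M.comp1_assoc[OF k G n(2)])
  note n1\<Lambda>' = n1\<Lambda>[unfolded assoc] and n2\<Lambda>' = n2\<Lambda>[unfolded assoc]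
  note e1k = M.rwhisk_cells[OF e1 k] and e2k = M.rwhisk_cells[OF e2 k]
    and F\<theta>k = M.rwhisk_cells[OF F\<theta> k] and \<theta>Gk = M.rwhisk_cells[OF \<theta>G k]
  have "lwhisk K (Lmor F c) (rwhisk K (Mtrans M \<theta>) ?k) \<bullet> (rwhisk K ?e1 ?k \<bullet> lwhisk K ?n1 ?\<Lambda>) =
      (rwhisk K (lwhisk K (Lmor F c) (Mtrans M \<theta>)) ?k \<bullet> rwhisk K ?e1 ?k) \<bullet> lwhisk K ?n1 ?\<Lambda>"
    by (simp only: M.lwhisk_rwhisk[OF Lmor_hom[OF c] M\<theta> k, symmetric] M.vcomp_cells_assoc[OF F\<theta>k e1k n1\<Lambda>'])
  also have "\<dots> = (rwhisk K ?e2 ?k \<bullet> rwhisk K (rwhisk K (Mtrans N \<theta>) ?G) ?k) \<bullet> lwhisk K ?n1 ?\<Lambda>"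
    by (simp only: M.rwhisk_vcomp[OF F\<theta> e1 k, symmetric] lax_\<theta> M.rwhisk_vcomp[OF e2 \<theta>G k])
  also have "\<dots> = rwhisk K ?e2 ?k \<bullet> (rwhisk K (Mtrans N \<theta>) (?G \<cdot> ?k) \<bullet> lwhisk K ?n1 ?\<Lambda>)"
    by (simp only: M.vcomp_cells_assoc[OF e2k \<theta>Gk n1\<Lambda>'] M.rwhisk_comp1[OF N\<theta> G k])
  \<comment> \<open>Interchange of \<open>Mtrans N \<theta>\<close> with \<open>?\<Lambda>\<close>
    replaces the argument \<open>?G \<cdot> ?k\<close> by \<open>?l\<close>, the tuple of the values
    in \<open>N\<close>.\<close>
  also have "\<dots> = rwhisk K ?e2 ?k \<bullet> (lwhisk K ?n2 ?\<Lambda> \<bullet> rwhisk K (Mtrans N \<theta>) ?l)"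
    by (simp only: M.whisk_exchange[OF N\<theta> \<Lambda>])
  also have "\<dots> = (rwhisk K ?e2 ?k \<bullet> lwhisk K ?n2 ?\<Lambda>) \<bullet> rwhisk K (Mtrans N \<theta>) ?l"
    by (simp only: M.vcomp_cells_assoc[OF e2k n2\<Lambda>' M.rwhisk_cells[OF N\<theta> cellsD(1)[OF \<Lambda>]]])
  finally show ?thesis
    by (simp only: eta_subst[OF a xs t(1) ts] eta_subst[OF a xs t(2) ts])
qed

text \<open>A whole family of argument cells is allowed instead of one changing position: the arrow
  \<open>B(...,q,...)\<close> is the family with the cell of \<open>q\<close> at one place and
  identities elsewhere, and tuples treat all places alike. The squares of the arguments combine to
  one square over the product, to which the lax cell of \<open>B\<close> is pasted.\<close>

lemma eta_natural_App:
  assumes a: "M.valuation Z \<upsilon> x a" and B: "B \<in> funs \<Sigma>"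
    and ts: "length ts = length (fdom \<Sigma> B)"
      "\<And>i. i < length (fdom \<Sigma> B) \<Longrightarrow> has_type \<Sigma> Z \<upsilon> (ts ! i) (fdom \<Sigma> B ! i)"
    and us: "length us = length (fdom \<Sigma> B)"
      "\<And>i. i < length (fdom \<Sigma> B) \<Longrightarrow> has_type \<Sigma> Z \<upsilon> (us ! i) (fdom \<Sigma> B ! i)"
    and \<beta>: "\<And>i. i < length (fdom \<Sigma> B) \<Longrightarrow> \<beta> i \<in> cells K x (Mob M (fdom \<Sigma> B ! i))
      (eval K \<Sigma> M x a (ts ! i)) (eval K \<Sigma> M x a (us ! i))"
    and \<gamma>: "\<And>i. i < length (fdom \<Sigma> B) \<Longrightarrow> \<gamma> i \<in> cells K x (Mob N (fdom \<Sigma> B ! i))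
      (eval K \<Sigma> N x (push \<upsilon> a) (ts ! i)) (eval K \<Sigma> N x (push \<upsilon> a) (us ! i))"
    and natural: "\<And>i. i < length (fdom \<Sigma> B) \<Longrightarrow>
      lwhisk K (Lmor F (fdom \<Sigma> B ! i)) (\<beta> i) \<bullet> eta K \<Sigma> M N F \<upsilon> x a (ts ! i) =
      eta K \<Sigma> M N F \<upsilon> x a (us ! i) \<bullet> \<gamma> i"
  shows "lwhisk K (Lmor F (fcod \<Sigma> B)) (lwhisk K (Mfun M B)
      (tup2 K {..<length (fdom \<Sigma> B)} (M.arg_obs B) x \<beta>)) \<bullet> eta K \<Sigma> M N F \<upsilon> x a (App B ts) =
    eta K \<Sigma> M N F \<upsilon> x a (App B us) \<bullet> lwhisk K (Mfun N B)
      (tup2 K {..<length (fdom \<Sigma> B)} (N.arg_obs B) x \<gamma>)"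
proof -
  let ?L = "{..<length (fdom \<Sigma> B)}" and ?d = "fcod \<Sigma> B"
  let ?G = "list_mor K M N F (fdom \<Sigma> B)"
  let ?T = "\<lambda>ts. tup1 K ?L (M.arg_obs B) x (\<lambda>i. eval K \<Sigma> M x a (ts ! i))"
  let ?U = "\<lambda>ts. tup1 K ?L (N.arg_obs B) x (\<lambda>i. eval K \<Sigma> N x (push \<upsilon> a) (ts ! i))"
  let ?E = "\<lambda>ts. tup2 K ?L (N.arg_obs B) x (\<lambda>i. eta K \<Sigma> M N F \<upsilon> x a (ts ! i))"
  let ?\<beta> = "tup2 K ?L (M.arg_obs B) x \<beta>" and ?\<gamma> = "tup2 K ?L (N.arg_obs B) x \<gamma>"
  have x: "x \<in> Obj K" using a by (simp add: M.valuation_def)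
  note PM = M.arg_product[OF B] and PN = N.arg_product[OF B]
  note cs = M.fun_types(1)[OF B] and G = list_mor_hom[OF M.fun_types(1)[OF B]]
  note MB = M.Mfun_hom[OF B] and NB = N.Mfun_hom[OF B] and Fd = Lmor_hom[OF M.fun_types(2)[OF B]]
  note L = Lcell_cells[OF B]
  have \<beta>': "\<beta> i \<in> cells K x (M.arg_obs B i) (eval K \<Sigma> M x a (ts ! i)) (eval K \<Sigma> M x a (us ! i))"
    if "i \<in> ?L" for i using \<beta> that by simp
  have \<gamma>': "\<gamma> i \<in> cells K x (N.arg_obs B i)
      (eval K \<Sigma> N x (push \<upsilon> a) (ts ! i)) (eval K \<Sigma> N x (push \<upsilon> a) (us ! i))"
    if "i \<in> ?L" for i using \<gamma> that by simp
  have \<eta>t: "eta K \<Sigma> M N F \<upsilon> x a (ts ! i) \<in> cells K x (N.arg_obs B i)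
      (eval K \<Sigma> N x (push \<upsilon> a) (ts ! i)) (Lmor F (fdom \<Sigma> B ! i) \<cdot> eval K \<Sigma> M x a (ts ! i))"
    if "i \<in> ?L" for i using a B ts(2) that by (rule eta_args_cells)
  have \<eta>u: "eta K \<Sigma> M N F \<upsilon> x a (us ! i) \<in> cells K x (N.arg_obs B i)
      (eval K \<Sigma> N x (push \<upsilon> a) (us ! i)) (Lmor F (fdom \<Sigma> B ! i) \<cdot> eval K \<Sigma> M x a (us ! i))"
    if "i \<in> ?L" for i using a B us(2) that by (rule eta_args_cells)
  have \<beta>c: "?\<beta> \<in> cells K x (prod_obj K ?L (M.arg_obs B)) (?T ts) (?T us)"
    by (rule M.tup2(1)[OF PM x \<beta>'])
  have \<gamma>c: "?\<gamma> \<in> cells K x (prod_obj K ?L (N.arg_obs B)) (?U ts) (?U us)"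
    by (rule M.tup2(1)[OF PN x \<gamma>'])
  have GT: "?G \<cdot> ?T ts = tup1 K ?L (N.arg_obs B) x (\<lambda>i. Lmor F (fdom \<Sigma> B ! i) \<cdot> eval K \<Sigma> M x a (ts ! i))"
    "?G \<cdot> ?T us = tup1 K ?L (N.arg_obs B) x (\<lambda>i. Lmor F (fdom \<Sigma> B ! i) \<cdot> eval K \<Sigma> M x a (us ! i))"
    using list_mor_tup1[OF cs x cellsD(1)[OF \<beta>']] list_mor_tup1[OF cs x cellsD(2)[OF \<beta>']] by simp_all
  have Et: "?E ts \<in> cells K x (prod_obj K ?L (N.arg_obs B)) (?U ts) (?G \<cdot> ?T ts)"
    unfolding GT by (rule M.tup2(1)[OF PN x \<eta>t])
  have Eu: "?E us \<in> cells K x (prod_obj K ?L (N.arg_obs B)) (?U us) (?G \<cdot> ?T us)"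
    unfolding GT by (rule M.tup2(1)[OF PN x \<eta>u])
  have F\<beta>: "lwhisk K (Lmor F (fdom \<Sigma> B ! i)) (\<beta> i) \<in> cells K x (N.arg_obs B i)
      (Lmor F (fdom \<Sigma> B ! i) \<cdot> eval K \<Sigma> M x a (ts ! i)) (Lmor F (fdom \<Sigma> B ! i) \<cdot> eval K \<Sigma> M x a (us ! i))"
    if "i \<in> ?L" for i
    using that cs by (intro M.lwhisk_cells[OF _ \<beta>']) (auto intro: Lmor_hom simp: subsetD)
  have square: "lwhisk K ?G ?\<beta> \<bullet> ?E ts = ?E us \<bullet> ?\<gamma>"
  proof -
    have "lwhisk K ?G ?\<beta> = tup2 K ?L (N.arg_obs B) x (\<lambda>i. lwhisk K (Lmor F (fdom \<Sigma> B ! i)) (\<beta> i))"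
      by (rule list_mor_tup2[OF cs x \<beta>'])
    moreover have "tup2 K ?L (N.arg_obs B) x (\<lambda>i. lwhisk K (Lmor F (fdom \<Sigma> B ! i)) (\<beta> i)) \<bullet> ?E ts =
        tup2 K ?L (N.arg_obs B) x (\<lambda>i. lwhisk K (Lmor F (fdom \<Sigma> B ! i)) (\<beta> i) \<bullet> eta K \<Sigma> M N F \<upsilon> x a (ts ! i))"
      by (rule M.tup2_vcomp[OF PN x F\<beta> \<eta>t])
    moreover have "?E us \<bullet> ?\<gamma> = tup2 K ?L (N.arg_obs B) x (\<lambda>i. eta K \<Sigma> M N F \<upsilon> x a (us ! i) \<bullet> \<gamma> i)"
      by (rule M.tup2_vcomp[OF PN x \<eta>u \<gamma>'])
    moreover have "tup2 K ?L (N.arg_obs B) x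
          (\<lambda>i. lwhisk K (Lmor F (fdom \<Sigma> B ! i)) (\<beta> i) \<bullet> eta K \<Sigma> M N F \<upsilon> x a (ts ! i)) =
        tup2 K ?L (N.arg_obs B) x (\<lambda>i. eta K \<Sigma> M N F \<upsilon> x a (us ! i) \<bullet> \<gamma> i)"
      by (rule M.tup2_cong) (simp add: natural)
    ultimately show ?thesis by simp
  qed
  note T = cellsD(1,2)[OF \<beta>c]
  have LT: "rwhisk K (Lcell F B) (?T v) \<in> cells K x (Mob N ?d) (Mfun N B \<cdot> ?G \<cdot> ?T v) ((Lmor F ?d \<cdot> Mfun M B) \<cdot> ?T v)"
    if "?T v \<in> hom1 K x (prod_obj K ?L (M.arg_obs B))" for v
    using M.rwhisk_cells[OF L that] by (simp only: M.comp1_assoc[OF that G NB])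
  note FM\<beta> = M.lwhisk_cells[OF M.comp1_hom[OF MB Fd] \<beta>c]
  note G\<beta> = M.lwhisk_cells[OF G \<beta>c]
  have "lwhisk K (Lmor F ?d) (lwhisk K (Mfun M B) ?\<beta>) \<bullet> (rwhisk K (Lcell F B) (?T ts) \<bullet> lwhisk K (Mfun N B) (?E ts)) =
      (lwhisk K (Lmor F ?d \<cdot> Mfun M B) ?\<beta> \<bullet> rwhisk K (Lcell F B) (?T ts)) \<bullet> lwhisk K (Mfun N B) (?E ts)"
    by (simp only: M.lwhisk_comp1[OF Fd MB \<beta>c, symmetric] M.vcomp_cells_assoc[OF FM\<beta> LT[OF T(1)] M.lwhisk_cells[OF NB Et]])
  \<comment> \<open>Sliding \<open>Lcell F B\<close> past \<open>?\<beta>\<close> changes the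
    whiskering 1-cell from \<open>Lmor F ?d \<cdot> Mfun M B\<close> to
    \<open>Mfun N B \<cdot> ?G\<close>, which exposes one side of \<open>square\<close>.\<close>
  also have "\<dots> = (rwhisk K (Lcell F B) (?T us) \<bullet> lwhisk K (Mfun N B \<cdot> ?G) ?\<beta>) \<bullet> lwhisk K (Mfun N B) (?E ts)"
    by (simp only: M.whisk_exchange[OF L \<beta>c])
  also have "\<dots> = rwhisk K (Lcell F B) (?T us) \<bullet> (lwhisk K (Mfun N B) (lwhisk K ?G ?\<beta>) \<bullet> lwhisk K (Mfun N B) (?E ts))"
    by (simp only: M.lwhisk_comp1[OF NB G \<beta>c]
        M.vcomp_cells_assoc[OF LT[OF T(2)] M.lwhisk_cells[OF NB G\<beta>] M.lwhisk_cells[OF NB Et]])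
  also have "\<dots> = rwhisk K (Lcell F B) (?T us) \<bullet> (lwhisk K (Mfun N B) (?E us) \<bullet> lwhisk K (Mfun N B) ?\<gamma>)"
    by (simp only: M.lwhisk_vcomp[OF NB G\<beta> Et, symmetric] square M.lwhisk_vcomp[OF NB Eu \<gamma>c])
  also have "\<dots> = (rwhisk K (Lcell F B) (?T us) \<bullet> lwhisk K (Mfun N B) (?E us)) \<bullet> lwhisk K (Mfun N B) ?\<gamma>"
    by (simp only: M.vcomp_cells_assoc[OF LT[OF T(2)] M.lwhisk_cells[OF NB Eu] M.lwhisk_cells[OF NB \<gamma>c]])
  finally show ?thesis
    unfolding eta_App[OF ts(1)] eta_App[OF us(1)] .
qed

end

section \<open>Algebras and bialgebras\<close>

lemma list_all2_nthI:
  assumes "list_all2 P ts cs"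
  shows "length ts = length cs" "i < length cs \<Longrightarrow> P (ts ! i) (cs ! i)"
  using assms by (auto simp: list_all2_conv_all_nth)

section \<open>Chosen inserters and equifiers\<close>

lemma some_inserter:
  assumes "is_inserter K f g E u \<phi>"
  shows "is_inserter K f g (fst (some_inserter K f g)) (fst (snd (some_inserter K f g)))
    (snd (snd (some_inserter K f g)))"
proof -
  have "\<exists>p. case p of (E, u, \<phi>) \<Rightarrow> is_inserter K f g E u \<phi>" using assms by auto
  from someI_ex[OF this] show ?thesis by (auto simp: some_inserter_def split: prod.splits)
qed

lemma some_equifier:
  assumes "is_equifier K \<eta> \<theta> E u"
  shows "is_equifier K \<eta> \<theta> (fst (some_equifier K \<eta> \<theta>)) (snd (some_equifier K \<eta> \<theta>))"
proof -
  have "\<exists>p. case p of (E, u) \<Rightarrow> is_equifier K \<eta> \<theta> E u" using assms by auto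
  from someI_ex[OF this] show ?thesis by (auto simp: some_equifier_def split: prod.splits)
qed

lemma pie_complete_inserter:
  assumes "pie_complete U K" "c \<in> Obj K" "d \<in> Obj K" "f \<in> hom1 K c d" "g \<in> hom1 K c d"
  shows "\<exists>E u \<phi>. is_inserter K f g E u \<phi>"
proof -
  have "\<forall>c\<in>Obj K. \<forall>d\<in>Obj K. \<forall>f\<in>hom1 K c d. \<forall>g\<in>hom1 K c d. \<exists>E u \<phi>. is_inserter K f g E u \<phi>"
    using assms(1) unfolding pie_complete_def by (elim conjE)
  from this[rule_format, OF assms(2-5)] show ?thesis .
qed

lemma pie_complete_equifier:
  assumes "pie_complete U K" "c \<in> Obj K" "d \<in> Obj K" "f \<in> hom1 K c d" "g \<in> hom1 K c d"
    and "\<eta> \<in> hom2 K f g" "\<theta> \<in> hom2 K f g"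
  shows "\<exists>E u. is_equifier K \<eta> \<theta> E u"
proof -
  have "\<forall>c\<in>Obj K. \<forall>d\<in>Obj K. \<forall>f\<in>hom1 K c d. \<forall>g\<in>hom1 K c d.
      \<forall>\<eta>\<in>hom2 K f g. \<forall>\<theta>\<in>hom2 K f g. \<exists>E u. is_equifier K \<eta> \<theta> E u"
    using assms(1) unfolding pie_complete_def by (elim conjE)
  from this[rule_format, OF assms(2-7)] show ?thesis .
qed

lemma inserterD:
  assumes "is_inserter K f g E u \<phi>"
  shows "u \<in> hom1 K E (Src K f)" "\<phi> \<in> hom2 K (f \<cdot>\<^bsub>K\<^esub> u) (g \<cdot>\<^bsub>K\<^esub> u)"
  using assms by (simp_all add: is_inserter_def)

lemma equifierD:
  assumes "is_equifier K \<eta> \<theta> E u"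
  shows "u \<in> hom1 K E (Src K (Dom K \<eta>))" "rwhisk K \<eta> u = rwhisk K \<theta> u"
  using assms by (simp_all add: is_equifier_def)

lemma inserter_universal:
  assumes "is_inserter K f g E u \<phi>" "x \<in> Obj K" "h' \<in> hom1 K x (Src K f)"
    and "\<alpha> \<in> hom2 K (f \<cdot>\<^bsub>K\<^esub> h') (g \<cdot>\<^bsub>K\<^esub> h')"
  shows "\<exists>!h. h \<in> hom1 K x E \<and> h' = u \<cdot>\<^bsub>K\<^esub> h \<and> \<alpha> = rwhisk K \<phi> h"
proof -
  have "\<forall>x\<in>Obj K. \<forall>h'\<in>hom1 K x (Src K f). \<forall>\<alpha>\<in>hom2 K (f \<cdot>\<^bsub>K\<^esub> h') (g \<cdot>\<^bsub>K\<^esub> h').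
      \<exists>!h. h \<in> hom1 K x E \<and> h' = u \<cdot>\<^bsub>K\<^esub> h \<and> \<alpha> = rwhisk K \<phi> h"
    using assms(1) unfolding is_inserter_def by (elim conjE)
  from this[rule_format, OF assms(2-4)] show ?thesis .
qed

lemma equifier_universal:
  assumes "is_equifier K \<eta> \<theta> E u" "x \<in> Obj K" "h' \<in> hom1 K x (Src K (Dom K \<eta>))"
    and "rwhisk K \<eta> h' = rwhisk K \<theta> h'"
  shows "\<exists>!h. h \<in> hom1 K x E \<and> h' = u \<cdot>\<^bsub>K\<^esub> h"
proof -
  have "\<forall>x\<in>Obj K. \<forall>h'\<in>hom1 K x (Src K (Dom K \<eta>)). rwhisk K \<eta> h' = rwhisk K \<theta> h' \<longrightarrow>
      (\<exists>!h. h \<in> hom1 K x E \<and> h' = u \<cdot>\<^bsub>K\<^esub> h)"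
    using assms(1) unfolding is_equifier_def by (elim conjE)
  from this[rule_format, OF assms(2-4)] show ?thesis .
qed

section \<open>A single model: the objects \<open>M^\<sigma>\<close> and \<open>M^T\<close>\<close>

locale algebra_model = model_in K \<Sigma> M
  for K :: "('o, 'm, 't) two_cat" (structure)
    and \<Sigma> :: "('c, 'b, 'v, 'a) sig2"
    and M :: "('c, 'b, 'a, 'o, 'm, 't) model" +
  fixes \<sigma> :: "('c, 'b, 's, 'f) sig1"
    and U :: "'u::infinite itself"
  assumes pie: "pie_complete U K"
    and sig: "is_sig_pair U \<Sigma> \<sigma>"
begin

abbreviation "A \<equiv> alg_obj K \<Sigma> \<sigma> M"
abbreviation "gen s \<equiv> base_proj K \<sigma> M s \<cdot> alg_u K \<Sigma> \<sigma> M"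
abbreviation "fsym_c f \<equiv> styp \<Sigma> \<sigma> (ftgt \<sigma> f)"

text \<open>The signature asserts only that some common type exists. Computing it from the target
  makes it a function of \<open>f\<close>, as the product over all function symbols requires; a term
  has one type only, so it is the common one.\<close>

lemma fsym_terms:
  assumes "f \<in> fsyms \<sigma>"
  shows "sterm \<Sigma> \<sigma> (fsrc \<sigma> f) (fsym_c f)" "sterm \<Sigma> \<sigma> (ftgt \<sigma> f) (fsym_c f)"
proof -
  obtain c where c: "sterm \<Sigma> \<sigma> (fsrc \<sigma> f) c" "sterm \<Sigma> \<sigma> (ftgt \<sigma> f) c"
    using sig assms by (auto simp: is_sig_pair_def is_sig1_def)
  then show "sterm \<Sigma> \<sigma> (fsrc \<sigma> f) (fsym_c f)" "sterm \<Sigma> \<sigma> (ftgt \<sigma> f) (fsym_c f)"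
    by (simp_all only: typ_of_eq[OF c(2)])
qed

lemma trans_ctx:
  assumes "\<theta> \<in> trans_syms \<Sigma>"
  shows "distinct (ctx \<Sigma> \<theta>)" "vtype \<Sigma> ` set (ctx \<Sigma> \<theta>) \<subseteq> cats \<Sigma>"
    and "\<exists>c. has_type \<Sigma> (set (ctx \<Sigma> \<theta>)) (vtype \<Sigma>) (tdom \<Sigma> \<theta>) c \<and>
      has_type \<Sigma> (set (ctx \<Sigma> \<theta>)) (vtype \<Sigma>) (tcod \<Sigma> \<theta>) c"
proof -
  have \<theta>: "distinct (ctx \<Sigma> \<theta>) \<and> set (ctx \<Sigma> \<theta>) \<subseteq> vars \<Sigma> \<and>
      atoms (tdom \<Sigma> \<theta>) \<subseteq> set (ctx \<Sigma> \<theta>) \<and> atoms (tcod \<Sigma> \<theta>) \<subseteq> set (ctx \<Sigma> \<theta>) \<and>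
      (\<exists>c. has_type \<Sigma> (vars \<Sigma>) (vtype \<Sigma>) (tdom \<Sigma> \<theta>) c \<and>
           has_type \<Sigma> (vars \<Sigma>) (vtype \<Sigma>) (tcod \<Sigma> \<theta>) c)"
    using sig assms by (simp add: is_sig_pair_def is_sig2_def)
  then show "distinct (ctx \<Sigma> \<theta>)" by simp
  show "vtype \<Sigma> ` set (ctx \<Sigma> \<theta>) \<subseteq> cats \<Sigma>"
    using \<theta> sig by (auto simp: is_sig_pair_def is_sig2_def)
  show "\<exists>c. has_type \<Sigma> (set (ctx \<Sigma> \<theta>)) (vtype \<Sigma>) (tdom \<Sigma> \<theta>) c \<and>
      has_type \<Sigma> (set (ctx \<Sigma> \<theta>)) (vtype \<Sigma>) (tcod \<Sigma> \<theta>) c"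
    using \<theta> by (meson has_type_atoms)
qed

lemma base_product: "has_product K (sorts \<sigma>) (\<lambda>s. Mob M (stype \<sigma> s))"
  using pie by (rule pie_complete_has_product)
    (use sig Mob_Obj in \<open>auto simp: is_sig_pair_def is_sig1_def\<close>)

lemma base_obj_Obj: "base_obj K \<sigma> M \<in> Obj K"
  unfolding base_obj_def by (rule prod_obj_Obj[OF base_product])

lemma base_valuation: "valuation (sorts \<sigma>) (stype \<sigma>) (base_obj K \<sigma> M) (base_proj K \<sigma> M)"
  unfolding valuation_def
proof (intro conjI ballI)
  fix s assume s: "s \<in> sorts \<sigma>"
  show "stype \<sigma> s \<in> cats \<Sigma>"
    using sig s by (simp add: is_sig_pair_def is_sig1_def)
  show "base_proj K \<sigma> M s \<in> hom1 K (base_obj K \<sigma> M) (Mob M (stype \<sigma> s))"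
    unfolding base_proj_def base_obj_def by (rule proj_hom[OF base_product s])
qed (rule base_obj_Obj)

lemma eval_s_hom: "sterm \<Sigma> \<sigma> t c \<Longrightarrow> eval_s K \<Sigma> \<sigma> M t \<in> hom1 K (base_obj K \<sigma> M) (Mob M c)"
  unfolding eval_s_def by (rule eval_hom[OF base_valuation])

lemma sterm_cats: "sterm \<Sigma> \<sigma> t c \<Longrightarrow> c \<in> cats \<Sigma>"
  by (rule type_in_cats[OF base_valuation])

lemma fsym_product: "has_product K (fsyms \<sigma>) (fsym_ob \<Sigma> \<sigma> M)"
  using pie by (rule pie_complete_has_product)
    (use sig Mob_Obj[OF sterm_cats[OF fsym_terms(2)]] in \<open>auto simp: is_sig_pair_def is_sig1_def fsym_ob_def\<close>)

lemma fsym_eval_hom: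
  assumes "\<And>f. f \<in> fsyms \<sigma> \<Longrightarrow> sterm \<Sigma> \<sigma> (r f) (fsym_c f)" "f \<in> fsyms \<sigma>"
  shows "eval_s K \<Sigma> \<sigma> M (r f) \<in> hom1 K (base_obj K \<sigma> M) (fsym_ob \<Sigma> \<sigma> M f)"
  unfolding fsym_ob_def by (rule eval_s_hom[OF assms(1)[OF assms(2)]])

lemma fsym_tup1_hom:
  assumes "\<And>f. f \<in> fsyms \<sigma> \<Longrightarrow> sterm \<Sigma> \<sigma> (r f) (fsym_c f)"
  shows "tup1 K (fsyms \<sigma>) (fsym_ob \<Sigma> \<sigma> M) (base_obj K \<sigma> M) (\<lambda>f. eval_s K \<Sigma> \<sigma> M (r f))
    \<in> hom1 K (base_obj K \<sigma> M) (prod_obj K (fsyms \<sigma>) (fsym_ob \<Sigma> \<sigma> M))"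
  using assms by (intro tup1(1)[OF fsym_product base_obj_Obj] fsym_eval_hom)

lemmas src_tup1_hom = fsym_tup1_hom[of "fsrc \<sigma>", OF fsym_terms(1)]
lemmas tgt_tup1_hom = fsym_tup1_hom[of "ftgt \<sigma>", OF fsym_terms(2)]

lemma inserter:
  "is_inserter K
     (tup1 K (fsyms \<sigma>) (fsym_ob \<Sigma> \<sigma> M) (base_obj K \<sigma> M) (\<lambda>f. eval_s K \<Sigma> \<sigma> M (fsrc \<sigma> f)))
     (tup1 K (fsyms \<sigma>) (fsym_ob \<Sigma> \<sigma> M) (base_obj K \<sigma> M) (\<lambda>f. eval_s K \<Sigma> \<sigma> M (ftgt \<sigma> f)))
     A (alg_u K \<Sigma> \<sigma> M) (alg_phi K \<Sigma> \<sigma> M)"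
proof -
  obtain E u \<phi> where "is_inserter K
     (tup1 K (fsyms \<sigma>) (fsym_ob \<Sigma> \<sigma> M) (base_obj K \<sigma> M) (\<lambda>f. eval_s K \<Sigma> \<sigma> M (fsrc \<sigma> f)))
     (tup1 K (fsyms \<sigma>) (fsym_ob \<Sigma> \<sigma> M) (base_obj K \<sigma> M) (\<lambda>f. eval_s K \<Sigma> \<sigma> M (ftgt \<sigma> f))) E u \<phi>"
    using pie_complete_inserter[OF pie base_obj_Obj prod_obj_Obj[OF fsym_product] src_tup1_hom tgt_tup1_hom]
    by auto
  from some_inserter[OF this] show ?thesis
    unfolding alg_obj_def alg_u_def alg_phi_def alg_def .
qed

lemma alg_u_hom: "alg_u K \<Sigma> \<sigma> M \<in> hom1 K A (base_obj K \<sigma> M)"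
  using inserterD(1)[OF inserter] src_tup1_hom by (simp add: hom1_def)

lemma alg_obj_Obj: "A \<in> Obj K"
  by (rule hom1_Obj(1)[OF alg_u_hom])

lemma gen_valuation: "valuation (sorts \<sigma>) (stype \<sigma>) A gen"
  by (rule valuation_comp1[OF base_valuation alg_u_hom])

text \<open>Precomposing with \<open>u_M\<close> is the same as evaluating at the generators, so
  results about arbitrary valuations apply to \<open>M^\<sigma>(t)\<close>.\<close>

lemma eval_alg_eq: "sterm \<Sigma> \<sigma> t c \<Longrightarrow> eval_alg K \<Sigma> \<sigma> M t = eval K \<Sigma> M A gen t"
  unfolding eval_alg_def eval_s_def by (rule eval_comp1[OF base_valuation _ alg_u_hom, symmetric])

lemma eval_alg_hom: "sterm \<Sigma> \<sigma> t c \<Longrightarrow> eval_alg K \<Sigma> \<sigma> M t \<in> hom1 K A (Mob M c)"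
  unfolding eval_alg_def by (rule comp1_hom[OF alg_u_hom eval_s_hom])

lemma fsym_tup1_comp1:
  assumes "\<And>f. f \<in> fsyms \<sigma> \<Longrightarrow> sterm \<Sigma> \<sigma> (r f) (fsym_c f)" "h \<in> hom1 K x (base_obj K \<sigma> M)"
  shows "tup1 K (fsyms \<sigma>) (fsym_ob \<Sigma> \<sigma> M) (base_obj K \<sigma> M) (\<lambda>f. eval_s K \<Sigma> \<sigma> M (r f)) \<cdot> h =
    tup1 K (fsyms \<sigma>) (fsym_ob \<Sigma> \<sigma> M) x (\<lambda>f. eval_s K \<Sigma> \<sigma> M (r f) \<cdot> h)"
  using fsym_eval_hom[OF assms(1)] by (rule tup1_comp1[OF fsym_product _ assms(2)])

text \<open>The inserter places \<phi> between composites of tuples with \<open>u_M\<close>. Moving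
  \<open>u_M\<close> into the tuples exposes the components \<open>M^\<sigma>(t)\<close>, from which
  the boundary of each projected cell is read off.\<close>

lemma alg_phi_cells:
  "alg_phi K \<Sigma> \<sigma> M \<in> cells K A (prod_obj K (fsyms \<sigma>) (fsym_ob \<Sigma> \<sigma> M))
    (tup1 K (fsyms \<sigma>) (fsym_ob \<Sigma> \<sigma> M) A (\<lambda>f. eval_alg K \<Sigma> \<sigma> M (fsrc \<sigma> f)))
    (tup1 K (fsyms \<sigma>) (fsym_ob \<Sigma> \<sigma> M) A (\<lambda>f. eval_alg K \<Sigma> \<sigma> M (ftgt \<sigma> f)))"
proof -
  have "tup1 K (fsyms \<sigma>) (fsym_ob \<Sigma> \<sigma> M) A (\<lambda>f. eval_alg K \<Sigma> \<sigma> M (r f)) =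
      tup1 K (fsyms \<sigma>) (fsym_ob \<Sigma> \<sigma> M) (base_obj K \<sigma> M) (\<lambda>f. eval_s K \<Sigma> \<sigma> M (r f)) \<cdot> alg_u K \<Sigma> \<sigma> M"
    if "\<And>f. f \<in> fsyms \<sigma> \<Longrightarrow> sterm \<Sigma> \<sigma> (r f) (fsym_c f)" for r
    unfolding eval_alg_def using that by (rule fsym_tup1_comp1[OF _ alg_u_hom, symmetric])
  from this[of "fsrc \<sigma>", OF fsym_terms(1)] this[of "ftgt \<sigma>", OF fsym_terms(2)]
  show ?thesis
    using cellsI[OF inserterD(2)[OF inserter] comp1_hom[OF alg_u_hom src_tup1_hom]] by simp
qed

lemma arrow_cell_GFun_cells:
  assumes "f \<in> fsyms \<sigma>"
  shows "arrow_cell K \<Sigma> \<sigma> M (GFun f) \<in>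
    cells K A (Mob M (fsym_c f)) (eval_alg K \<Sigma> \<sigma> M (fsrc \<sigma> f)) (eval_alg K \<Sigma> \<sigma> M (ftgt \<sigma> f))"
proof -
  have "proj K (fsyms \<sigma>) (fsym_ob \<Sigma> \<sigma> M) f \<cdot>
      tup1 K (fsyms \<sigma>) (fsym_ob \<Sigma> \<sigma> M) A (\<lambda>f. eval_alg K \<Sigma> \<sigma> M (r f)) = eval_alg K \<Sigma> \<sigma> M (r f)"
    if "\<And>f. f \<in> fsyms \<sigma> \<Longrightarrow> sterm \<Sigma> \<sigma> (r f) (fsym_c f)" for r
    by (rule tup1(2)[OF fsym_product alg_obj_Obj])
      (use assms that in \<open>auto simp: fsym_ob_def intro: eval_alg_hom\<close>)
  then show ?thesis
    using lwhisk_cells[OF proj_hom[OF fsym_product assms] alg_phi_cells] fsym_terms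
    by (simp add: fsym_ob_def)
qed

lemma subst_type:
  assumes "distinct xs" "has_type \<Sigma> (set xs) (vtype \<Sigma>) t c" "list_all2 (sterm \<Sigma> \<sigma>) ts (map (vtype \<Sigma>) xs)"
  shows "sterm \<Sigma> \<sigma> (subst xs ts t) c"
proof -
  note ts = list_all2_nthI[OF assms(3)]
  then have l: "length ts = length xs" by simp
  show ?thesis
    unfolding subst_nth(1)[OF assms(1) l]
    using assms(2) ts by (intro has_type_bind_trm) (auto simp: in_set_conv_nth subst_nth(2)[OF assms(1) l])
qed

lemma garrow_types:
  assumes "is_garrow \<Sigma> \<sigma> q"
  shows "sterm \<Sigma> \<sigma> (gsrc \<Sigma> \<sigma> q) (styp \<Sigma> \<sigma> (gtgt \<Sigma> \<sigma> q))"
    and "sterm \<Sigma> \<sigma> (gtgt \<Sigma> \<sigma> q) (styp \<Sigma> \<sigma> (gtgt \<Sigma> \<sigma> q))"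
proof -
  \<comment> \<open>Case analysis replaces induction, because the rule for \<open>GApp\<close>
    itself asserts that both argument lists are well typed.\<close>
  have ex: "\<exists>c. sterm \<Sigma> \<sigma> (gsrc \<Sigma> \<sigma> q) c \<and> sterm \<Sigma> \<sigma> (gtgt \<Sigma> \<sigma> q) c"
    using assms
  proof cases
    case (1 f)
    then show ?thesis using fsym_terms[OF 1(2)] by auto
  next
    case (2 \<theta> ts)
    then show ?thesis using trans_ctx[OF 2(2)] by (auto intro: subst_type)
  next
    case (3 B q ts us)
    then show ?thesis by (auto intro!: has_type.App)
  qed
  from ex obtain c where c: "sterm \<Sigma> \<sigma> (gsrc \<Sigma> \<sigma> q) c" "sterm \<Sigma> \<sigma> (gtgt \<Sigma> \<sigma> q) c" by blast
  then show "sterm \<Sigma> \<sigma> (gsrc \<Sigma> \<sigma> q) (styp \<Sigma> \<sigma> (gtgt \<Sigma> \<sigma> q))"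
    and "sterm \<Sigma> \<sigma> (gtgt \<Sigma> \<sigma> q) (styp \<Sigma> \<sigma> (gtgt \<Sigma> \<sigma> q))"
    by (simp_all only: typ_of_eq[OF c(2)])
qed

lemma arrow_cell_GTrans:
  assumes "length ts = length (ctx \<Sigma> \<theta>)"
  shows "arrow_cell K \<Sigma> \<sigma> M (GTrans \<theta> ts) = rwhisk K (Mtrans M \<theta>)
    (tup1 K {..<length (ctx \<Sigma> \<theta>)} (ctx_ob (ctx \<Sigma> \<theta>)) A (\<lambda>i. eval_alg K \<Sigma> \<sigma> M (ts ! i)))"
  using assms by (auto simp: ltup1_def ctx_obs_eq simp del: map_map
      intro!: arg_cong[where f="rwhisk K _"] tup1_cong)

text \<open>The list of cells in \<open>arrow_cell\<close> at a \<open>GApp\<close>, as a function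
  of the index. Position \<open>length ts\<close> carries the arrow; at every other position the
  lists with the source and with the target of \<open>q\<close> have the same term.\<close>

definition gapp_cell ::
  "('b, 's) trm list \<Rightarrow> ('b, 's, 'a, 'f) garrow \<Rightarrow> ('b, 's) trm list \<Rightarrow> nat \<Rightarrow> 't" where
  "gapp_cell ts q us i = (if i = length ts then arrow_cell K \<Sigma> \<sigma> M q
    else Id2 K (eval_alg K \<Sigma> \<sigma> M ((ts @ gtgt \<Sigma> \<sigma> q # us) ! i)))"

lemma arrow_cell_GApp:
  assumes "length (ts @ gtgt \<Sigma> \<sigma> q # us) = length (fdom \<Sigma> B)"
  shows "arrow_cell K \<Sigma> \<sigma> M (GApp B ts q us) = lwhisk K (Mfun M B)
    (tup2 K {..<length (fdom \<Sigma> B)} (arg_obs B) A (gapp_cell ts q us))"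
proof -
  have "(map (\<lambda>t. Id2 K (eval_alg K \<Sigma> \<sigma> M t)) ts @ arrow_cell K \<Sigma> \<sigma> M q #
      map (\<lambda>t. Id2 K (eval_alg K \<Sigma> \<sigma> M t)) us) ! i = gapp_cell ts q us i" if "i < length (fdom \<Sigma> B)" for i
    using that assms by (auto simp: gapp_cell_def nth_append nth_Cons')
  then show ?thesis
    by (auto simp: ltup2_def intro!: arg_cong[where f="lwhisk K _"] tup2_cong)
qed

lemma gapp_nth: "i \<noteq> length ts \<Longrightarrow> (ts @ t # us) ! i = (ts @ t' # us) ! i"
  by (auto simp: nth_append nth_Cons')

text \<open>At \<open>length ts\<close> this is the boundary assumed for \<open>q\<close>, once the
  type of its target is identified with the entry of \<open>cs\<close>. Elsewhere the two lists
  agree, so an identity has the required endpoints.\<close>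

lemma gapp_cell_cells:
  assumes "arrow_cell K \<Sigma> \<sigma> M q \<in> cells K A (Mob M (styp \<Sigma> \<sigma> (gtgt \<Sigma> \<sigma> q)))
      (eval_alg K \<Sigma> \<sigma> M (gsrc \<Sigma> \<sigma> q)) (eval_alg K \<Sigma> \<sigma> M (gtgt \<Sigma> \<sigma> q))"
    and "list_all2 (sterm \<Sigma> \<sigma>) (ts @ gtgt \<Sigma> \<sigma> q # us) cs" "i < length cs"
  shows "gapp_cell ts q us i \<in> cells K A (Mob M (cs ! i))
    (eval_alg K \<Sigma> \<sigma> M ((ts @ gsrc \<Sigma> \<sigma> q # us) ! i)) (eval_alg K \<Sigma> \<sigma> M ((ts @ gtgt \<Sigma> \<sigma> q # us) ! i))"
proof -
  have i: "sterm \<Sigma> \<sigma> ((ts @ gtgt \<Sigma> \<sigma> q # us) ! i) (cs ! i)"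
    by (rule list_all2_nthI(2)[OF assms(2,3)])
  show ?thesis
  proof (cases "i = length ts")
    case True
    then show ?thesis using assms(1) typ_of_eq[OF i] by (simp add: gapp_cell_def)
  next
    case False
    then show ?thesis
      using Id2_cells[OF eval_alg_hom[OF i]] gapp_nth[OF False, of "gsrc \<Sigma> \<sigma> q" us "gtgt \<Sigma> \<sigma> q"]
      by (simp add: gapp_cell_def)
  qed
qed

text \<open>The work is in matching endpoints: by projecting \<phi> for a function symbol, by the
  substitution formula for a transformation symbol, and by the recursion for evaluation, read
  componentwise, for \<open>B(...,q,...)\<close>.\<close>

lemma arrow_cell_cells:
  assumes "is_garrow \<Sigma> \<sigma> q"
  shows "arrow_cell K \<Sigma> \<sigma> M q \<in> cells K A (Mob M (styp \<Sigma> \<sigma> (gtgt \<Sigma> \<sigma> q)))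
    (eval_alg K \<Sigma> \<sigma> M (gsrc \<Sigma> \<sigma> q)) (eval_alg K \<Sigma> \<sigma> M (gtgt \<Sigma> \<sigma> q))"
  using assms
proof induction
  case (1 f)
  then show ?case using arrow_cell_GFun_cells by simp
next
  case (2 \<theta> ts)
  obtain c where t: "has_type \<Sigma> (set (ctx \<Sigma> \<theta>)) (vtype \<Sigma>) (tdom \<Sigma> \<theta>) c"
    "has_type \<Sigma> (set (ctx \<Sigma> \<theta>)) (vtype \<Sigma>) (tcod \<Sigma> \<theta>) c"
    using trans_ctx(3)[OF 2(1)] by auto
  note xs = trans_ctx(1,2)[OF 2(1)]
  have l: "length ts = length (ctx \<Sigma> \<theta>)" using list_all2_nthI(1)[OF 2(2)] by simp
  have ts: "sterm \<Sigma> \<sigma> (ts ! i) (vtype \<Sigma> (ctx \<Sigma> \<theta> ! i))" if "i < length (ctx \<Sigma> \<theta>)" for i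
    using list_all2_nthI(2)[OF 2(2), of i] that by simp
  have e: "eval K \<Sigma> M A gen (ts ! i) \<in> hom1 K A (ctx_ob (ctx \<Sigma> \<theta>) i)"
    if "i \<in> {..<length (ctx \<Sigma> \<theta>)}" for i
    using eval_hom[OF gen_valuation ts] that by simp
  let ?T = "tup1 K {..<length (ctx \<Sigma> \<theta>)} (ctx_ob (ctx \<Sigma> \<theta>)) A (\<lambda>i. eval K \<Sigma> M A gen (ts ! i))"
  have T: "?T \<in> hom1 K A (prod_obj K {..<length (ctx \<Sigma> \<theta>)} (ctx_ob (ctx \<Sigma> \<theta>)))"
    by (rule tup1(1)[OF ctx_product[OF xs(2)] alg_obj_Obj e])
  have T': "tup1 K {..<length (ctx \<Sigma> \<theta>)} (ctx_ob (ctx \<Sigma> \<theta>)) A (\<lambda>i. eval_alg K \<Sigma> \<sigma> M (ts ! i)) = ?T"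
    by (rule tup1_cong) (use ts eval_alg_eq in auto)
  have m: "eval_ctx K \<Sigma> M (ctx \<Sigma> \<theta>) (tdom \<Sigma> \<theta>) \<in>
      hom1 K (prod_obj K {..<length (ctx \<Sigma> \<theta>)} (ctx_ob (ctx \<Sigma> \<theta>))) (Mob M c)"
    unfolding eval_ctx_eq by (rule eval_hom[OF ctx_valuation[OF xs] t(1)])
  have \<theta>: "Mtrans M \<theta> \<in> cells K (prod_obj K {..<length (ctx \<Sigma> \<theta>)} (ctx_ob (ctx \<Sigma> \<theta>))) (Mob M c)
      (eval_ctx K \<Sigma> M (ctx \<Sigma> \<theta>) (tdom \<Sigma> \<theta>)) (eval_ctx K \<Sigma> M (ctx \<Sigma> \<theta>) (tcod \<Sigma> \<theta>))"
    using model 2(1) by (intro cellsI[OF _ m]) (simp add: is_model_def)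
  have s: "eval_alg K \<Sigma> \<sigma> M (subst (ctx \<Sigma> \<theta>) ts t) = eval_ctx K \<Sigma> M (ctx \<Sigma> \<theta>) t \<cdot> ?T"
    if "has_type \<Sigma> (set (ctx \<Sigma> \<theta>)) (vtype \<Sigma>) t c" for t
    unfolding eval_alg_eq[OF subst_type[OF xs(1) that 2(2)]]
    by (rule eval_subst[OF xs that l alg_obj_Obj e])
  have c: "styp \<Sigma> \<sigma> (subst (ctx \<Sigma> \<theta>) ts (tcod \<Sigma> \<theta>)) = c"
    by (rule typ_of_eq[OF subst_type[OF xs(1) t(2) 2(2)]])
  show ?case
    unfolding arrow_cell_GTrans[OF l] T' gsrc.simps gtgt.simps s[OF t(1)] s[OF t(2)] c
    by (rule rwhisk_cells[OF \<theta> T])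
next
  case (3 B q ts us)
  let ?L = "{..<length (fdom \<Sigma> B)}"
  note src = list_all2_nthI[OF 3(3)] and tgt = list_all2_nthI[OF 3(4)]
  have "tup2 K ?L (arg_obs B) A (gapp_cell ts q us) \<in> cells K A (prod_obj K ?L (arg_obs B))
      (tup1 K ?L (arg_obs B) A (\<lambda>i. eval K \<Sigma> M A gen ((ts @ gsrc \<Sigma> \<sigma> q # us) ! i)))
      (tup1 K ?L (arg_obs B) A (\<lambda>i. eval K \<Sigma> M A gen ((ts @ gtgt \<Sigma> \<sigma> q # us) ! i)))"
    using gapp_cell_cells[OF 3(5,4)] eval_alg_eq[OF src(2)] eval_alg_eq[OF tgt(2)]
    by (intro tup2(1)[OF arg_product[OF 3(1)] alg_obj_Obj]) simp
  from lwhisk_cells[OF Mfun_hom[OF 3(1)] this]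
  show ?case
    unfolding arrow_cell_GApp[OF tgt(1)] gsrc.simps gtgt.simps typ_of.simps
      eval_alg_eq[OF has_type.App[OF 3(1,3)]] eval_alg_eq[OF has_type.App[OF 3(1,4)]]
      eval_App[OF src(1)] eval_App[OF tgt(1)] .
qed

text \<open>The type is computed at the end of the path, as in \<open>eqn_ob\<close>. Source and
  target of an arrow have the same type, so it is also the type at the start.\<close>

lemma path_types:
  assumes "is_gpath \<Sigma> \<sigma> (t, qs)"
  shows "sterm \<Sigma> \<sigma> t (styp \<Sigma> \<sigma> (path_tgt \<Sigma> \<sigma> (t, qs)))"
    "sterm \<Sigma> \<sigma> (path_tgt \<Sigma> \<sigma> (t, qs)) (styp \<Sigma> \<sigma> (path_tgt \<Sigma> \<sigma> (t, qs)))"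
proof -
  have "sterm \<Sigma> \<sigma> t (styp \<Sigma> \<sigma> (path_tgt \<Sigma> \<sigma> (t, qs))) \<and>
    sterm \<Sigma> \<sigma> (path_tgt \<Sigma> \<sigma> (t, qs)) (styp \<Sigma> \<sigma> (path_tgt \<Sigma> \<sigma> (t, qs)))"
    using assms
  proof (induction qs arbitrary: t)
    case Nil
    then obtain c where "sterm \<Sigma> \<sigma> t c" by auto
    then show ?case by (simp add: typ_of_eq)
  next
    case (Cons q qs)
    then have q: "is_garrow \<Sigma> \<sigma> q" "gsrc \<Sigma> \<sigma> q = t" "is_gpath \<Sigma> \<sigma> (gtgt \<Sigma> \<sigma> q, qs)" by auto
    show ?case
      using Cons(1)[OF q(3)] garrow_types(1)[OF q(1)] typ_of_eq[OF conjunct1[OF Cons(1)[OF q(3)]]]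
      by (simp add: q(2))
  qed
  then show "sterm \<Sigma> \<sigma> t (styp \<Sigma> \<sigma> (path_tgt \<Sigma> \<sigma> (t, qs)))"
    "sterm \<Sigma> \<sigma> (path_tgt \<Sigma> \<sigma> (t, qs)) (styp \<Sigma> \<sigma> (path_tgt \<Sigma> \<sigma> (t, qs)))" by auto
qed

lemma path_step_type:
  assumes "is_gpath \<Sigma> \<sigma> (t, q # qs)"
  shows "styp \<Sigma> \<sigma> (gtgt \<Sigma> \<sigma> q) = styp \<Sigma> \<sigma> (path_tgt \<Sigma> \<sigma> (gtgt \<Sigma> \<sigma> q, qs))"
  by (rule typ_of_eq[OF path_types(1)]) (use assms in simp)

lemma path_cell_cells:
  assumes "is_gpath \<Sigma> \<sigma> (t, qs)"
  shows "path_cell K \<Sigma> \<sigma> M (t, qs) \<in> cells K A (Mob M (styp \<Sigma> \<sigma> (path_tgt \<Sigma> \<sigma> (t, qs))))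
    (eval_alg K \<Sigma> \<sigma> M t) (eval_alg K \<Sigma> \<sigma> M (path_tgt \<Sigma> \<sigma> (t, qs)))"
  using assms
proof (induction qs arbitrary: t)
  case Nil
  then show ?case using path_types[OF Nil] by (auto intro!: Id2_cells intro: eval_alg_hom)
next
  case (Cons q qs)
  then show ?case
    using arrow_cell_cells[of q] path_step_type[OF Cons(2)] by (auto intro: vcomp_cells)
qed

text \<open>The two paths of an equation are parallel, so both boundaries can be expressed through
  \<open>fst e\<close>. This makes the two tuples parallel 2-cells, as the equifier
  requires.\<close>

lemma eqn_cells:
  assumes "is_theory U \<Sigma> \<sigma> T" "e \<in> T"
  shows "path_cell K \<Sigma> \<sigma> M (fst e) \<in> cells K A (eqn_ob \<Sigma> \<sigma> M e)
      (eval_alg K \<Sigma> \<sigma> M (path_src (fst e))) (eval_alg K \<Sigma> \<sigma> M (path_tgt \<Sigma> \<sigma> (fst e)))"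
    and "path_cell K \<Sigma> \<sigma> M (snd e) \<in> cells K A (eqn_ob \<Sigma> \<sigma> M e)
      (eval_alg K \<Sigma> \<sigma> M (path_src (fst e))) (eval_alg K \<Sigma> \<sigma> M (path_tgt \<Sigma> \<sigma> (fst e)))"
proof -
  have "is_equation \<Sigma> \<sigma> e" using assms by (simp add: is_theory_def)
  then have e: "is_gpath \<Sigma> \<sigma> (fst e)" "is_gpath \<Sigma> \<sigma> (snd e)" "path_src (fst e) = path_src (snd e)"
    "path_tgt \<Sigma> \<sigma> (fst e) = path_tgt \<Sigma> \<sigma> (snd e)"
    by (auto simp: is_equation_def split: prod.splits)
  have p: "path_cell K \<Sigma> \<sigma> M p \<in> cells K A (Mob M (styp \<Sigma> \<sigma> (path_tgt \<Sigma> \<sigma> p)))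
      (eval_alg K \<Sigma> \<sigma> M (path_src p)) (eval_alg K \<Sigma> \<sigma> M (path_tgt \<Sigma> \<sigma> p))"
    if "is_gpath \<Sigma> \<sigma> p" for p
    using path_cell_cells[of "fst p" "snd p"] that by (simp add: path_src_def)
  show "path_cell K \<Sigma> \<sigma> M (fst e) \<in> cells K A (eqn_ob \<Sigma> \<sigma> M e)
      (eval_alg K \<Sigma> \<sigma> M (path_src (fst e))) (eval_alg K \<Sigma> \<sigma> M (path_tgt \<Sigma> \<sigma> (fst e)))"
    using p[OF e(1)] by (simp add: eqn_ob_def)
  show "path_cell K \<Sigma> \<sigma> M (snd e) \<in> cells K A (eqn_ob \<Sigma> \<sigma> M e)
      (eval_alg K \<Sigma> \<sigma> M (path_src (fst e))) (eval_alg K \<Sigma> \<sigma> M (path_tgt \<Sigma> \<sigma> (fst e)))"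
    using p[OF e(2)] by (simp add: eqn_ob_def e(3,4))
qed

lemma eqn_product:
  assumes "is_theory U \<Sigma> \<sigma> T"
  shows "has_product K T (eqn_ob \<Sigma> \<sigma> M)"
proof (rule pie_complete_has_product[OF pie])
  show "small U T" using assms by (simp add: is_theory_def)
  show "eqn_ob \<Sigma> \<sigma> M e \<in> Obj K" if "e \<in> T" for e
    by (rule hom1_Obj(2)[OF cellsD(1)[OF eqn_cells(1)[OF assms that]]])
qed

text \<open>Whiskering passes into tuples and projections recover the components. The single
  condition tested by the equifier thus becomes one condition for each equation.\<close>

lemma equalized_iff:
  assumes T: "is_theory U \<Sigma> \<sigma> T" and h: "h \<in> hom1 K x A"
  shows "rwhisk K (tup2 K T (eqn_ob \<Sigma> \<sigma> M) A (\<lambda>e. path_cell K \<Sigma> \<sigma> M (fst e))) h =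
      rwhisk K (tup2 K T (eqn_ob \<Sigma> \<sigma> M) A (\<lambda>e. path_cell K \<Sigma> \<sigma> M (snd e))) h \<longleftrightarrow>
    (\<forall>e\<in>T. rwhisk K (path_cell K \<Sigma> \<sigma> M (fst e)) h = rwhisk K (path_cell K \<Sigma> \<sigma> M (snd e)) h)"
    (is "rwhisk K ?p h = rwhisk K ?q h \<longleftrightarrow> _")
proof -
  note P = eqn_product[OF T] and x = hom1_Obj(1)[OF h]
  have p: "rwhisk K ?p h = tup2 K T (eqn_ob \<Sigma> \<sigma> M) x (\<lambda>e. rwhisk K (path_cell K \<Sigma> \<sigma> M (fst e)) h)"
    by (rule tup2_rwhisk[OF P eqn_cells(1)[OF T] h])
  have q: "rwhisk K ?q h = tup2 K T (eqn_ob \<Sigma> \<sigma> M) x (\<lambda>e. rwhisk K (path_cell K \<Sigma> \<sigma> M (snd e)) h)"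
    by (rule tup2_rwhisk[OF P eqn_cells(2)[OF T] h])
  have proj_p: "lwhisk K (proj K T (eqn_ob \<Sigma> \<sigma> M) e) (rwhisk K ?p h) = rwhisk K (path_cell K \<Sigma> \<sigma> M (fst e)) h"
    if "e \<in> T" for e
    unfolding p by (rule tup2(2)[OF P x rwhisk_cells[OF eqn_cells(1)[OF T] h] that])
  have proj_q: "lwhisk K (proj K T (eqn_ob \<Sigma> \<sigma> M) e) (rwhisk K ?q h) = rwhisk K (path_cell K \<Sigma> \<sigma> M (snd e)) h"
    if "e \<in> T" for e
    unfolding q by (rule tup2(2)[OF P x rwhisk_cells[OF eqn_cells(2)[OF T] h] that])
  show ?thesis
  proof (intro iffI ballI)
    fix e assume "rwhisk K ?p h = rwhisk K ?q h" "e \<in> T"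
    then show "rwhisk K (path_cell K \<Sigma> \<sigma> M (fst e)) h = rwhisk K (path_cell K \<Sigma> \<sigma> M (snd e)) h"
      using proj_p proj_q by simp
  next
    assume eq: "\<forall>e\<in>T. rwhisk K (path_cell K \<Sigma> \<sigma> M (fst e)) h = rwhisk K (path_cell K \<Sigma> \<sigma> M (snd e)) h"
    show "rwhisk K ?p h = rwhisk K ?q h"
      unfolding p q by (rule tup2_cong) (use eq in simp)
  qed
qed

text \<open>\<open>is_equifier\<close> types its 1-cells through \<open>Src\<close> and
  \<open>Dom\<close> of the first 2-cell; the second part evaluates that object to
  \<open>M^\<sigma>\<close>.\<close>

lemma equifier:
  assumes "is_theory U \<Sigma> \<sigma> T"
  shows "is_equifier K
     (tup2 K T (eqn_ob \<Sigma> \<sigma> M) A (\<lambda>e. path_cell K \<Sigma> \<sigma> M (fst e)))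
     (tup2 K T (eqn_ob \<Sigma> \<sigma> M) A (\<lambda>e. path_cell K \<Sigma> \<sigma> M (snd e)))
     (bialg_obj K \<Sigma> \<sigma> T M) (bialg_e K \<Sigma> \<sigma> T M)"
    and "Src K (Dom K (tup2 K T (eqn_ob \<Sigma> \<sigma> M) A (\<lambda>e. path_cell K \<Sigma> \<sigma> M (fst e)))) = A"
proof -
  let ?s = "tup1 K T (eqn_ob \<Sigma> \<sigma> M) A (\<lambda>e. eval_alg K \<Sigma> \<sigma> M (path_src (fst e)))"
  let ?t = "tup1 K T (eqn_ob \<Sigma> \<sigma> M) A (\<lambda>e. eval_alg K \<Sigma> \<sigma> M (path_tgt \<Sigma> \<sigma> (fst e)))"
  have p: "tup2 K T (eqn_ob \<Sigma> \<sigma> M) A (\<lambda>e. path_cell K \<Sigma> \<sigma> M (fst e)) \<in>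
      cells K A (prod_obj K T (eqn_ob \<Sigma> \<sigma> M)) ?s ?t"
    by (rule tup2(1)[OF eqn_product[OF assms] alg_obj_Obj eqn_cells(1)[OF assms]])
  have q: "tup2 K T (eqn_ob \<Sigma> \<sigma> M) A (\<lambda>e. path_cell K \<Sigma> \<sigma> M (snd e)) \<in>
      cells K A (prod_obj K T (eqn_ob \<Sigma> \<sigma> M)) ?s ?t"
    by (rule tup2(1)[OF eqn_product[OF assms] alg_obj_Obj eqn_cells(2)[OF assms]])
  obtain E u where "is_equifier K
     (tup2 K T (eqn_ob \<Sigma> \<sigma> M) A (\<lambda>e. path_cell K \<Sigma> \<sigma> M (fst e)))
     (tup2 K T (eqn_ob \<Sigma> \<sigma> M) A (\<lambda>e. path_cell K \<Sigma> \<sigma> M (snd e))) E u"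
    using pie_complete_equifier[OF pie alg_obj_Obj prod_obj_Obj[OF eqn_product[OF assms]]
        cellsD(1,2,3)[OF p] cellsD(3)[OF q]] by blast
  from some_equifier[OF this] show "is_equifier K
     (tup2 K T (eqn_ob \<Sigma> \<sigma> M) A (\<lambda>e. path_cell K \<Sigma> \<sigma> M (fst e)))
     (tup2 K T (eqn_ob \<Sigma> \<sigma> M) A (\<lambda>e. path_cell K \<Sigma> \<sigma> M (snd e)))
     (bialg_obj K \<Sigma> \<sigma> T M) (bialg_e K \<Sigma> \<sigma> T M)"
    unfolding bialg_obj_def bialg_e_def bialg_def .
  show "Src K (Dom K (tup2 K T (eqn_ob \<Sigma> \<sigma> M) A (\<lambda>e. path_cell K \<Sigma> \<sigma> M (fst e)))) = A"
    using cellsD(1,4)[OF p] by (auto simp: hom1_def)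
qed

end

section \<open>Transport of algebras and bialgebras along a lax morphism\<close>

locale lax_algebra = lax_morphism K \<Sigma> M N F +
    MA: algebra_model K \<Sigma> M \<sigma> U + NA: algebra_model K \<Sigma> N \<sigma> U
  for K :: "('o, 'm, 't) two_cat" (structure)
    and \<Sigma> :: "('c, 'b, 'v, 'a) sig2"
    and M N :: "('c, 'b, 'a, 'o, 'm, 't) model"
    and F :: "('c, 'b, 'm, 't) lax_mor"
    and \<sigma> :: "('c, 'b, 's, 'f) sig1"
    and U :: "'u::infinite itself" +
  assumes iso: "f \<in> fsyms \<sigma> \<Longrightarrow> iso2 K (eta_s K \<Sigma> \<sigma> M N F (ftgt \<sigma> f))"
begin

abbreviation "F0 \<equiv> base_mor K \<sigma> M N F"
abbreviation "uM \<equiv> alg_u K \<Sigma> \<sigma> M"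
abbreviation "eta_u t \<equiv> rwhisk K (eta_s K \<Sigma> \<sigma> M N F t) uM"
abbreviation "prod_fsym \<equiv> prod_mor K (fsyms \<sigma>) (fsym_ob \<Sigma> \<sigma> M) (fsym_ob \<Sigma> \<sigma> N) (\<lambda>f. Lmor F (MA.fsym_c f))"

lemma sort_cats: "s \<in> sorts \<sigma> \<Longrightarrow> stype \<sigma> s \<in> cats \<Sigma>"
  using MA.base_valuation by (simp add: M.valuation_def)

lemma base_mor_hom: "F0 \<in> hom1 K (base_obj K \<sigma> M) (base_obj K \<sigma> N)"
  unfolding base_mor_def base_obj_def
  by (rule M.prod_mor(1)[OF MA.base_product NA.base_product Lmor_hom[OF sort_cats]])

lemma base_proj_mor:
  "s \<in> sorts \<sigma> \<Longrightarrow> base_proj K \<sigma> N s \<cdot> F0 = Lmor F (stype \<sigma> s) \<cdot> base_proj K \<sigma> M s"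
  unfolding base_mor_def base_proj_def
  by (rule M.prod_mor(2)[OF MA.base_product NA.base_product Lmor_hom[OF sort_cats]])

lemma eta_s_cells:
  assumes "sterm \<Sigma> \<sigma> t c"
  shows "eta_s K \<Sigma> \<sigma> M N F t \<in> cells K (base_obj K \<sigma> M) (Mob N c)
    (eval_s K \<Sigma> \<sigma> N t \<cdot> F0) (Lmor F c \<cdot> eval_s K \<Sigma> \<sigma> M t)"
proof -
  have "eval_s K \<Sigma> \<sigma> N t \<cdot> F0 = eval K \<Sigma> N (base_obj K \<sigma> M) (push (stype \<sigma>) (base_proj K \<sigma> M)) t"
    unfolding eval_s_def N.eval_comp1[OF NA.base_valuation assms base_mor_hom, symmetric]
    by (rule N.eval_cong[OF assms base_proj_mor])
  then show ?thesis
    using eta_cells[OF MA.base_valuation assms] by (simp add: eta_s_def eval_s_def)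
qed

text \<open>With the domain written through \<open>F_0 u_M\<close> the cell is available before
  \<open>F^\<sigma>\<close>, and the 2-cell that determines \<open>F^\<sigma>\<close> is built from
  it in this form.\<close>

lemma eta_u_cells:
  assumes "sterm \<Sigma> \<sigma> t c"
  shows "eta_u t \<in> cells K MA.A (Mob N c) (eval_s K \<Sigma> \<sigma> N t \<cdot> F0 \<cdot> uM) (Lmor F c \<cdot> eval_alg K \<Sigma> \<sigma> M t)"
  using M.rwhisk_cells[OF eta_s_cells[OF assms] MA.alg_u_hom]
  unfolding eval_alg_def M.comp1_assoc[OF MA.alg_u_hom base_mor_hom NA.eval_s_hom[OF assms]]
    M.comp1_assoc[OF MA.alg_u_hom MA.eval_s_hom[OF assms] Lmor_hom[OF MA.sterm_cats[OF assms]]] .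

lemma eta_u_eq: "sterm \<Sigma> \<sigma> t c \<Longrightarrow> eta_u t = eta K \<Sigma> M N F (stype \<sigma>) MA.A MA.gen t"
  unfolding eta_s_def by (rule eta_comp1[OF MA.base_valuation _ MA.alg_u_hom, symmetric])

text \<open>Whiskering is functorial and so preserves inverses. The order recorded, \<eta> after its
  inverse, is the one that arises when \<eta> is composed with the cell prescribed for
  \<open>\<phi>_N * F^\<sigma>\<close>.\<close>

lemma inv_eta_u:
  assumes "f \<in> fsyms \<sigma>"
  shows "rwhisk K (inv2 K (eta_s K \<Sigma> \<sigma> M N F (ftgt \<sigma> f))) uM \<in> cells K MA.A (Mob N (MA.fsym_c f))
      (Lmor F (MA.fsym_c f) \<cdot> eval_alg K \<Sigma> \<sigma> M (ftgt \<sigma> f)) (eval_s K \<Sigma> \<sigma> N (ftgt \<sigma> f) \<cdot> F0 \<cdot> uM)"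
    and "eta_u (ftgt \<sigma> f) \<bullet> rwhisk K (inv2 K (eta_s K \<Sigma> \<sigma> M N F (ftgt \<sigma> f))) uM =
      Id2 K (Lmor F (MA.fsym_c f) \<cdot> eval_alg K \<Sigma> \<sigma> M (ftgt \<sigma> f))"
proof -
  note t = MA.fsym_terms(2)[OF assms]
  note \<eta> = eta_s_cells[OF t]
  note i = M.inv2[OF iso[OF assms] \<eta>]
  have assoc: "(eval_s K \<Sigma> \<sigma> N (ftgt \<sigma> f) \<cdot> F0) \<cdot> uM = eval_s K \<Sigma> \<sigma> N (ftgt \<sigma> f) \<cdot> F0 \<cdot> uM"
    "(Lmor F (MA.fsym_c f) \<cdot> eval_s K \<Sigma> \<sigma> M (ftgt \<sigma> f)) \<cdot> uM = Lmor F (MA.fsym_c f) \<cdot> eval_alg K \<Sigma> \<sigma> M (ftgt \<sigma> f)"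
    unfolding eval_alg_def
    by (rule M.comp1_assoc[OF MA.alg_u_hom base_mor_hom NA.eval_s_hom[OF t]]
        M.comp1_assoc[OF MA.alg_u_hom MA.eval_s_hom[OF t] Lmor_hom[OF MA.sterm_cats[OF t]]])+
  show "rwhisk K (inv2 K (eta_s K \<Sigma> \<sigma> M N F (ftgt \<sigma> f))) uM \<in> cells K MA.A (Mob N (MA.fsym_c f))
      (Lmor F (MA.fsym_c f) \<cdot> eval_alg K \<Sigma> \<sigma> M (ftgt \<sigma> f)) (eval_s K \<Sigma> \<sigma> N (ftgt \<sigma> f) \<cdot> F0 \<cdot> uM)"
    using M.rwhisk_cells[OF i(1) MA.alg_u_hom] unfolding assoc .
  show "eta_u (ftgt \<sigma> f) \<bullet> rwhisk K (inv2 K (eta_s K \<Sigma> \<sigma> M N F (ftgt \<sigma> f))) uM =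
      Id2 K (Lmor F (MA.fsym_c f) \<cdot> eval_alg K \<Sigma> \<sigma> M (ftgt \<sigma> f))"
    unfolding M.rwhisk_vcomp[OF \<eta> i(1) MA.alg_u_hom, symmetric] i(3)
      M.rwhisk_Id2[OF cellsD(2)[OF \<eta>] MA.alg_u_hom] assoc ..
qed

text \<open>The component at \<open>f\<close> of the 2-cell prescribed for
  \<open>\<phi>_N * F^\<sigma>\<close>; arguments about one function symbol then involve no
  tuples.\<close>

definition "fsym_cell f =
  rwhisk K (inv2 K (eta_s K \<Sigma> \<sigma> M N F (ftgt \<sigma> f))) uM
  \<bullet> lwhisk K (Lmor F (MA.fsym_c f)) (arrow_cell K \<Sigma> \<sigma> M (GFun f)) \<bullet> eta_u (fsrc \<sigma> f)"

lemma fsym_types_cats: "f \<in> fsyms \<sigma> \<Longrightarrow> MA.fsym_c f \<in> cats \<Sigma>"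
  by (rule MA.sterm_cats[OF MA.fsym_terms(2)])

lemma fsym_cell_parts:
  assumes "f \<in> fsyms \<sigma>"
  shows "lwhisk K (Lmor F (MA.fsym_c f)) (arrow_cell K \<Sigma> \<sigma> M (GFun f)) \<in> cells K MA.A (Mob N (MA.fsym_c f))
      (Lmor F (MA.fsym_c f) \<cdot> eval_alg K \<Sigma> \<sigma> M (fsrc \<sigma> f)) (Lmor F (MA.fsym_c f) \<cdot> eval_alg K \<Sigma> \<sigma> M (ftgt \<sigma> f))"
    and "lwhisk K (Lmor F (MA.fsym_c f)) (arrow_cell K \<Sigma> \<sigma> M (GFun f)) \<bullet> eta_u (fsrc \<sigma> f) \<in>
      cells K MA.A (Mob N (MA.fsym_c f))
      (eval_s K \<Sigma> \<sigma> N (fsrc \<sigma> f) \<cdot> F0 \<cdot> uM) (Lmor F (MA.fsym_c f) \<cdot> eval_alg K \<Sigma> \<sigma> M (ftgt \<sigma> f))"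
    and "fsym_cell f \<in> cells K MA.A (Mob N (MA.fsym_c f))
      (eval_s K \<Sigma> \<sigma> N (fsrc \<sigma> f) \<cdot> F0 \<cdot> uM) (eval_s K \<Sigma> \<sigma> N (ftgt \<sigma> f) \<cdot> F0 \<cdot> uM)"
proof -
  show 1: "lwhisk K (Lmor F (MA.fsym_c f)) (arrow_cell K \<Sigma> \<sigma> M (GFun f)) \<in> cells K MA.A (Mob N (MA.fsym_c f))
      (Lmor F (MA.fsym_c f) \<cdot> eval_alg K \<Sigma> \<sigma> M (fsrc \<sigma> f)) (Lmor F (MA.fsym_c f) \<cdot> eval_alg K \<Sigma> \<sigma> M (ftgt \<sigma> f))"
    by (rule M.lwhisk_cells[OF Lmor_hom[OF fsym_types_cats[OF assms]] MA.arrow_cell_GFun_cells[OF assms]])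
  show 2: "lwhisk K (Lmor F (MA.fsym_c f)) (arrow_cell K \<Sigma> \<sigma> M (GFun f)) \<bullet> eta_u (fsrc \<sigma> f) \<in>
      cells K MA.A (Mob N (MA.fsym_c f))
      (eval_s K \<Sigma> \<sigma> N (fsrc \<sigma> f) \<cdot> F0 \<cdot> uM) (Lmor F (MA.fsym_c f) \<cdot> eval_alg K \<Sigma> \<sigma> M (ftgt \<sigma> f))"
    by (rule M.vcomp_cells[OF 1 eta_u_cells[OF MA.fsym_terms(1)[OF assms]]])
  show "fsym_cell f \<in> cells K MA.A (Mob N (MA.fsym_c f))
      (eval_s K \<Sigma> \<sigma> N (fsrc \<sigma> f) \<cdot> F0 \<cdot> uM) (eval_s K \<Sigma> \<sigma> N (ftgt \<sigma> f) \<cdot> F0 \<cdot> uM)"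
    unfolding fsym_cell_def by (rule M.vcomp_cells[OF inv_eta_u(1)[OF assms] 2])
qed

lemma prod_fsym_phi:
  "lwhisk K prod_fsym (alg_phi K \<Sigma> \<sigma> M) =
    tup2 K (fsyms \<sigma>) (fsym_ob \<Sigma> \<sigma> N) MA.A
      (\<lambda>f. lwhisk K (Lmor F (MA.fsym_c f)) (arrow_cell K \<Sigma> \<sigma> M (GFun f)))"
proof -
  \<comment> \<open>A 2-cell into a product is the tuple of its projections, and the projections of
    \<phi> are by definition the cells of the function symbols.\<close>
  have \<phi>: "alg_phi K \<Sigma> \<sigma> M = tup2 K (fsyms \<sigma>) (fsym_ob \<Sigma> \<sigma> M) MA.A (\<lambda>f. arrow_cell K \<Sigma> \<sigma> M (GFun f))"
    by (rule M.tup2_eqI[OF MA.fsym_product MA.alg_phi_cells, symmetric]) simp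
  show ?thesis
    unfolding \<phi>
  proof (rule M.prod_mor_tup2[OF MA.fsym_product NA.fsym_product _ MA.alg_obj_Obj])
    fix f assume "f \<in> fsyms \<sigma>"
    then show "Lmor F (MA.fsym_c f) \<in> hom1 K (fsym_ob \<Sigma> \<sigma> M f) (fsym_ob \<Sigma> \<sigma> N f)"
      "arrow_cell K \<Sigma> \<sigma> M (GFun f) \<in> cells K MA.A (fsym_ob \<Sigma> \<sigma> M f)
        (eval_alg K \<Sigma> \<sigma> M (fsrc \<sigma> f)) (eval_alg K \<Sigma> \<sigma> M (ftgt \<sigma> f))"
      unfolding fsym_ob_def
      by (simp_all only: Lmor_hom fsym_types_cats MA.arrow_cell_GFun_cells)
  qed
qed

text \<open>Vertical composition of tuples is componentwise, which collapses the three factors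
  prescribed for \<open>\<phi>_N * F^\<sigma>\<close> to a single tuple.\<close>

lemma alg_mor_cell_eq:
  "tup2 K (fsyms \<sigma>) (fsym_ob \<Sigma> \<sigma> N) MA.A
      (\<lambda>f. rwhisk K (inv2 K (eta_s K \<Sigma> \<sigma> M N F (ftgt \<sigma> f))) uM)
    \<bullet> lwhisk K prod_fsym (alg_phi K \<Sigma> \<sigma> M)
    \<bullet> tup2 K (fsyms \<sigma>) (fsym_ob \<Sigma> \<sigma> N) MA.A (\<lambda>f. eta_u (fsrc \<sigma> f)) =
  tup2 K (fsyms \<sigma>) (fsym_ob \<Sigma> \<sigma> N) MA.A fsym_cell"
proof -
  note P = NA.fsym_product and A = MA.alg_obj_Obj
  have "tup2 K (fsyms \<sigma>) (fsym_ob \<Sigma> \<sigma> N) MA.A (\<lambda>f. lwhisk K (Lmor F (MA.fsym_c f)) (arrow_cell K \<Sigma> \<sigma> M (GFun f)))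
      \<bullet> tup2 K (fsyms \<sigma>) (fsym_ob \<Sigma> \<sigma> N) MA.A (\<lambda>f. eta_u (fsrc \<sigma> f)) =
    tup2 K (fsyms \<sigma>) (fsym_ob \<Sigma> \<sigma> N) MA.A
      (\<lambda>f. lwhisk K (Lmor F (MA.fsym_c f)) (arrow_cell K \<Sigma> \<sigma> M (GFun f)) \<bullet> eta_u (fsrc \<sigma> f))"
  proof (rule M.tup2_vcomp[OF P A])
    fix f assume f: "f \<in> fsyms \<sigma>"
    show "lwhisk K (Lmor F (MA.fsym_c f)) (arrow_cell K \<Sigma> \<sigma> M (GFun f)) \<in> cells K MA.A (fsym_ob \<Sigma> \<sigma> N f)
        (Lmor F (MA.fsym_c f) \<cdot> eval_alg K \<Sigma> \<sigma> M (fsrc \<sigma> f)) (Lmor F (MA.fsym_c f) \<cdot> eval_alg K \<Sigma> \<sigma> M (ftgt \<sigma> f))"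
      unfolding fsym_ob_def by (rule fsym_cell_parts(1)[OF f])
    show "eta_u (fsrc \<sigma> f) \<in> cells K MA.A (fsym_ob \<Sigma> \<sigma> N f)
        (eval_s K \<Sigma> \<sigma> N (fsrc \<sigma> f) \<cdot> F0 \<cdot> uM) (Lmor F (MA.fsym_c f) \<cdot> eval_alg K \<Sigma> \<sigma> M (fsrc \<sigma> f))"
      unfolding fsym_ob_def by (rule eta_u_cells[OF MA.fsym_terms(1)[OF f]])
  qed
  moreover have "tup2 K (fsyms \<sigma>) (fsym_ob \<Sigma> \<sigma> N) MA.A
      (\<lambda>f. rwhisk K (inv2 K (eta_s K \<Sigma> \<sigma> M N F (ftgt \<sigma> f))) uM)
    \<bullet> tup2 K (fsyms \<sigma>) (fsym_ob \<Sigma> \<sigma> N) MA.A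
      (\<lambda>f. lwhisk K (Lmor F (MA.fsym_c f)) (arrow_cell K \<Sigma> \<sigma> M (GFun f)) \<bullet> eta_u (fsrc \<sigma> f)) =
    tup2 K (fsyms \<sigma>) (fsym_ob \<Sigma> \<sigma> N) MA.A fsym_cell"
    unfolding fsym_cell_def
  proof (rule M.tup2_vcomp[OF P A])
    fix f assume f: "f \<in> fsyms \<sigma>"
    show "rwhisk K (inv2 K (eta_s K \<Sigma> \<sigma> M N F (ftgt \<sigma> f))) uM \<in> cells K MA.A (fsym_ob \<Sigma> \<sigma> N f)
        (Lmor F (MA.fsym_c f) \<cdot> eval_alg K \<Sigma> \<sigma> M (ftgt \<sigma> f)) (eval_s K \<Sigma> \<sigma> N (ftgt \<sigma> f) \<cdot> F0 \<cdot> uM)"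
      unfolding fsym_ob_def by (rule inv_eta_u(1)[OF f])
    show "lwhisk K (Lmor F (MA.fsym_c f)) (arrow_cell K \<Sigma> \<sigma> M (GFun f)) \<bullet> eta_u (fsrc \<sigma> f) \<in>
        cells K MA.A (fsym_ob \<Sigma> \<sigma> N f)
        (eval_s K \<Sigma> \<sigma> N (fsrc \<sigma> f) \<cdot> F0 \<cdot> uM) (Lmor F (MA.fsym_c f) \<cdot> eval_alg K \<Sigma> \<sigma> M (ftgt \<sigma> f))"
      unfolding fsym_ob_def by (rule fsym_cell_parts(2)[OF f])
  qed
  ultimately show ?thesis by (simp only: prod_fsym_phi)
qed

text \<open>The universal property of the inserter for \<open>N\<close>, at the 1-cell
  \<open>F_0 u_M\<close> and the tuple of the cells \<open>fsym_cell f\<close>. Precomposing the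
  pair of 1-cells defining the inserter with \<open>F_0 u_M\<close> gives the endpoints of that
  tuple.\<close>

lemma ex1_alg_mor: "\<exists>!G. is_alg_mor K \<Sigma> \<sigma> M N F G"
proof -
  have h: "F0 \<cdot> uM \<in> hom1 K MA.A (base_obj K \<sigma> N)"
    by (rule M.comp1_hom[OF MA.alg_u_hom base_mor_hom])
  have h': "F0 \<cdot> uM \<in> hom1 K MA.A (Src K
      (tup1 K (fsyms \<sigma>) (fsym_ob \<Sigma> \<sigma> N) (base_obj K \<sigma> N) (\<lambda>f. eval_s K \<Sigma> \<sigma> N (fsrc \<sigma> f))))"
    using h NA.src_tup1_hom by (simp add: hom1_def)
  have src: "tup1 K (fsyms \<sigma>) (fsym_ob \<Sigma> \<sigma> N) (base_obj K \<sigma> N) (\<lambda>f. eval_s K \<Sigma> \<sigma> N (fsrc \<sigma> f)) \<cdot> F0 \<cdot> uM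
      = tup1 K (fsyms \<sigma>) (fsym_ob \<Sigma> \<sigma> N) MA.A (\<lambda>f. eval_s K \<Sigma> \<sigma> N (fsrc \<sigma> f) \<cdot> F0 \<cdot> uM)"
    by (rule NA.fsym_tup1_comp1[OF MA.fsym_terms(1) h])
  have tgt: "tup1 K (fsyms \<sigma>) (fsym_ob \<Sigma> \<sigma> N) (base_obj K \<sigma> N) (\<lambda>f. eval_s K \<Sigma> \<sigma> N (ftgt \<sigma> f)) \<cdot> F0 \<cdot> uM
      = tup1 K (fsyms \<sigma>) (fsym_ob \<Sigma> \<sigma> N) MA.A (\<lambda>f. eval_s K \<Sigma> \<sigma> N (ftgt \<sigma> f) \<cdot> F0 \<cdot> uM)"
    by (rule NA.fsym_tup1_comp1[OF MA.fsym_terms(2) h])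
  have "tup2 K (fsyms \<sigma>) (fsym_ob \<Sigma> \<sigma> N) MA.A fsym_cell \<in> cells K MA.A (prod_obj K (fsyms \<sigma>) (fsym_ob \<Sigma> \<sigma> N))
      (tup1 K (fsyms \<sigma>) (fsym_ob \<Sigma> \<sigma> N) MA.A (\<lambda>f. eval_s K \<Sigma> \<sigma> N (fsrc \<sigma> f) \<cdot> F0 \<cdot> uM))
      (tup1 K (fsyms \<sigma>) (fsym_ob \<Sigma> \<sigma> N) MA.A (\<lambda>f. eval_s K \<Sigma> \<sigma> N (ftgt \<sigma> f) \<cdot> F0 \<cdot> uM))"
    by (rule M.tup2(1)[OF NA.fsym_product MA.alg_obj_Obj]) (unfold fsym_ob_def, rule fsym_cell_parts(3))
  from inserter_universal[OF NA.inserter MA.alg_obj_Obj h' cellsD(3)[OF this, folded src tgt]]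
  show ?thesis
    unfolding is_alg_mor_def alg_mor_cell_eq by metis
qed

lemma alg_mor: "is_alg_mor K \<Sigma> \<sigma> M N F (alg_mor K \<Sigma> \<sigma> M N F)"
  unfolding alg_mor_def by (rule theI'[OF ex1_alg_mor])

abbreviation "G \<equiv> alg_mor K \<Sigma> \<sigma> M N F"

lemma alg_mor_hom: "G \<in> hom1 K MA.A NA.A"
  using alg_mor by (simp add: is_alg_mor_def)

text \<open>Combines \<open>u_N F^\<sigma> = F_0 u_M\<close> with the projections of
  \<open>F_0\<close>. Restricting along \<open>F^\<sigma>\<close> thus turns the generators of
  \<open>N\<close> into the pushed generators of \<open>M\<close>.\<close>

lemma gen_alg_mor: "s \<in> sorts \<sigma> \<Longrightarrow> NA.gen s \<cdot> G = Lmor F (stype \<sigma> s) \<cdot> MA.gen s"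
proof -
  assume s: "s \<in> sorts \<sigma>"
  have N: "base_proj K \<sigma> N s \<in> hom1 K (base_obj K \<sigma> N) (Mob N (stype \<sigma> s))"
    and M: "base_proj K \<sigma> M s \<in> hom1 K (base_obj K \<sigma> M) (Mob M (stype \<sigma> s))"
    using s MA.base_valuation NA.base_valuation by (auto simp: M.valuation_def N.valuation_def)
  have "NA.gen s \<cdot> G = base_proj K \<sigma> N s \<cdot> F0 \<cdot> uM"
    using M.comp1_assoc[OF alg_mor_hom NA.alg_u_hom N] alg_mor by (simp add: is_alg_mor_def)
  also have "\<dots> = Lmor F (stype \<sigma> s) \<cdot> MA.gen s"
    using M.comp1_assoc[OF MA.alg_u_hom base_mor_hom N]
      M.comp1_assoc[OF MA.alg_u_hom M Lmor_hom[OF sort_cats[OF s]]] base_proj_mor[OF s] by simp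
  finally show ?thesis .
qed

lemma eval_alg_mor:
  assumes "sterm \<Sigma> \<sigma> t c"
  shows "eval_alg K \<Sigma> \<sigma> N t \<cdot> G = eval K \<Sigma> N MA.A (push (stype \<sigma>) MA.gen) t"
  unfolding NA.eval_alg_eq[OF assms] N.eval_comp1[OF NA.gen_valuation assms alg_mor_hom, symmetric]
  by (rule N.eval_cong[OF assms gen_alg_mor])

text \<open>The second description of the domain: \<open>N^\<sigma>(t) F^\<sigma>\<close> is
  evaluation in \<open>N\<close> at the pushed generators, where \<eta> over
  \<open>M^\<sigma>\<close> starts. In this form the cell composes with cells of \<open>N\<close>
  whiskered by \<open>F^\<sigma>\<close>.\<close>

lemma eta_u_cells':
  assumes "sterm \<Sigma> \<sigma> t c"
  shows "eta_u t \<in> cells K MA.A (Mob N c) (eval_alg K \<Sigma> \<sigma> N t \<cdot> G) (Lmor F c \<cdot> eval_alg K \<Sigma> \<sigma> M t)"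
  unfolding eval_alg_mor[OF assms] MA.eval_alg_eq[OF assms] eta_u_eq[OF assms]
  by (rule eta_cells[OF MA.gen_valuation assms])

text \<open>The equation determining \<open>F^\<sigma>\<close> is projected to its component at
  \<open>f\<close>; whiskering on the left by a projection commutes with whiskering on the right by
  \<open>G\<close>.\<close>

lemma arrow_cell_GFun_mor:
  assumes "f \<in> fsyms \<sigma>"
  shows "rwhisk K (arrow_cell K \<Sigma> \<sigma> N (GFun f)) G = fsym_cell f"
proof -
  have "rwhisk K (alg_phi K \<Sigma> \<sigma> N) G = tup2 K (fsyms \<sigma>) (fsym_ob \<Sigma> \<sigma> N) MA.A fsym_cell"
    using alg_mor unfolding is_alg_mor_def alg_mor_cell_eq by (elim conjE)
  moreover have "lwhisk K (proj K (fsyms \<sigma>) (fsym_ob \<Sigma> \<sigma> N) f)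
      (tup2 K (fsyms \<sigma>) (fsym_ob \<Sigma> \<sigma> N) MA.A fsym_cell) = fsym_cell f"
    by (rule M.tup2(2)[OF NA.fsym_product MA.alg_obj_Obj _ assms])
      (unfold fsym_ob_def, rule fsym_cell_parts(3))
  ultimately show ?thesis
    using M.lwhisk_rwhisk[OF M.proj_hom[OF NA.fsym_product assms] NA.alg_phi_cells alg_mor_hom] by simp
qed

text \<open>Composing \<open>fsym_cell f\<close> with \<eta> at the target cancels its leading
  factor. Here the invertibility at function coarity terms enters naturality.\<close>

lemma arrow_natural_GFun:
  assumes "f \<in> fsyms \<sigma>"
  shows "lwhisk K (Lmor F (MA.fsym_c f)) (arrow_cell K \<Sigma> \<sigma> M (GFun f)) \<bullet> eta_u (fsrc \<sigma> f) =
    eta_u (ftgt \<sigma> f) \<bullet> rwhisk K (arrow_cell K \<Sigma> \<sigma> N (GFun f)) G"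
proof -
  note p = fsym_cell_parts[OF assms] and i = inv_eta_u[OF assms]
  have "eta_u (ftgt \<sigma> f) \<bullet> fsym_cell f =
      (eta_u (ftgt \<sigma> f) \<bullet> rwhisk K (inv2 K (eta_s K \<Sigma> \<sigma> M N F (ftgt \<sigma> f))) uM)
      \<bullet> (lwhisk K (Lmor F (MA.fsym_c f)) (arrow_cell K \<Sigma> \<sigma> M (GFun f)) \<bullet> eta_u (fsrc \<sigma> f))"
    unfolding fsym_cell_def
    by (rule M.vcomp_cells_assoc[OF eta_u_cells[OF MA.fsym_terms(2)[OF assms]] i(1) p(2), symmetric])
  also have "\<dots> = lwhisk K (Lmor F (MA.fsym_c f)) (arrow_cell K \<Sigma> \<sigma> M (GFun f)) \<bullet> eta_u (fsrc \<sigma> f)"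
    unfolding i(2) by (rule M.vcomp_Id2(1)[OF p(2)])
  finally show ?thesis unfolding arrow_cell_GFun_mor[OF assms] by (rule sym)
qed

text \<open>This is \<open>eta_natural_subst\<close> at the generators. What remains is to see that
  precomposing the tuple of values in \<open>N\<close> with \<open>G\<close> gives the tuple of
  values at the pushed generators.\<close>

lemma arrow_natural_GTrans:
  assumes \<theta>: "\<theta> \<in> trans_syms \<Sigma>" and ts: "list_all2 (sterm \<Sigma> \<sigma>) ts (map (vtype \<Sigma>) (ctx \<Sigma> \<theta>))"
    and c: "styp \<Sigma> \<sigma> (gtgt \<Sigma> \<sigma> (GTrans \<theta> ts)) = c"
  shows "lwhisk K (Lmor F c) (arrow_cell K \<Sigma> \<sigma> M (GTrans \<theta> ts)) \<bullet> eta_u (gsrc \<Sigma> \<sigma> (GTrans \<theta> ts)) =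
    eta_u (gtgt \<Sigma> \<sigma> (GTrans \<theta> ts)) \<bullet> rwhisk K (arrow_cell K \<Sigma> \<sigma> N (GTrans \<theta> ts)) G"
proof -
  let ?xs = "ctx \<Sigma> \<theta>"
  let ?I = "{..<length ?xs}"
  obtain d where t: "has_type \<Sigma> (set ?xs) (vtype \<Sigma>) (tdom \<Sigma> \<theta>) d"
    "has_type \<Sigma> (set ?xs) (vtype \<Sigma>) (tcod \<Sigma> \<theta>) d"
    using MA.trans_ctx(3)[OF \<theta>] by auto
  note xs = MA.trans_ctx(1,2)[OF \<theta>]
  have l: "length ts = length ?xs" using list_all2_nthI(1)[OF ts] by simp
  have ts': "sterm \<Sigma> \<sigma> (ts ! i) (vtype \<Sigma> (?xs ! i))" if "i < length ?xs" for i
    using list_all2_nthI(2)[OF ts, of i] that by simp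
  have s: "sterm \<Sigma> \<sigma> (subst ?xs ts (tdom \<Sigma> \<theta>)) d" "sterm \<Sigma> \<sigma> (subst ?xs ts (tcod \<Sigma> \<theta>)) d"
    by (rule MA.subst_type[OF xs(1) t(1) ts] MA.subst_type[OF xs(1) t(2) ts])+
  have d: "d = c" using c typ_of_eq[OF s(2)] by simp
  have eM: "tup1 K ?I (M.ctx_ob ?xs) MA.A (\<lambda>i. eval_alg K \<Sigma> \<sigma> M (ts ! i)) =
      tup1 K ?I (M.ctx_ob ?xs) MA.A (\<lambda>i. eval K \<Sigma> M MA.A MA.gen (ts ! i))"
    by (rule M.tup1_cong) (use ts' MA.eval_alg_eq in auto)
  have e: "eval_alg K \<Sigma> \<sigma> N (ts ! i) \<in> hom1 K NA.A (N.ctx_ob ?xs i)" if "i \<in> ?I" for i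
    using NA.eval_alg_hom[OF ts'] that by simp
  have n: "eval_ctx K \<Sigma> N ?xs (tdom \<Sigma> \<theta>) \<in> hom1 K (prod_obj K ?I (N.ctx_ob ?xs)) (Mob N d)"
    unfolding N.eval_ctx_eq by (rule N.eval_hom[OF N.ctx_valuation[OF xs] t(1)])
  have N\<theta>: "Mtrans N \<theta> \<in> cells K (prod_obj K ?I (N.ctx_ob ?xs)) (Mob N d)
      (eval_ctx K \<Sigma> N ?xs (tdom \<Sigma> \<theta>)) (eval_ctx K \<Sigma> N ?xs (tcod \<Sigma> \<theta>))"
    using N.model \<theta> by (intro M.cellsI[OF _ n]) (simp add: is_model_def)
  have T: "tup1 K ?I (N.ctx_ob ?xs) NA.A (\<lambda>i. eval_alg K \<Sigma> \<sigma> N (ts ! i)) \<in>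
      hom1 K NA.A (prod_obj K ?I (N.ctx_ob ?xs))"
    by (rule M.tup1(1)[OF N.ctx_product[OF xs(2)] NA.alg_obj_Obj e])
  have "tup1 K ?I (N.ctx_ob ?xs) NA.A (\<lambda>i. eval_alg K \<Sigma> \<sigma> N (ts ! i)) \<cdot> G =
      tup1 K ?I (N.ctx_ob ?xs) MA.A (\<lambda>i. eval_alg K \<Sigma> \<sigma> N (ts ! i) \<cdot> G)"
    by (rule M.tup1_comp1[OF N.ctx_product[OF xs(2)] e alg_mor_hom])
  also have "\<dots> = tup1 K ?I (N.ctx_ob ?xs) MA.A (\<lambda>i. eval K \<Sigma> N MA.A (push (stype \<sigma>) MA.gen) (ts ! i))"
    by (rule M.tup1_cong) (use eval_alg_mor[OF ts'] in auto)
  finally have "rwhisk K (arrow_cell K \<Sigma> \<sigma> N (GTrans \<theta> ts)) G = rwhisk K (Mtrans N \<theta>)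
      (tup1 K ?I (N.ctx_ob ?xs) MA.A (\<lambda>i. eval K \<Sigma> N MA.A (push (stype \<sigma>) MA.gen) (ts ! i)))"
    unfolding NA.arrow_cell_GTrans[OF l] M.rwhisk_comp1[OF N\<theta> T alg_mor_hom, symmetric] by simp
  then show ?thesis
    unfolding MA.arrow_cell_GTrans[OF l] eM gsrc.simps gtgt.simps eta_u_eq[OF s(1)] eta_u_eq[OF s(2)]
    using eta_natural_subst[OF MA.gen_valuation \<theta> xs t l ts'] by (simp only: d)
qed

lemma arrow_natural_GApp:
  assumes B: "B \<in> funs \<Sigma>" and q: "is_garrow \<Sigma> \<sigma> q"
    and ts: "list_all2 (sterm \<Sigma> \<sigma>) (ts @ gsrc \<Sigma> \<sigma> q # us) (fdom \<Sigma> B)"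
    and vs: "list_all2 (sterm \<Sigma> \<sigma>) (ts @ gtgt \<Sigma> \<sigma> q # us) (fdom \<Sigma> B)"
    and IH: "lwhisk K (Lmor F (styp \<Sigma> \<sigma> (gtgt \<Sigma> \<sigma> q))) (arrow_cell K \<Sigma> \<sigma> M q) \<bullet> eta_u (gsrc \<Sigma> \<sigma> q) =
      eta_u (gtgt \<Sigma> \<sigma> q) \<bullet> rwhisk K (arrow_cell K \<Sigma> \<sigma> N q) G"
  shows "lwhisk K (Lmor F (fcod \<Sigma> B)) (arrow_cell K \<Sigma> \<sigma> M (GApp B ts q us)) \<bullet> eta_u (gsrc \<Sigma> \<sigma> (GApp B ts q us)) =
    eta_u (gtgt \<Sigma> \<sigma> (GApp B ts q us)) \<bullet> rwhisk K (arrow_cell K \<Sigma> \<sigma> N (GApp B ts q us)) G"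
proof -
  let ?L = "{..<length (fdom \<Sigma> B)}"
  let ?ts = "ts @ gsrc \<Sigma> \<sigma> q # us" and ?vs = "ts @ gtgt \<Sigma> \<sigma> q # us"
  let ?\<beta> = "MA.gapp_cell ts q us" and ?\<gamma> = "NA.gapp_cell ts q us"
  note ts' = list_all2_nthI[OF ts] and vs' = list_all2_nthI[OF vs]
  note \<beta> = MA.gapp_cell_cells[OF MA.arrow_cell_cells[OF q] vs]
  note \<gamma> = NA.gapp_cell_cells[OF NA.arrow_cell_cells[OF q] vs]
  have "rwhisk K (tup2 K ?L (N.arg_obs B) NA.A ?\<gamma>) G = tup2 K ?L (N.arg_obs B) MA.A (\<lambda>i. rwhisk K (?\<gamma> i) G)"
  proof (rule M.tup2_rwhisk[OF N.arg_product[OF B] _ alg_mor_hom])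
    show "?\<gamma> i \<in> cells K NA.A (N.arg_obs B i) (eval_alg K \<Sigma> \<sigma> N (?ts ! i)) (eval_alg K \<Sigma> \<sigma> N (?vs ! i))"
      if "i \<in> ?L" for i using \<gamma> that by simp
  qed
  moreover have "tup2 K ?L (N.arg_obs B) NA.A ?\<gamma> \<in> cells K NA.A (prod_obj K ?L (N.arg_obs B))
      (tup1 K ?L (N.arg_obs B) NA.A (\<lambda>i. eval_alg K \<Sigma> \<sigma> N (?ts ! i)))
      (tup1 K ?L (N.arg_obs B) NA.A (\<lambda>i. eval_alg K \<Sigma> \<sigma> N (?vs ! i)))"
    by (rule M.tup2(1)[OF N.arg_product[OF B] NA.alg_obj_Obj]) (use \<gamma> in simp)
  ultimately have N: "rwhisk K (arrow_cell K \<Sigma> \<sigma> N (GApp B ts q us)) G =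
      lwhisk K (Mfun N B) (tup2 K ?L (N.arg_obs B) MA.A (\<lambda>i. rwhisk K (?\<gamma> i) G))"
    using M.lwhisk_rwhisk[OF N.Mfun_hom[OF B] _ alg_mor_hom] unfolding NA.arrow_cell_GApp[OF vs'(1)]
    by simp
  have s: "sterm \<Sigma> \<sigma> (App B ?ts) (fcod \<Sigma> B)" "sterm \<Sigma> \<sigma> (App B ?vs) (fcod \<Sigma> B)"
    using B ts vs by (auto intro: has_type.App)
  show ?thesis
    unfolding N MA.arrow_cell_GApp[OF vs'(1)] gsrc.simps gtgt.simps eta_u_eq[OF s(1)] eta_u_eq[OF s(2)]
  proof (rule eta_natural_App[OF MA.gen_valuation B ts' vs'])
    fix i assume i: "i < length (fdom \<Sigma> B)"
    note t = ts'(2)[OF i] and v = vs'(2)[OF i]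
    show "?\<beta> i \<in> cells K MA.A (Mob M (fdom \<Sigma> B ! i))
        (eval K \<Sigma> M MA.A MA.gen (?ts ! i)) (eval K \<Sigma> M MA.A MA.gen (?vs ! i))"
      using \<beta>[OF i] by (simp only: MA.eval_alg_eq[OF t] MA.eval_alg_eq[OF v])
    show "rwhisk K (?\<gamma> i) G \<in> cells K MA.A (Mob N (fdom \<Sigma> B ! i))
        (eval K \<Sigma> N MA.A (push (stype \<sigma>) MA.gen) (?ts ! i)) (eval K \<Sigma> N MA.A (push (stype \<sigma>) MA.gen) (?vs ! i))"
      using M.rwhisk_cells[OF \<gamma>[OF i] alg_mor_hom] by (simp only: eval_alg_mor[OF t] eval_alg_mor[OF v])
    show "lwhisk K (Lmor F (fdom \<Sigma> B ! i)) (?\<beta> i) \<bullet> eta K \<Sigma> M N F (stype \<sigma>) MA.A MA.gen (?ts ! i) =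
        eta K \<Sigma> M N F (stype \<sigma>) MA.A MA.gen (?vs ! i) \<bullet> rwhisk K (?\<gamma> i) G"
    \<comment> \<open>At the position of \<open>q\<close> the square is the hypothesis on
      \<open>q\<close>. At every other position both transported cells are identities, and each side
      reduces to \<eta> of the same term.\<close>
    proof (cases "i = length ts")
      case True
      then show ?thesis
        using IH typ_of_eq[OF v] eta_u_eq[OF t] eta_u_eq[OF v] by (simp add: MA.gapp_cell_def NA.gapp_cell_def)
    next
      case False
      have eq: "?ts ! i = ?vs ! i" by (rule MA.gapp_nth[OF False])
      have c: "fdom \<Sigma> B ! i \<in> cats \<Sigma>" by (rule MA.sterm_cats[OF v])
      note \<eta> = eta_u_cells'[OF v]
      have "lwhisk K (Lmor F (fdom \<Sigma> B ! i)) (?\<beta> i) = Id2 K (Lmor F (fdom \<Sigma> B ! i) \<cdot> eval_alg K \<Sigma> \<sigma> M (?vs ! i))"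
        using M.lwhisk_Id2[OF Lmor_hom[OF c] MA.eval_alg_hom[OF v]] False by (simp add: MA.gapp_cell_def)
      moreover have "rwhisk K (?\<gamma> i) G = Id2 K (eval_alg K \<Sigma> \<sigma> N (?vs ! i) \<cdot> G)"
        using M.rwhisk_Id2[OF NA.eval_alg_hom[OF v] alg_mor_hom] False by (simp add: NA.gapp_cell_def)
      ultimately show ?thesis
        using M.vcomp_Id2[OF \<eta>] by (simp add: eq eta_u_eq[OF v])
    qed
  qed
qed

lemma arrow_natural:
  assumes "is_garrow \<Sigma> \<sigma> q"
  shows "lwhisk K (Lmor F (styp \<Sigma> \<sigma> (gtgt \<Sigma> \<sigma> q))) (arrow_cell K \<Sigma> \<sigma> M q) \<bullet> eta_u (gsrc \<Sigma> \<sigma> q) =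
    eta_u (gtgt \<Sigma> \<sigma> q) \<bullet> rwhisk K (arrow_cell K \<Sigma> \<sigma> N q) G"
  using assms
proof induction
  case (1 f)
  then show ?case using arrow_natural_GFun by simp
next
  case (2 \<theta> ts)
  then show ?case by (rule arrow_natural_GTrans) (rule refl)
next
  case (3 B q ts us)
  from arrow_natural_GApp[OF 3(1,2,3,4,5)] show ?case by simp
qed

lemma path_natural:
  assumes "is_gpath \<Sigma> \<sigma> (t, qs)"
  shows "lwhisk K (Lmor F (styp \<Sigma> \<sigma> (path_tgt \<Sigma> \<sigma> (t, qs)))) (path_cell K \<Sigma> \<sigma> M (t, qs)) \<bullet> eta_u t =
    eta_u (path_tgt \<Sigma> \<sigma> (t, qs)) \<bullet> rwhisk K (path_cell K \<Sigma> \<sigma> N (t, qs)) G"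
  using assms
proof (induction qs arbitrary: t)
  case Nil
  note t = MA.path_types(1)[OF Nil]
  note \<eta> = eta_u_cells'[OF t] and c = MA.sterm_cats[OF t]
  show ?case
    using M.lwhisk_Id2[OF Lmor_hom[OF c] MA.eval_alg_hom[OF t]]
      M.rwhisk_Id2[OF NA.eval_alg_hom[OF t] alg_mor_hom] M.vcomp_Id2[OF \<eta>] by simp
next
  case (Cons q qs)
  let ?t = "gtgt \<Sigma> \<sigma> q" and ?z = "path_tgt \<Sigma> \<sigma> (t, q # qs)"
  let ?c = "styp \<Sigma> \<sigma> ?z"
  let ?pM = "path_cell K \<Sigma> \<sigma> M (?t, qs)" and ?qM = "arrow_cell K \<Sigma> \<sigma> M q"
  let ?pN = "path_cell K \<Sigma> \<sigma> N (?t, qs)" and ?qN = "arrow_cell K \<Sigma> \<sigma> N q"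
  have q: "is_garrow \<Sigma> \<sigma> q" "gsrc \<Sigma> \<sigma> q = t" "is_gpath \<Sigma> \<sigma> (?t, qs)"
    using Cons(2) by auto
  \<comment> \<open>All vertices of a path have the same type, so one 1-cell
    \<open>Lmor F ?c\<close> serves all the squares that are pasted.\<close>
  have c: "styp \<Sigma> \<sigma> ?t = ?c"
    using MA.path_step_type[OF Cons(2)] by simp
  note Fc = Lmor_hom[OF MA.sterm_cats[OF MA.path_types(1)[OF Cons(2)]]]
  have pM: "?pM \<in> cells K MA.A (Mob M ?c) (eval_alg K \<Sigma> \<sigma> M ?t) (eval_alg K \<Sigma> \<sigma> M ?z)"
    and pN: "?pN \<in> cells K NA.A (Mob N ?c) (eval_alg K \<Sigma> \<sigma> N ?t) (eval_alg K \<Sigma> \<sigma> N ?z)"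
    using MA.path_cell_cells[OF q(3)] NA.path_cell_cells[OF q(3)] by simp_all
  have qM: "?qM \<in> cells K MA.A (Mob M ?c) (eval_alg K \<Sigma> \<sigma> M t) (eval_alg K \<Sigma> \<sigma> M ?t)"
    and qN: "?qN \<in> cells K NA.A (Mob N ?c) (eval_alg K \<Sigma> \<sigma> N t) (eval_alg K \<Sigma> \<sigma> N ?t)"
    using MA.arrow_cell_cells[OF q(1)] NA.arrow_cell_cells[OF q(1)] by (simp_all only: c q(2))
  have \<eta>: "eta_u t \<in> cells K MA.A (Mob N ?c) (eval_alg K \<Sigma> \<sigma> N t \<cdot> G) (Lmor F ?c \<cdot> eval_alg K \<Sigma> \<sigma> M t)"
    "eta_u ?t \<in> cells K MA.A (Mob N ?c) (eval_alg K \<Sigma> \<sigma> N ?t \<cdot> G) (Lmor F ?c \<cdot> eval_alg K \<Sigma> \<sigma> M ?t)"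
    "eta_u ?z \<in> cells K MA.A (Mob N ?c) (eval_alg K \<Sigma> \<sigma> N ?z \<cdot> G) (Lmor F ?c \<cdot> eval_alg K \<Sigma> \<sigma> M ?z)"
    using eta_u_cells'[OF MA.path_types(1)[OF Cons(2)]] eta_u_cells'[OF MA.garrow_types(2)[OF q(1)]]
      eta_u_cells'[OF MA.path_types(2)[OF Cons(2)]] by (simp_all only: c)
  note FpM = M.lwhisk_cells[OF Fc pM] and FqM = M.lwhisk_cells[OF Fc qM]
  note pNG = M.rwhisk_cells[OF pN alg_mor_hom] and qNG = M.rwhisk_cells[OF qN alg_mor_hom]
  have "lwhisk K (Lmor F ?c) (?pM \<bullet> ?qM) \<bullet> eta_u t =
      lwhisk K (Lmor F ?c) ?pM \<bullet> (lwhisk K (Lmor F ?c) ?qM \<bullet> eta_u t)"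
    by (simp only: M.lwhisk_vcomp[OF Fc pM qM] M.vcomp_cells_assoc[OF FpM FqM \<eta>(1)])
  also have "\<dots> = lwhisk K (Lmor F ?c) ?pM \<bullet> (eta_u ?t \<bullet> rwhisk K ?qN G)"
    using arrow_natural[OF q(1)] by (simp only: c q(2))
  also have "\<dots> = (lwhisk K (Lmor F ?c) ?pM \<bullet> eta_u ?t) \<bullet> rwhisk K ?qN G"
    by (simp only: M.vcomp_cells_assoc[OF FpM \<eta>(2) qNG])
  also have "\<dots> = (eta_u ?z \<bullet> rwhisk K ?pN G) \<bullet> rwhisk K ?qN G"
    using Cons(1)[OF q(3)] by simp
  also have "\<dots> = eta_u ?z \<bullet> rwhisk K (?pN \<bullet> ?qN) G"
    by (simp only: M.vcomp_cells_assoc[OF \<eta>(3) pNG qNG] M.rwhisk_vcomp[OF pN qN alg_mor_hom])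
  finally show ?case by simp
qed

lemma ex1_bialg_mor:
  assumes T: "is_theory U \<Sigma> \<sigma> T"
    and monic: "\<And>t. t \<in> eqn_coarity_terms \<Sigma> \<sigma> T \<Longrightarrow>
      monic2 K (rwhisk K (eta_s K \<Sigma> \<sigma> M N F t) (uM \<cdot> bialg_e K \<Sigma> \<sigma> T M))"
  shows "\<exists>!H. H \<in> hom1 K (bialg_obj K \<Sigma> \<sigma> T M) (bialg_obj K \<Sigma> \<sigma> T N) \<and>
    bialg_e K \<Sigma> \<sigma> T N \<cdot> H = G \<cdot> bialg_e K \<Sigma> \<sigma> T M"
proof -
  let ?e = "bialg_e K \<Sigma> \<sigma> T M" and ?E = "bialg_obj K \<Sigma> \<sigma> T M"
  have e: "?e \<in> hom1 K ?E MA.A"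
    using equifierD(1)[OF MA.equifier(1)[OF T]] by (simp only: MA.equifier(2)[OF T])
  have Ge: "G \<cdot> ?e \<in> hom1 K ?E NA.A"
    by (rule M.comp1_hom[OF e alg_mor_hom])
  have eM: "rwhisk K (path_cell K \<Sigma> \<sigma> M (fst x)) ?e = rwhisk K (path_cell K \<Sigma> \<sigma> M (snd x)) ?e"
    if "x \<in> T" for x
    using MA.equalized_iff[OF T e] equifierD(2)[OF MA.equifier(1)[OF T]] that by blast
  have eN: "rwhisk K (path_cell K \<Sigma> \<sigma> N (fst x)) (G \<cdot> ?e) = rwhisk K (path_cell K \<Sigma> \<sigma> N (snd x)) (G \<cdot> ?e)"
    if x: "x \<in> T" for x
  proof -
    let ?s = "path_src (fst x)" and ?z = "path_tgt \<Sigma> \<sigma> (fst x)"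
    let ?c = "styp \<Sigma> \<sigma> ?z"
    have "is_equation \<Sigma> \<sigma> x" using T x by (simp add: is_theory_def)
    then have p: "is_gpath \<Sigma> \<sigma> (fst x)" "is_gpath \<Sigma> \<sigma> (snd x)" "path_src (snd x) = ?s"
      "path_tgt \<Sigma> \<sigma> (snd x) = ?z"
      by (auto simp: is_equation_def split: prod.splits)
    have s: "sterm \<Sigma> \<sigma> ?s ?c" and z: "sterm \<Sigma> \<sigma> ?z ?c"
      using MA.path_types[of "fst (fst x)" "snd (fst x)"] p(1) by (simp_all add: path_src_def)
    note Fc = Lmor_hom[OF MA.sterm_cats[OF z]]
    note \<eta>s = eta_u_cells'[OF s] and \<eta>z = eta_u_cells'[OF z]
    \<comment> \<open>The hypothesis whiskers by the composite \<open>uM \<cdot> ?e\<close>; the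
      squares are first whiskered by \<open>uM\<close> and then restricted along
      \<open>?e\<close>.\<close>
    have \<mu>: "rwhisk K (eta_s K \<Sigma> \<sigma> M N F ?z) (uM \<cdot> ?e) = rwhisk K (eta_u ?z) ?e"
      by (rule M.rwhisk_comp1[OF eta_s_cells[OF z] MA.alg_u_hom e])
    have "?z \<in> eqn_coarity_terms \<Sigma> \<sigma> T"
      unfolding eqn_coarity_terms_def using x by (cases x) auto
    from monic[OF this] have mono: "monic2 K (rwhisk K (eta_u ?z) ?e)"
      unfolding \<mu> .
    \<comment> \<open>The square of either path of the equation, restricted along \<open>?e\<close>.
      Its right-hand side involves \<open>y\<close> only through the restricted cell in
      \<open>M\<close>, which is the same for both paths by \<open>eM\<close>.\<close>
    have step: "rwhisk K (path_cell K \<Sigma> \<sigma> N y) (G \<cdot> ?e) \<in> cells K ?E (Mob N ?c)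
          ((eval_alg K \<Sigma> \<sigma> N ?s \<cdot> G) \<cdot> ?e) ((eval_alg K \<Sigma> \<sigma> N ?z \<cdot> G) \<cdot> ?e) \<and>
        rwhisk K (eta_u ?z) ?e \<bullet> rwhisk K (path_cell K \<Sigma> \<sigma> N y) (G \<cdot> ?e) =
          lwhisk K (Lmor F ?c) (rwhisk K (path_cell K \<Sigma> \<sigma> M y) ?e) \<bullet> rwhisk K (eta_u ?s) ?e"
      if y: "is_gpath \<Sigma> \<sigma> y" "path_src y = ?s" "path_tgt \<Sigma> \<sigma> y = ?z" for y
    proof -
      have yM: "path_cell K \<Sigma> \<sigma> M y \<in> cells K MA.A (Mob M ?c) (eval_alg K \<Sigma> \<sigma> M ?s) (eval_alg K \<Sigma> \<sigma> M ?z)"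
        and yN: "path_cell K \<Sigma> \<sigma> N y \<in> cells K NA.A (Mob N ?c) (eval_alg K \<Sigma> \<sigma> N ?s) (eval_alg K \<Sigma> \<sigma> N ?z)"
        using MA.path_cell_cells[of "fst y" "snd y"] NA.path_cell_cells[of "fst y" "snd y"] y
        by (simp_all add: path_src_def)
      have nat: "lwhisk K (Lmor F ?c) (path_cell K \<Sigma> \<sigma> M y) \<bullet> eta_u ?s =
          eta_u ?z \<bullet> rwhisk K (path_cell K \<Sigma> \<sigma> N y) G"
        using path_natural[of "fst y" "snd y"] y by (simp add: path_src_def)
      note yNG = M.rwhisk_cells[OF yN alg_mor_hom]
      have "rwhisk K (eta_u ?z) ?e \<bullet> rwhisk K (rwhisk K (path_cell K \<Sigma> \<sigma> N y) G) ?e =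
          rwhisk K (lwhisk K (Lmor F ?c) (path_cell K \<Sigma> \<sigma> M y)) ?e \<bullet> rwhisk K (eta_u ?s) ?e"
        by (simp only: M.rwhisk_vcomp[OF \<eta>z yNG e, symmetric] nat[symmetric]
            M.rwhisk_vcomp[OF M.lwhisk_cells[OF Fc yM] \<eta>s e])
      then show ?thesis
        using M.rwhisk_cells[OF yNG e] M.rwhisk_comp1[OF yN alg_mor_hom e] M.lwhisk_rwhisk[OF Fc yM e] by simp
    qed
    note 1 = step[OF p(1) refl refl] and 2 = step[OF p(2,3,4)]
    have "rwhisk K (eta_u ?z) ?e \<bullet> rwhisk K (path_cell K \<Sigma> \<sigma> N (fst x)) (G \<cdot> ?e) =
        rwhisk K (eta_u ?z) ?e \<bullet> rwhisk K (path_cell K \<Sigma> \<sigma> N (snd x)) (G \<cdot> ?e)"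
      using 1 2 eM[OF x] by simp
    \<comment> \<open>By \<open>step\<close> the two cells are parallel and end at the domain of the
      monic cell, as the definition of \<open>monic2\<close> demands.\<close>
    then show ?thesis
      using mono cellsD(3)[OF conjunct1[OF 1]] cellsD(3)[OF conjunct1[OF 2]]
        cellsD(4)[OF M.rwhisk_cells[OF \<eta>z e]]
      unfolding monic2_def by metis
  qed
  have "rwhisk K (tup2 K T (eqn_ob \<Sigma> \<sigma> N) NA.A (\<lambda>x. path_cell K \<Sigma> \<sigma> N (fst x))) (G \<cdot> ?e) =
      rwhisk K (tup2 K T (eqn_ob \<Sigma> \<sigma> N) NA.A (\<lambda>x. path_cell K \<Sigma> \<sigma> N (snd x))) (G \<cdot> ?e)"
    using NA.equalized_iff[OF T Ge] eN by blast
  from equifier_universal[OF NA.equifier(1)[OF T] M.hom1_Obj(1)[OF e] _ this] Ge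
  show ?thesis
    unfolding NA.equifier(2)[OF T] by metis
qed

end

theorem theorem3p14:
  fixes K :: "('o, 'm, 't) two_cat"
    and \<Sigma> :: "('c, 'b, 'v, 'a) sig2"
    and \<sigma> :: "('c, 'b, 's, 'f) sig1"
    and T :: "('b, 's, 'a, 'f) eqn set"
    and M N :: "('c, 'b, 'a, 'o, 'm, 't) model"
    and F :: "('c, 'b, 'm, 't) lax_mor"
  assumes "two_category K"
    and "pie_complete TYPE('u::infinite) K"
    and "is_sig_pair TYPE('u) \<Sigma> \<sigma>"
    and "is_theory TYPE('u) \<Sigma> \<sigma> T"
    and "is_model K \<Sigma> M"
    and "is_model K \<Sigma> N"
    and "is_lax_mor K \<Sigma> M N F"
    and "\<And>t. t \<in> fun_coarity_terms \<sigma> \<Longrightarrow> iso2 K (eta_s K \<Sigma> \<sigma> M N F t)"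
    and "\<And>t. t \<in> eqn_coarity_terms \<Sigma> \<sigma> T \<Longrightarrow>
           monic2 K (rwhisk K (eta_s K \<Sigma> \<sigma> M N F t)
             (alg_u K \<Sigma> \<sigma> M \<cdot>\<^bsub>K\<^esub> bialg_e K \<Sigma> \<sigma> T M))"
  shows "(\<exists>!G. is_alg_mor K \<Sigma> \<sigma> M N F G) \<and>
    (\<exists>!H. H \<in> hom1 K (bialg_obj K \<Sigma> \<sigma> T M) (bialg_obj K \<Sigma> \<sigma> T N) \<and>
       bialg_e K \<Sigma> \<sigma> T N \<cdot>\<^bsub>K\<^esub> H = alg_mor K \<Sigma> \<sigma> M N F \<cdot>\<^bsub>K\<^esub> bialg_e K \<Sigma> \<sigma> T M)"
proof -
  interpret two_category K by (rule assms(1))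
  \<comment> \<open>Products of lists are indexed by initial segments of the naturals, which are
    small because \<open>'u\<close> is infinite.\<close>
  have products: "has_product K {..<length cs} (nth cs)" if "set cs \<subseteq> Obj K" for cs
    using assms(2) finite_small[OF finite_lessThan]
    by (rule pie_complete_has_product) (use that in \<open>auto simp: subset_iff\<close>)
  have types: "set (fdom \<Sigma> B) \<subseteq> cats \<Sigma>" "fcod \<Sigma> B \<in> cats \<Sigma>" if "B \<in> funs \<Sigma>" for B
    using assms(3) that by (auto simp: is_sig_pair_def is_sig2_def)
  interpret lax_algebra K \<Sigma> M N F \<sigma> "TYPE('u)"
    by unfold_locales (use products types assms(2,3,5-8) in \<open>auto simp: fun_coarity_terms_def\<close>)
  show ?thesis
    using ex1_alg_mor ex1_bialg_mor[OF assms(4,9)] by blast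
qed

end
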